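(* Fix $\alpha\in(0,1)$. For each $i\ge 1$ let $\epsilon_{i1},\epsilon_{i2},\ldots$ be independent and identically distributed random variables with zero mean, and put $\epsilon_i'=\epsilon_{i1}/(E\epsilon_{i1}^2)^{1/2}$. Assume that there is a constant $C>0$ (not depending on $i$ or $n$) such that $P(|\epsilon_i'|\le C)=1$ for each $i$. Let $N=N(n)\to\infty$ as $n\to\infty$ in such a manner that $\log N=o(n^{1/2})$. Let $\hat t_{i\alpha}$ be the bootstrap critical point for the $i$th test (defined in the context), and put $$p_i=P_{0i}(|T_i|>\hat t_{i\alpha}),$$ where $T_i$ is the Student's $t$ statistic of the $i$th sample and $P_{0i}$ is probability under the null hypothesis $\mu_i=0$. Then, as $n\to\infty$, $$\max_{1\le i\le N}p_i=o(1)\qquad\text{and}\qquad \sum_{i=1}^N p_i=-\log(1-\alpha)+o(1).$$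
   Context: Model: $Y_{ij}=\mu_i+\epsilon_{ij}$ for $i\ge1$, $1\le j\le n$, where the $\mu_i$ are constants and, for each $i$, the errors $\epsilon_{i1},\ldots,\epsilon_{in}$ are i.i.d. with zero mean. No independence between different values of $i$ is assumed. The null hypothesis $H_{0i}$ is $\mu_i=0$, and $P_{0i}$ denotes probability calculated under $H_{0i}$. The test statistic is $T_i=n^{1/2}\bar Y_i/S_i$, with $\bar Y_i=n^{-1}\sum_{j=1}^n Y_{ij}$ and $S_i^2=n^{-1}\sum_{j=1}^n(Y_{ij}-\bar Y_i)^2$. Bootstrap critical point. Let $\mathcal{Y}_i=\{Y_{i1},\ldots,Y_{in}\}$, and let $Y_{i1}^\dagger,\ldots,Y_{in}^\dagger$ be a resample drawn by sampling randomly, with replacement, from $\mathcal{Y}_i$ (that is, conditionally on $\mathcal{Y}_i$, independent draws each equal to $Y_{ij}$ with probability $1/n$ for $j=1,\ldots,n$). Put $Y_{ij}^*=Y_{ij}^\dagger-\bar Y_i$, $\bar Y_i^*=n^{-1}\sum_j Y_{ij}^*$, $(S_i^* )^2=n^{-1}\sum_j(Y_{ij}^*-\bar Y_i^* )^2$ and $T_i^*=n^{1/2}\bar Y_i^*/S_i^*$. For $\xi\in(0,1)$ let $z_\xi$ be the solution of $P(|Z|>z_\xi)=1-(1-\xi)^{1/N}$, where $Z$ is standard Normal. Let $\xi=\hat f_i(\alpha)$ be the solution of $$P(|T_i^*|>z_\xi\mid\mathcal{Y}_i)=1-(1-\alpha)^{1/N}.$$ The bootstrap critical point is $\hat t_{i\alpha}=z_{\hat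 f_i(\alpha)}$. It is a function of the data $\mathcal{Y}_i$, and $H_{0i}$ is rejected if and only if $|T_i|>\hat t_{i\alpha}$. The probability $p_i$ accounts for the randomness of both $T_i$ and $\hat t_{i\alpha}$.
   Formalization: As the resampling law is discrete, the equation defining f̂_i(α) has no exact or no unique solution; f̂_i(α) is taken as the supremum of ξ in (0,1) with P(|T_i*|>z_ξ | Y_i) ≤ 1−(1−α)^{1/N}, and T_i, T_i* are set to 0 when S_i, S_i* vanish. *)

theory Defs
  imports "HOL-Probability.Probability" "HOL-Library.Landau_Symbols"
begin

text \<open>
  A sample of size \<open>n\<close> is a function \<open>y :: nat \<Rightarrow> real\<close> of which only the values at
  \<open>1, \<dots>, n\<close> are used.
\<close>

definition sample_mean :: "nat \<Rightarrow> (nat \<Rightarrow> real) \<Rightarrow> real" where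
  "sample_mean n y = (\<Sum>j=1..n. y j) / real n"

definition sample_sd :: "nat \<Rightarrow> (nat \<Rightarrow> real) \<Rightarrow> real" where
  "sample_sd n y = sqrt ((\<Sum>j=1..n. (y j - sample_mean n y)\<^sup>2) / real n)"

text \<open>
  If the sample is constant then \<open>sample_sd n y = 0\<close> and the quotient is \<open>0\<close> by the
  convention \<open>x / 0 = 0\<close>; such a sample never leads to rejection.
\<close>

definition t_stat :: "nat \<Rightarrow> (nat \<Rightarrow> real) \<Rightarrow> real" where
  "t_stat n y = sqrt (real n) * sample_mean n y / sample_sd n y"

text \<open>\<open>n\<close> independent draws, each equal to \<open>y j\<close> with probability \<open>1/n\<close>, for \<open>j = 1, \<dots>, n\<close>.\<close>

definition resample :: "nat \<Rightarrow> (nat \<Rightarrow> real) \<Rightarrow> (nat \<Rightarrow> real) pmf" where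
  "resample n y = Pi_pmf {1..n} 0 (\<lambda>_. map_pmf y (pmf_of_set {1..n}))"

definition boot_t_stat :: "nat \<Rightarrow> (nat \<Rightarrow> real) \<Rightarrow> (nat \<Rightarrow> real) \<Rightarrow> real" where
  "boot_t_stat n y yd = t_stat n (\<lambda>j. yd j - sample_mean n y)"

text \<open>The conditional probability that \<open>\<bar>T\<^sup>*\<bar> > z\<close> given that the data are \<open>y\<close>.\<close>

definition boot_tail :: "nat \<Rightarrow> (nat \<Rightarrow> real) \<Rightarrow> real \<Rightarrow> real" where
  "boot_tail n y z = measure_pmf.prob (resample n y) {yd. \<bar>boot_t_stat n y yd\<bar> > z}"

definition level :: "nat \<Rightarrow> real \<Rightarrow> real" where
  "level N \<xi> = 1 - (1 - \<xi>) powr (1 / real N)"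

text \<open>
  For \<open>N \<ge> 1\<close> and \<open>0 < \<xi> < 1\<close> the solution is unique and positive. The restriction to
  \<open>z \<ge> 0\<close> only matters at \<open>\<xi> = 1\<close>, where it selects \<open>z = 0\<close>.
\<close>

definition normal_crit :: "nat \<Rightarrow> real \<Rightarrow> real" where
  "normal_crit N \<xi> =
     (THE z. z \<ge> 0 \<and> measure std_normal_distribution {x. \<bar>x\<bar> > z} = level N \<xi>)"

text \<open>
  The conditional distribution of the bootstrap statistic is discrete, so the equation
  \<open>boot_tail n y (normal_crit N \<xi>) = level N \<alpha>\<close> need not have a solution \<open>\<xi>\<close>, and if it
  has one it has an interval of them. Its left-hand side is a nondecreasing step function of
  \<open>\<xi>\<close>, and we solve the equation in the sense of quantiles, by a generalized inverse:
  \<open>boot_level\<close> is the largest \<open>\<xi>\<close> at which the left-hand side does not exceed the right-hand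
  side. The resulting critical point is the usual upper quantile of \<open>\<bar>T\<^sup>*\<bar>\<close>, the least
  \<open>t \<ge> 0\<close> with \<open>boot_tail n y t \<le> level N \<alpha>\<close>; if the equation has a solution, then
  \<open>boot_level\<close> is one as well, unless it equals \<open>1\<close>, in which case the critical point is \<open>0\<close>.
\<close>

definition boot_level :: "nat \<Rightarrow> nat \<Rightarrow> (nat \<Rightarrow> real) \<Rightarrow> real \<Rightarrow> real" where
  "boot_level n N y \<alpha> =
     Sup {\<xi>. 0 < \<xi> \<and> \<xi> < 1 \<and> boot_tail n y (normal_crit N \<xi>) \<le> level N \<alpha>}"

definition boot_crit :: "nat \<Rightarrow> nat \<Rightarrow> (nat \<Rightarrow> real) \<Rightarrow> real \<Rightarrow> real" where
  "boot_crit n N y \<alpha> = normal_crit N (boot_level n N y \<alpha>)"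

text \<open>
  Probability of rejection for the data \<open>Y\<^sub>j = \<mu> + e\<^sub>j\<close>; the null hypothesis is \<open>\<mu> = 0\<close>.
\<close>

definition rejection_prob ::
  "'a measure \<Rightarrow> nat \<Rightarrow> nat \<Rightarrow> real \<Rightarrow> real \<Rightarrow> (nat \<Rightarrow> 'a \<Rightarrow> real) \<Rightarrow> real" where
  "rejection_prob M n N \<alpha> \<mu> e =
     measure M {\<omega> \<in> space M.
       \<bar>t_stat n (\<lambda>j. \<mu> + e j \<omega>)\<bar> > boot_crit n N (\<lambda>j. \<mu> + e j \<omega>) \<alpha>}"

end

theory Submission
  imports Defs "HOL-Real_Asymp.Real_Asymp"
begin

text \<open>
  Normalise \<open>E \<epsilon>\<^sup>2 = 1\<close> and put \<open>\<kappa> = E \<epsilon>\<^sup>3\<close>, \<open>V = \<Sum> X\<^sub>j\<^sup>2\<close>. The event \<open>T > u / sqrt (1 - u\<^sup>2/n)\<close> is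
  \<open>\<Sum> X\<^sub>j > u sqrt V\<close>, and \<open>u sqrt V \<le> u (V / sqrt n + sqrt n) / 2\<close> with an error that is negligible
  compared with \<open>1/u\<close>. So Student's statistic may be replaced by the sum \<open>W\<close> of the independent
  variables \<open>(X\<^sub>j - b (X\<^sub>j\<^sup>2 - 1) / 2) / sqrt n\<close> with \<open>b = u / sqrt n\<close>. Tilting by \<open>exp (u W)\<close> and using
  \[ E \exp ((b + i\theta) (X - b (X^2 - 1) / 2))
     = \exp ((b + i\theta)^2 / 2 - \kappa b^3 / 3) + O(b^4 + b^2 |\theta| + |\theta|^3), \]
  the tail probability reduces to a local limit theorem for \<open>W\<close> on the scale \<open>1/u\<close>. It suffices to
  prove it after adding Gaussian noise with standard deviation \<open>\<tau>/u\<close>, where it follows from Fourier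
  inversion; no Berry--Esseen bound is needed. The result is
  \[ P (T > u / \sqrt{1 - u^2/n}) \sim \exp (- u^2 / 2 - \kappa u^3 / (3 \sqrt n)) / (u \sqrt{2\pi}), \]
  uniformly over all standardised laws bounded by a given constant and all large \<open>u = o(n\<^sup>1\<^sup>/\<^sup>4)\<close>.

  By Hoeffding's inequality the standardised empirical law is, outside an event of probability
  \<open>exp (- c sqrt n) = o(1/N)\<close>, bounded by \<open>4 C\<close> and has a skewness within \<open>O(n\<^sup>-\<^sup>1\<^sup>/\<^sup>4)\<close> of \<open>\<kappa>\<close>, which
  changes the tail only by a factor \<open>1 + o(1)\<close>. So the tails of \<open>T\<close> and of its bootstrap version
  agree up to such a factor, the bootstrap critical point lies between two constants at which the
  tail of \<open>\<bar>T\<bar>\<close> is \<open>1 + o(1)\<close> times \<open>1 - (1 - \<alpha>)\<^sup>1\<^sup>/\<^sup>N\<close>, and every \<open>p\<^sub>i\<close> is \<open>(1 + o(1)) (- ln (1 - \<alpha>)) / N\<close>.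
\<close>

section \<open>The tilted moment generating function\<close>

locale std_law = prob_space \<nu> for \<nu> :: "real measure" and C :: real +
  assumes sets_law [measurable_cong]: "sets \<nu> = sets borel"
    and bounded_law: "AE x in \<nu>. \<bar>x\<bar> \<le> C"
    and mean_law: "(\<integral>x. x \<partial>\<nu>) = 0"
    and variance_law: "(\<integral>x. x\<^sup>2 \<partial>\<nu>) = 1"
begin

definition skew :: real where "skew = (\<integral>x. x ^ 3 \<partial>\<nu>)"

lemma space_law [simp]: "space \<nu> = UNIV"
  using sets_eq_imp_space_eq[OF sets_law] by simp

lemma integrable_on_law:
  fixes f :: "real \<Rightarrow> 'b::{banach, second_countable_topology}"
  assumes [measurable]: "f \<in> borel_measurable borel"
    and "\<And>x. \<bar>x\<bar> \<le> C \<Longrightarrow> norm (f x) \<le> B"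
  shows "integrable \<nu> f"
  by (rule integrable_const_bound[of _ B]) (use bounded_law assms(2) in auto)

lemma integrable_continuous_law:
  fixes f :: "real \<Rightarrow> 'b::{banach, second_countable_topology}"
  assumes "continuous_on UNIV f"
  shows "integrable \<nu> f"
proof -
  have "compact (f ` {-C..C})"
    by (intro compact_continuous_image continuous_on_subset[OF assms]) auto
  then obtain B where B: "\<And>x. x \<in> {-C..C} \<Longrightarrow> norm (f x) \<le> B"
    by (meson bounded_iff compact_imp_bounded imageI)
  show ?thesis
    by (rule integrable_on_law[of _ B]) (use assms B in \<open>auto intro: borel_measurable_continuous_onI simp: abs_le_iff\<close>)
qed

lemma C_nonneg: "0 \<le> C"
proof -
  have "AE x in \<nu>. 0 \<le> C"
    using bounded_law by eventually_elim linarith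
  thus ?thesis by simp
qed

lemma norm_integral_law_le:
  fixes f :: "real \<Rightarrow> 'b::{banach, second_countable_topology}"
  assumes "\<And>x. \<bar>x\<bar> \<le> C \<Longrightarrow> norm (f x) \<le> B"
  shows "norm (\<integral>x. f x \<partial>\<nu>) \<le> B"
proof (cases "integrable \<nu> f")
  case True
  have "norm (\<integral>x. f x \<partial>\<nu>) \<le> (\<integral>x. norm (f x) \<partial>\<nu>)" by (rule integral_norm_bound)
  also have "\<dots> \<le> (\<integral>x. B \<partial>\<nu>)"
    by (rule integral_mono_AE) (use True bounded_law assms in auto)
  finally show ?thesis using prob_space by simp
next
  case False
  have "0 \<le> B" using assms[of 0] C_nonneg norm_ge_zero[of "f 0"] by linarith
  with False show ?thesis by (simp add: not_integrable_integral_eq)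
qed

lemma C_ge_1: "C \<ge> 1"
proof -
  have "norm (\<integral>x. x\<^sup>2 \<partial>\<nu>) \<le> C\<^sup>2"
    by (rule norm_integral_law_le) (metis abs_le_square_iff abs_of_nonneg C_nonneg norm_power power2_abs real_norm_def)
  hence "1\<^sup>2 \<le> C\<^sup>2" by (simp add: variance_law)
  thus ?thesis using C_nonneg power2_le_imp_le by blast
qed

lemma abs_skew_le: "\<bar>skew\<bar> \<le> C"
proof -
  have "\<bar>skew\<bar> \<le> (\<integral>x. \<bar>x ^ 3\<bar> \<partial>\<nu>)" unfolding skew_def by (rule integral_abs_bound)
  also have "\<dots> \<le> (\<integral>x. C * x\<^sup>2 \<partial>\<nu>)"
  proof (rule integral_mono_AE)
    show "AE x in \<nu>. \<bar>x ^ 3\<bar> \<le> C * x\<^sup>2"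
      using bounded_law
      by eventually_elim (simp add: power3_eq_cube power2_eq_square abs_mult mult_right_mono mult.assoc)
  qed (intro integrable_continuous_law continuous_intros)+
  finally show ?thesis by (simp add: variance_law)
qed

end

text \<open>With \<open>b = u / sqrt n\<close>, this is the linearisation at \<open>V = n\<close> of \<open>\<Sum> X\<^sub>j - u sqrt V\<close>, up to constants.\<close>

definition tilt_arg :: "real \<Rightarrow> real \<Rightarrow> real" where
  "tilt_arg b x = x - b * (x\<^sup>2 - 1) / 2"

lemma continuous_on_tilt_arg [continuous_intros]: "continuous_on A (tilt_arg b)"
  unfolding tilt_arg_def by (intro continuous_intros) auto

lemma tilt_arg_measurable [measurable]: "tilt_arg b \<in> borel_measurable borel"
  by (intro borel_measurable_continuous_onI continuous_intros)

lemma exp_cubic_remainder: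
  fixes z :: complex
  shows "norm (exp z - (1 + z + z\<^sup>2 / 2 + z ^ 3 / 6)) \<le> exp (norm z) * norm z ^ 4"
proof -
  have "norm (exp z - (\<Sum>i\<le>3. z ^ i / fact i)) \<le> exp (norm z) * (norm z ^ Suc 3) / fact 3"
    by (rule Taylor_exp_field)
  also have "\<dots> \<le> exp (norm z) * norm z ^ 4"
    by (simp add: fact_numeral field_simps)
  finally show ?thesis
    by (simp add: fact_numeral numeral_eq_Suc)
qed

lemma exp_linear_remainder:
  fixes z :: complex
  shows "norm (exp z - (1 + z)) \<le> exp (norm z) * norm z ^ 2"
proof -
  have "norm (exp z - (\<Sum>i\<le>1. z ^ i / fact i)) \<le> exp (norm z) * (norm z ^ Suc 1) / fact 1"
    by (rule Taylor_exp_field)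
  thus ?thesis by (simp add: numeral_eq_Suc)
qed

lemma exp_tilt_pointwise:
  fixes w :: complex and b x C :: real
  assumes "1 \<le> C" "\<bar>x\<bar> \<le> C" "0 \<le> b" "b \<le> 1" "b \<le> norm w" "norm w \<le> 2"
  defines "B \<equiv> C + C\<^sup>2"
  shows "norm (exp (w * tilt_arg b x) -
      ((1 + w * b / 2) + (w + w\<^sup>2 * b / 2) * x + (w\<^sup>2 / 2 - w * b / 2) * x\<^sup>2
         + (w ^ 3 / 6 - w\<^sup>2 * b / 2) * x ^ 3))
    \<le> 3 * exp (2 * B) * B ^ 4 * norm w ^ 4" (is "norm (_ - ?p) \<le> _")
proof -
  define d where "d = b * (x\<^sup>2 - 1) / 2"
  define r where "r = norm w"
  have r: "0 \<le> r" "r \<le> 2" "b \<le> r" using assms by (auto simp: r_def)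
  have x2: "x\<^sup>2 \<le> C\<^sup>2" using assms by (simp add: abs_le_square_iff[symmetric])
  have C2: "1 \<le> C\<^sup>2" using assms(1) by (simp add: one_le_power)
  have x21: "\<bar>x\<^sup>2 - 1\<bar> \<le> C\<^sup>2"
    using x2 C2 zero_le_power2[of x] unfolding abs_le_iff by linarith
  have d_le: "\<bar>d\<bar> \<le> b * C\<^sup>2"
  proof -
    have "\<bar>d\<bar> = b * \<bar>x\<^sup>2 - 1\<bar> / 2" using assms by (simp add: d_def abs_mult)
    also have "\<dots> \<le> b * C\<^sup>2 / 2" using x21 assms by (intro divide_right_mono mult_left_mono) auto
    also have "\<dots> \<le> b * C\<^sup>2" using assms C2 by simp
    finally show ?thesis .
  qed
  have dC: "b * C\<^sup>2 \<le> C\<^sup>2" using assms C2 by (simp add: mult_left_le_one_le)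
  have B: "C \<le> B" "1 \<le> B" "C\<^sup>2 \<le> B" using assms(1) C2 unfolding B_def by linarith+
  have y_le: "\<bar>tilt_arg b x\<bar> \<le> B"
  proof -
    have "tilt_arg b x = x - d" by (simp add: tilt_arg_def d_def)
    thus ?thesis using d_le dC assms(2) unfolding B_def by linarith
  qed
  define y where "y = tilt_arg b x"
  have y: "y = x - d" by (simp add: y_def tilt_arg_def d_def)
  define z where "z = w * y"
  have nz: "norm z \<le> r * B"
    using y_le r unfolding z_def r_def y_def by (simp add: norm_mult mult_left_mono)
  have nz2: "norm z \<le> 2 * B"
    using nz r B by (meson mult_right_mono order_trans zero_le_one)
  have R1: "norm (exp z - (1 + z + z\<^sup>2 / 2 + z ^ 3 / 6)) \<le> exp (2 * B) * B ^ 4 * r ^ 4"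
  proof -
    have "norm (exp z - (1 + z + z\<^sup>2 / 2 + z ^ 3 / 6)) \<le> exp (norm z) * norm z ^ 4"
      by (rule exp_cubic_remainder)
    also have "\<dots> \<le> exp (2 * B) * (r * B) ^ 4"
      using nz nz2 by (intro mult_mono power_mono) auto
    finally show ?thesis by (simp add: power_mult_distrib algebra_simps)
  qed
  have eq: "(1 + z + z\<^sup>2 / 2 + z ^ 3 / 6) - ?p = w\<^sup>2 / 2 * d\<^sup>2 + w ^ 3 / 6 * (y ^ 3 - x ^ 3)"
  proof -
    have cd: "complex_of_real d = b * (x\<^sup>2 - 1) / 2" by (simp add: d_def)
    have p: "?p = 1 + w * x - w * d + w\<^sup>2 / 2 * x\<^sup>2 - w\<^sup>2 * x * d + w ^ 3 / 6 * x ^ 3"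
      unfolding cd by (simp add: algebra_simps power2_eq_square power3_eq_cube add_divide_distrib diff_divide_distrib)
    show ?thesis unfolding z_def p y
      by (simp add: algebra_simps power2_eq_square power3_eq_cube add_divide_distrib diff_divide_distrib)
  qed
  have R2: "norm (w\<^sup>2 / 2 * (d\<^sup>2)) \<le> B ^ 4 * r ^ 4"
  proof -
    have "\<bar>d\<bar> \<le> r * B" using d_le r B C2 assms(3)
      by (meson mult_mono order_trans zero_le_power2)
    hence "d\<^sup>2 \<le> (r * B)\<^sup>2" by (rule power2_le_iff_abs_le[THEN iffD2, rotated]) (use r B in simp)
    hence "norm (w\<^sup>2 / 2 * (d\<^sup>2)) \<le> r\<^sup>2 / 2 * (r * B)\<^sup>2"
      by (simp add: norm_mult norm_divide norm_power r_def mult_left_mono divide_right_mono)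
    also have "\<dots> = B\<^sup>2 * r ^ 4 / 2"
      by (simp add: power2_eq_square power3_eq_cube power4_eq_xxxx)
    also have "\<dots> \<le> B\<^sup>2 * r ^ 4" by simp
    also have "\<dots> \<le> B ^ 4 * r ^ 4" using B by (intro mult_right_mono power_increasing) auto
    finally show ?thesis .
  qed
  have R3: "norm (w ^ 3 / 6 * (y ^ 3 - x ^ 3)) \<le> B ^ 4 * r ^ 4"
  proof -
    have e: "y ^ 3 - x ^ 3 = - d * (y\<^sup>2 + y * x + x\<^sup>2)"
      by (simp add: y algebra_simps power2_eq_square power3_eq_cube)
    have yB: "\<bar>y\<bar> \<le> B" "\<bar>x\<bar> \<le> B" using y_le assms(2) B by (auto simp: y_def)
    have "\<bar>y\<^sup>2 + y * x + x\<^sup>2\<bar> \<le> \<bar>y\<bar> * \<bar>y\<bar> + \<bar>y\<bar> * \<bar>x\<bar> + \<bar>x\<bar> * \<bar>x\<bar>"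
      unfolding power2_eq_square abs_mult[symmetric] by linarith
    also have "\<dots> \<le> B * B + B * B + B * B"
      using yB B by (intro add_mono mult_mono) auto
    finally have q: "\<bar>y\<^sup>2 + y * x + x\<^sup>2\<bar> \<le> 3 * B\<^sup>2" by (simp add: power2_eq_square)
    have "\<bar>y ^ 3 - x ^ 3\<bar> \<le> (r * B) * (3 * B\<^sup>2)"
    proof -
      have "\<bar>d\<bar> \<le> r * B" using d_le r B C2 assms(3)
        by (meson mult_mono order_trans zero_le_power2)
      thus ?thesis unfolding e abs_mult abs_minus_cancel using q by (intro mult_mono) auto
    qed
    hence "norm (w ^ 3 / 6 * (y ^ 3 - x ^ 3)) \<le> r ^ 3 / 6 * ((r * B) * (3 * B\<^sup>2))"
      using mult_left_mono[of "\<bar>y ^ 3 - x ^ 3\<bar>" "(r * B) * (3 * B\<^sup>2)" "r ^ 3 / 6"] r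
      by (simp only: norm_mult norm_divide norm_power norm_of_real norm_numeral flip: r_def) simp
    also have "\<dots> = B ^ 3 * r ^ 4 / 2"
      by (simp add: power2_eq_square power3_eq_cube power4_eq_xxxx)
    also have "\<dots> \<le> B ^ 3 * r ^ 4" using B r by simp
    also have "\<dots> \<le> B ^ 4 * r ^ 4" using B by (intro mult_right_mono power_increasing) auto
    finally show ?thesis .
  qed
  have "norm (exp z - ?p) \<le> norm (exp z - (1 + z + z\<^sup>2 / 2 + z ^ 3 / 6))
      + norm (w\<^sup>2 / 2 * (d\<^sup>2)) + norm (w ^ 3 / 6 * (y ^ 3 - x ^ 3))"
  proof -
    have "exp z - ?p = (exp z - (1 + z + z\<^sup>2 / 2 + z ^ 3 / 6)) + (w\<^sup>2 / 2 * d\<^sup>2 + w ^ 3 / 6 * (y ^ 3 - x ^ 3))"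
      using eq by (simp add: algebra_simps)
    thus ?thesis by (metis (no_types, lifting) norm_triangle_mono norm_triangle_ineq order_refl add.assoc of_real_power)
  qed
  also have "\<dots> \<le> exp (2 * B) * B ^ 4 * r ^ 4 + B ^ 4 * r ^ 4 + B ^ 4 * r ^ 4"
    using R1 R2 R3 by linarith
  also have "\<dots> \<le> exp (2 * B) * B ^ 4 * r ^ 4 + exp (2 * B) * B ^ 4 * r ^ 4 + exp (2 * B) * B ^ 4 * r ^ 4"
  proof -
    have "1 * (B ^ 4 * r ^ 4) \<le> exp (2 * B) * (B ^ 4 * r ^ 4)"
      using B r by (intro mult_right_mono) auto
    thus ?thesis unfolding mult.assoc by linarith
  qed
  finally show ?thesis by (simp add: z_def y_def r_def algebra_simps)
qed

definition tilt_const :: "real \<Rightarrow> real" where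
  "tilt_const C = 6 * exp (2 * (C + C\<^sup>2)) * (C + C\<^sup>2) ^ 4 + 8 * C\<^sup>2 * exp (8 * C) + C"

lemma (in std_law) integral_exp_tilt:
  fixes b \<theta> :: real
  assumes b: "0 \<le> b" "b \<le> 1" and \<theta>: "\<bar>\<theta>\<bar> \<le> 1"
  defines "w \<equiv> Complex b \<theta>"
  shows "norm ((\<integral>x. exp (w * tilt_arg b x) \<partial>\<nu>) - exp (w\<^sup>2 / 2 - skew * b ^ 3 / 3))
    \<le> tilt_const C * (b ^ 4 + b\<^sup>2 * \<bar>\<theta>\<bar> + \<bar>\<theta>\<bar> ^ 3)"
proof -
  define B where "B = C + C\<^sup>2"
  define K where "K = 3 * exp (2 * B) * B ^ 4"
  define r where "r = norm w"
  have b_r: "b \<le> r" and r2: "r \<le> 2" and r0: "0 \<le> r"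
    using complex_Re_le_cmod[of w] cmod_le[of w] b \<theta> by (auto simp: r_def w_def)
  have rsq: "r\<^sup>2 = b\<^sup>2 + \<theta>\<^sup>2" by (simp add: r_def w_def cmod_power2)
  have r4: "r ^ 4 \<le> 2 * (b ^ 4 + \<bar>\<theta>\<bar> ^ 3)"
  proof -
    have "r ^ 4 = (b\<^sup>2 + \<theta>\<^sup>2)\<^sup>2" by (simp flip: rsq)
    also have "\<dots> \<le> 2 * ((b\<^sup>2)\<^sup>2 + (\<theta>\<^sup>2)\<^sup>2)"
      using sum_squares_bound[of "b\<^sup>2" "\<theta>\<^sup>2"] by (simp add: power2_sum)
    also have "(\<theta>\<^sup>2)\<^sup>2 = \<bar>\<theta>\<bar> ^ 4" by simp
    also have "\<dots> \<le> \<bar>\<theta>\<bar> ^ 3" using \<theta> by (intro power_decreasing) auto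
    finally show ?thesis by simp
  qed
  define p where "p x = (1 + w * b / 2) + (w + w\<^sup>2 * b / 2) * x + (w\<^sup>2 / 2 - w * b / 2) * x\<^sup>2
         + (w ^ 3 / 6 - w\<^sup>2 * b / 2) * x ^ 3" for x :: real
  have int_p: "(\<integral>x. p x \<partial>\<nu>) = 1 + w\<^sup>2 / 2 - w\<^sup>2 * b * skew / 2 + w ^ 3 * skew / 6"
  proof -
    have i: "integrable \<nu> (\<lambda>x. complex_of_real (x ^ k))" for k
      by (intro integrable_continuous_law continuous_intros)
    have e: "(\<integral>x. complex_of_real (x ^ k) \<partial>\<nu>) = complex_of_real (\<integral>x. x ^ k \<partial>\<nu>)" for k
      by (rule integral_complex_of_real)
    have "p x = (1 + w * b / 2) + (w + w\<^sup>2 * b / 2) * complex_of_real (x ^ 1)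
        + (w\<^sup>2 / 2 - w * b / 2) * complex_of_real (x\<^sup>2)
        + (w ^ 3 / 6 - w\<^sup>2 * b / 2) * complex_of_real (x ^ 3)" for x
      by (simp add: p_def)
    hence "(\<integral>x. p x \<partial>\<nu>) = (\<integral>x. (1 + w * b / 2) + (w + w\<^sup>2 * b / 2) * complex_of_real (x ^ 1)
        + (w\<^sup>2 / 2 - w * b / 2) * complex_of_real (x\<^sup>2)
        + (w ^ 3 / 6 - w\<^sup>2 * b / 2) * complex_of_real (x ^ 3) \<partial>\<nu>)"
      by (simp only:)
    also have "\<dots> = (1 + w * b / 2) + (w + w\<^sup>2 * b / 2) * (\<integral>x. complex_of_real (x ^ 1) \<partial>\<nu>)
        + (w\<^sup>2 / 2 - w * b / 2) * (\<integral>x. complex_of_real (x\<^sup>2) \<partial>\<nu>)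
        + (w ^ 3 / 6 - w\<^sup>2 * b / 2) * (\<integral>x. complex_of_real (x ^ 3) \<partial>\<nu>)"
      using i[of 1] i[of 2] i[of 3] prob_space by (simp del: of_real_power)
    also have "\<dots> = (1 + w * b / 2) + (w\<^sup>2 / 2 - w * b / 2) + (w ^ 3 / 6 - w\<^sup>2 * b / 2) * skew"
      unfolding e by (simp add: mean_law variance_law skew_def)
    finally show ?thesis by (simp add: algebra_simps)
  qed
  have t1: "norm ((\<integral>x. exp (w * tilt_arg b x) \<partial>\<nu>) - (\<integral>x. p x \<partial>\<nu>)) \<le> K * r ^ 4"
  proof -
    have "(\<integral>x. exp (w * tilt_arg b x) \<partial>\<nu>) - (\<integral>x. p x \<partial>\<nu>) = (\<integral>x. exp (w * tilt_arg b x) - p x \<partial>\<nu>)"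
      by (intro Bochner_Integration.integral_diff[symmetric] integrable_continuous_law)
         (auto simp: p_def intro!: continuous_intros)
    also have "norm \<dots> \<le> K * r ^ 4"
      unfolding p_def K_def r_def B_def
      by (intro norm_integral_law_le exp_tilt_pointwise) (use b C_ge_1 b_r r2 in \<open>auto simp: r_def\<close>)
    finally show ?thesis .
  qed
  define v where "v = w\<^sup>2 / 2 - skew * b ^ 3 / 3"
  have nv: "norm v \<le> 2 * C * r\<^sup>2"
  proof -
    have "norm v \<le> norm (w\<^sup>2 / 2) + norm (complex_of_real (skew * b ^ 3 / 3))"
      unfolding v_def by (metis norm_triangle_ineq4 of_real_mult of_real_divide of_real_power of_real_numeral)
    also have "\<dots> = r\<^sup>2 / 2 + \<bar>skew\<bar> * b ^ 3 / 3"
      using b by (simp add: norm_divide norm_power r_def abs_mult norm_mult power_abs)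
    also have "\<dots> \<le> r\<^sup>2 / 2 + C * r\<^sup>2 / 3"
    proof -
      have "b ^ 3 \<le> b\<^sup>2" using b by (intro power_decreasing) auto
      also have "\<dots> \<le> r\<^sup>2" using b b_r by (intro power_mono) auto
      finally have "\<bar>skew\<bar> * b ^ 3 \<le> C * r\<^sup>2"
        using abs_skew_le b C_nonneg by (intro mult_mono) auto
      thus ?thesis by simp
    qed
    also have "\<dots> \<le> C * r\<^sup>2 + C * r\<^sup>2"
      using mult_right_mono[OF C_ge_1, of "r\<^sup>2"] zero_le_power2[of r] by linarith
    finally show ?thesis by simp
  qed
  have t2: "norm (exp v - (1 + v)) \<le> exp (8 * C) * (4 * C\<^sup>2) * r ^ 4"
  proof -
    have r24: "r\<^sup>2 \<le> 2\<^sup>2" using r0 r2 by (intro power_mono) auto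
    have "norm v \<le> 8 * C" using nv mult_left_mono[OF r24, of "2 * C"] C_nonneg by simp
    hence "exp (norm v) * norm v ^ 2 \<le> exp (8 * C) * (2 * C * r\<^sup>2)\<^sup>2"
      using nv by (intro mult_mono power_mono) auto
    also have "\<dots> = exp (8 * C) * (4 * C\<^sup>2) * r ^ 4" by (simp add: power_mult_distrib)
    finally show ?thesis using exp_linear_remainder[of v] by linarith
  qed
  have t3: "norm ((\<integral>x. p x \<partial>\<nu>) - (1 + v)) \<le> C * (b\<^sup>2 * \<bar>\<theta>\<bar> + \<bar>\<theta>\<bar> ^ 3)"
  proof -
    have w_eq: "w = complex_of_real b + \<i> * complex_of_real \<theta>" by (simp add: w_def complex_eq_iff)
    have "(\<integral>x. p x \<partial>\<nu>) - (1 + v) = - \<i> * complex_of_real (skew * (b\<^sup>2 * \<theta> / 2 + \<theta> ^ 3 / 6))"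
      unfolding int_p v_def w_eq
      by (simp add: field_simps power2_eq_square power3_eq_cube)
    hence "norm ((\<integral>x. p x \<partial>\<nu>) - (1 + v)) = \<bar>skew\<bar> * \<bar>b\<^sup>2 * \<theta> / 2 + \<theta> ^ 3 / 6\<bar>"
      by (simp only: norm_mult norm_minus_cancel norm_ii mult_1 norm_of_real abs_mult)
    also have "\<dots> \<le> C * (b\<^sup>2 * \<bar>\<theta>\<bar> + \<bar>\<theta>\<bar> ^ 3)"
    proof (rule mult_mono)
      have "\<bar>b\<^sup>2 * \<theta> / 2 + \<theta> ^ 3 / 6\<bar> \<le> b\<^sup>2 * \<bar>\<theta>\<bar> / 2 + \<bar>\<theta>\<bar> ^ 3 / 6"
        by (rule order_trans[OF abs_triangle_ineq]) (simp add: abs_mult power_abs)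
      also have "\<dots> \<le> b\<^sup>2 * \<bar>\<theta>\<bar> + \<bar>\<theta>\<bar> ^ 3"
        by (intro add_mono) auto
      finally show "\<bar>b\<^sup>2 * \<theta> / 2 + \<theta> ^ 3 / 6\<bar> \<le> b\<^sup>2 * \<bar>\<theta>\<bar> + \<bar>\<theta>\<bar> ^ 3" .
    qed (use abs_skew_le C_nonneg in auto)
    finally show ?thesis .
  qed
  have "norm ((\<integral>x. exp (w * tilt_arg b x) \<partial>\<nu>) - exp v)
      \<le> K * r ^ 4 + C * (b\<^sup>2 * \<bar>\<theta>\<bar> + \<bar>\<theta>\<bar> ^ 3) + exp (8 * C) * (4 * C\<^sup>2) * r ^ 4"
  proof -
    have "norm (a - d) \<le> norm (a - b) + norm (b - c) + norm (d - c)" for a b c d :: complex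
      by norm
    from this[of _ _ "\<integral>x. p x \<partial>\<nu>" "1 + v"] t1 t2 t3 show ?thesis by (meson add_mono order_trans)
  qed
  also have "\<dots> = (K + exp (8 * C) * (4 * C\<^sup>2)) * r ^ 4 + C * (b\<^sup>2 * \<bar>\<theta>\<bar> + \<bar>\<theta>\<bar> ^ 3)"
    by (simp add: algebra_simps)
  also have "\<dots> \<le> (K + exp (8 * C) * (4 * C\<^sup>2)) * (2 * (b ^ 4 + b\<^sup>2 * \<bar>\<theta>\<bar> + \<bar>\<theta>\<bar> ^ 3))
      + C * (b ^ 4 + b\<^sup>2 * \<bar>\<theta>\<bar> + \<bar>\<theta>\<bar> ^ 3)"
  proof (intro add_mono mult_left_mono)
    show "r ^ 4 \<le> 2 * (b ^ 4 + b\<^sup>2 * \<bar>\<theta>\<bar> + \<bar>\<theta>\<bar> ^ 3)" by (rule order_trans[OF r4]) auto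
    show "0 \<le> K + exp (8 * C) * (4 * C\<^sup>2)" using C_nonneg by (auto simp: K_def B_def)
  qed (use C_nonneg in auto)
  also have "\<dots> = tilt_const C * (b ^ 4 + b\<^sup>2 * \<bar>\<theta>\<bar> + \<bar>\<theta>\<bar> ^ 3)"
    by (simp add: tilt_const_def K_def B_def algebra_simps)
  finally show ?thesis by (simp add: v_def)
qed

lemma norm_power_Suc_diff_le:
  fixes z w :: "'a::real_normed_field"
  assumes "norm z \<le> \<rho>" "norm w \<le> \<rho>"
  shows "norm (z ^ Suc m - w ^ Suc m) \<le> real (Suc m) * \<rho> ^ m * norm (z - w)"
proof (induction m)
  case (Suc m)
  have r: "0 \<le> \<rho>" using assms(1) norm_ge_zero order_trans by blast
  have "z ^ Suc (Suc m) - w ^ Suc (Suc m) = z * (z ^ Suc m - w ^ Suc m) + w ^ Suc m * (z - w)"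
    by (simp add: algebra_simps)
  also have "norm \<dots> \<le> norm z * norm (z ^ Suc m - w ^ Suc m) + norm w ^ Suc m * norm (z - w)"
    by (metis norm_mult norm_power norm_triangle_ineq)
  also have "\<dots> \<le> \<rho> * (real (Suc m) * \<rho> ^ m * norm (z - w)) + \<rho> ^ Suc m * norm (z - w)"
    using Suc r assms by (intro add_mono mult_mono power_mono) auto
  finally show ?case by (simp add: algebra_simps)
qed simp

context std_law
begin

definition tilt_mgf :: "real \<Rightarrow> complex \<Rightarrow> complex" where
  "tilt_mgf b w = (\<integral>x. exp (w * tilt_arg b x) \<partial>\<nu>)"

definition tilt_rate :: "nat \<Rightarrow> real \<Rightarrow> real" where
  "tilt_rate n h = h\<^sup>2 / 2 - skew * h ^ 3 / (3 * sqrt n)"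

lemma tilt_const_ge: "C \<le> tilt_const C" "1 \<le> tilt_const C"
proof -
  show "C \<le> tilt_const C" using C_nonneg by (simp add: tilt_const_def)
  thus "1 \<le> tilt_const C" using C_ge_1 by linarith
qed

lemma tilt_mgf_power:
  fixes n :: nat and h e t :: real
  defines "K \<equiv> tilt_const C"
  assumes n: "0 < n" and h: "0 \<le> h" "h\<^sup>2 \<le> e * sqrt n" and e: "1 \<le> e * sqrt n" "e \<le> 1 / (4 * K)"
    and t: "\<bar>t\<bar> \<le> sqrt n / (16 * K)"
  shows "norm (tilt_mgf (h / sqrt n) (Complex (h / sqrt n) (t / sqrt n)) ^ n
            - exp (Complex (tilt_rate n h - t\<^sup>2 / 2) (h * t)))
         \<le> 3 * K * e * (1 + \<bar>t\<bar> + \<bar>t\<bar> ^ 3) * exp (tilt_rate n h - t\<^sup>2 / 4)"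
proof -
  define b where "b = h / sqrt n"
  define \<theta> where "\<theta> = t / sqrt n"
  define w where "w = Complex b \<theta>"
  define D where "D = K * (b ^ 4 + b\<^sup>2 * \<bar>\<theta>\<bar> + \<bar>\<theta>\<bar> ^ 3)"
  define \<alpha> where "\<alpha> = b\<^sup>2 / 2 - skew * b ^ 3 / 3"
  have K: "1 \<le> K" "C \<le> K" using tilt_const_ge by (auto simp: K_def)
  have sn: "sqrt n > 0" using n by simp
  have e0: "0 < e" using e(1) sn by (smt (verit) mult_nonpos_nonneg)
  have b0: "0 \<le> b" using h sn by (simp add: b_def)
  have b2: "b\<^sup>2 * n = h\<^sup>2" and h_b: "h = b * sqrt n" and t_th: "t = \<theta> * sqrt n"
    using n by (auto simp: b_def \<theta>_def power_divide)
  have be: "b \<le> e"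
  proof (rule power2_le_imp_le)
    have "b\<^sup>2 * n \<le> e * sqrt n * 1" using h b2 by simp
    also have "\<dots> \<le> e * sqrt n * (e * sqrt n)" using e e0 sn by (intro mult_left_mono) auto
    also have "\<dots> = e\<^sup>2 * n" using n by (simp add: power2_eq_square)
    finally show "b\<^sup>2 \<le> e\<^sup>2" using n by simp
  qed (use e0 in simp)
  have eK: "e * K \<le> 1 / 4" using e(2) K by (simp add: field_simps)
  have e4: "e \<le> 1 / 4"
  proof -
    have "e * 1 \<le> e * K" using K e0 by (intro mult_left_mono) auto
    thus ?thesis using eK by linarith
  qed
  have b1: "b \<le> 1" using be e4 by simp
  have th: "\<bar>\<theta>\<bar> \<le> 1 / (16 * K)"
    using t sn K by (simp add: \<theta>_def field_simps)
  have th1: "\<bar>\<theta>\<bar> * K \<le> 1 / 16" using th K by (simp add: field_simps)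
  have th2: "\<bar>\<theta>\<bar> \<le> 1 / 16"
  proof -
    have "\<bar>\<theta>\<bar> * 1 \<le> \<bar>\<theta>\<bar> * K" using K by (intro mult_left_mono) auto
    thus ?thesis using th1 by linarith
  qed
  have D0: "0 \<le> D" using K b0 by (auto simp: D_def)
  have a0: "0 \<le> \<alpha>"
  proof -
    have "skew * b \<le> C * e"
      using abs_skew_le b0 be C_nonneg by (intro mult_mono) auto
    also have "\<dots> \<le> e * K" using K e0 by (simp add: mult.commute)
    also note eK
    finally have "skew * b * b\<^sup>2 \<le> 1 / 4 * b\<^sup>2" by (intro mult_right_mono) auto
    hence "skew * b ^ 3 \<le> b\<^sup>2 / 4" by (simp add: power2_eq_square power3_eq_cube mult_ac)
    thus ?thesis using zero_le_power2[of b] unfolding \<alpha>_def by linarith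
  qed
  define \<psi> where "\<psi> = tilt_mgf b w * exp (- complex_of_real \<alpha>)"
  define \<psi>0 where "\<psi>0 = exp (Complex (- \<theta>\<^sup>2 / 2) (b * \<theta>))"
  have diff: "norm (\<psi> - \<psi>0) \<le> D"
  proof -
    have w2: "w\<^sup>2 / 2 - skew * b ^ 3 / 3 = Complex (- \<theta>\<^sup>2 / 2) (b * \<theta>) + complex_of_real \<alpha>"
      by (simp add: w_def \<alpha>_def complex_eq_iff power2_eq_square power3_eq_cube diff_divide_distrib)
    have "\<psi>0 = exp (w\<^sup>2 / 2 - skew * b ^ 3 / 3) * exp (- complex_of_real \<alpha>)"
      unfolding w2 \<psi>0_def by (simp flip: exp_add)
    hence "\<psi> - \<psi>0 = (tilt_mgf b w - exp (w\<^sup>2 / 2 - skew * b ^ 3 / 3)) * exp (- complex_of_real \<alpha>)"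
      by (simp add: \<psi>_def algebra_simps)
    hence "norm (\<psi> - \<psi>0) = norm (tilt_mgf b w - exp (w\<^sup>2 / 2 - skew * b ^ 3 / 3)) * exp (- \<alpha>)"
      by (simp add: norm_mult)
    also have "\<dots> \<le> norm (tilt_mgf b w - exp (w\<^sup>2 / 2 - skew * b ^ 3 / 3)) * 1"
      using a0 by (intro mult_left_mono) auto
    also have "\<dots> \<le> D"
      using integral_exp_tilt[OF b0 b1, of \<theta>] th2
      by (simp add: D_def K_def w_def tilt_mgf_def)
    finally show ?thesis .
  qed
  define \<rho> where "\<rho> = exp (- \<theta>\<^sup>2 / 4 + 5 * K\<^sup>2 * b ^ 4)"
  have n0: "norm \<psi>0 = exp (- \<theta>\<^sup>2 / 2)" by (simp add: \<psi>0_def)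
  have r0: "norm \<psi>0 \<le> \<rho>"
  proof -
    have "0 \<le> \<theta>\<^sup>2" "0 \<le> 5 * K\<^sup>2 * b ^ 4" by auto
    thus ?thesis unfolding n0 \<rho>_def exp_le_cancel_iff by linarith
  qed
  have r1: "norm \<psi> \<le> \<rho>"
  proof -
    have "norm \<psi> \<le> exp (- \<theta>\<^sup>2 / 2) + D"
      using diff norm_triangle_ineq2[of \<psi> \<psi>0] n0 by linarith
    also have "\<dots> \<le> 1 - \<theta>\<^sup>2 / 4 + 5 * K\<^sup>2 * b ^ 4"
    proof -
      define q where "q = \<theta>\<^sup>2 / 2"
      have q: "0 \<le> q" "q \<le> 1 / 4"
      proof -
        have "\<bar>\<theta>\<bar>\<^sup>2 \<le> (1 / 16)\<^sup>2" using th2 by (intro power_mono) auto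
        thus "q \<le> 1 / 4" by (simp add: q_def power2_eq_square)
      qed (simp add: q_def)
      have "exp (- q) \<le> 1 / (1 + q)"
        using exp_ge_add_one_self[of q] q by (simp add: exp_minus field_simps)
      also have "\<dots> \<le> 1 - q + q\<^sup>2"
      proof -
        have "0 \<le> q ^ 3" using q by simp
        thus ?thesis using q by (simp add: field_simps power2_eq_square power3_eq_cube)
      qed
      also have "q\<^sup>2 \<le> q / 4" using q mult_left_mono[of q "1/4" q] by (simp add: power2_eq_square)
      finally have A: "exp (- \<theta>\<^sup>2 / 2) \<le> 1 - 3 * \<theta>\<^sup>2 / 8" by (simp add: q_def)
      have "0 \<le> (8 * K * b\<^sup>2 - \<bar>\<theta>\<bar>)\<^sup>2" by simp
      hence B: "K * (b\<^sup>2 * \<bar>\<theta>\<bar>) \<le> 4 * K\<^sup>2 * b ^ 4 + \<theta>\<^sup>2 / 16"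
        by (simp add: power2_diff power_mult_distrib)
      have "K * \<bar>\<theta>\<bar> ^ 3 = (\<bar>\<theta>\<bar> * K) * \<theta>\<^sup>2"
        by (simp add: power3_eq_cube power2_eq_square mult_ac)
      also have "\<dots> \<le> 1 / 16 * \<theta>\<^sup>2" using th1 by (intro mult_right_mono) auto
      finally have E: "K * \<bar>\<theta>\<bar> ^ 3 \<le> \<theta>\<^sup>2 / 16" by simp
      have F: "K * b ^ 4 \<le> K\<^sup>2 * b ^ 4"
        using K by (intro mult_right_mono) (auto simp: power2_eq_square)
      show ?thesis using A B E F unfolding D_def by (simp add: algebra_simps)
    qed
    also have "\<dots> \<le> \<rho>" unfolding \<rho>_def using exp_ge_add_one_self[of "- \<theta>\<^sup>2 / 4 + 5 * K\<^sup>2 * b ^ 4"] by linarith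
    finally show ?thesis .
  qed
  obtain m where m: "n = Suc m" using n gr0_conv_Suc by auto
  have nb4: "real n * b ^ 4 \<le> e\<^sup>2"
  proof -
    have "h\<^sup>2 * h\<^sup>2 \<le> (e * sqrt n) * (e * sqrt n)" using h e0 by (intro mult_mono) auto
    also have "\<dots> = e\<^sup>2 * n" using n by (simp add: power2_eq_square)
    finally have "(b\<^sup>2 * n) * (b\<^sup>2 * n) \<le> e\<^sup>2 * n" unfolding b2 .
    thus ?thesis using n by (simp add: power2_eq_square power4_eq_xxxx mult_ac)
  qed
  have rm: "\<rho> ^ m \<le> 3 * exp (- t\<^sup>2 / 4)"
  proof -
    have "\<rho> ^ m = exp (real m * (- \<theta>\<^sup>2 / 4 + 5 * K\<^sup>2 * b ^ 4))"
      by (simp add: \<rho>_def exp_of_nat_mult)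
    also have "\<dots> \<le> exp (- t\<^sup>2 / 4 + 1)"
    proof -
      have "real m * (- \<theta>\<^sup>2 / 4 + 5 * K\<^sup>2 * b ^ 4) = - real n * \<theta>\<^sup>2 / 4 + \<theta>\<^sup>2 / 4 + 5 * K\<^sup>2 * (real m * b ^ 4)"
        by (simp add: m field_simps)
      moreover have "real n * \<theta>\<^sup>2 = t\<^sup>2" using n by (simp add: \<theta>_def power_divide)
      moreover have "\<theta>\<^sup>2 / 4 \<le> 1 / 4"
        using power_mono[OF th2, of 2] by (simp add: power2_eq_square)
      moreover have "5 * K\<^sup>2 * (real m * b ^ 4) \<le> 5 / 16"
      proof -
        have "real m * b ^ 4 \<le> real n * b ^ 4" using m by (intro mult_right_mono) auto
        hence "5 * K\<^sup>2 * (real m * b ^ 4) \<le> 5 * K\<^sup>2 * e\<^sup>2" using nb4 by (intro mult_left_mono) auto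
        also have "\<dots> = 5 * (e * K)\<^sup>2" by (simp add: power_mult_distrib)
        also have "\<dots> \<le> 5 * (1 / 4)\<^sup>2" using eK e0 K by (intro mult_left_mono power_mono) auto
        finally show ?thesis by (simp add: power2_eq_square)
      qed
      ultimately show ?thesis unfolding exp_le_cancel_iff by linarith
    qed
    also have "\<dots> = exp 1 * exp (- t\<^sup>2 / 4)" by (simp flip: exp_add)
    also have "\<dots> \<le> 3 * exp (- t\<^sup>2 / 4)" using exp_le by (intro mult_right_mono) auto
    finally show ?thesis .
  qed
  have nD: "real n * D \<le> K * e * (1 + \<bar>t\<bar> + \<bar>t\<bar> ^ 3)"
  proof -
    have A: "real n * b ^ 4 \<le> e"
    proof -
      have "real n * b ^ 4 \<le> e * e" using nb4 by (simp add: power2_eq_square)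
      also have "\<dots> \<le> e * 1" using e0 e4 by (intro mult_left_mono) auto
      finally show ?thesis by simp
    qed
    have B: "real n * (b\<^sup>2 * \<bar>\<theta>\<bar>) \<le> e * \<bar>t\<bar>"
    proof -
      have "real n * (b\<^sup>2 * \<bar>\<theta>\<bar>) = h\<^sup>2 * \<bar>\<theta>\<bar>" using b2 by (simp add: mult_ac)
      also have "\<dots> \<le> e * sqrt n * \<bar>\<theta>\<bar>" using h by (intro mult_right_mono) auto
      finally show ?thesis using sn by (simp add: \<theta>_def abs_divide)
    qed
    have E: "real n * \<bar>\<theta>\<bar> ^ 3 \<le> e * \<bar>t\<bar> ^ 3"
    proof -
      have "\<bar>t\<bar> ^ 3 = \<bar>\<theta>\<bar> ^ 3 * (sqrt n * sqrt n * sqrt n)"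
        using sn by (simp add: t_th abs_mult power_mult_distrib power3_eq_cube mult_ac)
      hence "e * \<bar>t\<bar> ^ 3 = real n * \<bar>\<theta>\<bar> ^ 3 * (e * sqrt n)" using n by (simp add: mult_ac)
      also have "real n * \<bar>\<theta>\<bar> ^ 3 * (e * sqrt n) \<ge> real n * \<bar>\<theta>\<bar> ^ 3 * 1"
        using e by (intro mult_left_mono) auto
      finally show ?thesis by simp
    qed
    have "real n * D = K * (real n * b ^ 4 + real n * (b\<^sup>2 * \<bar>\<theta>\<bar>) + real n * \<bar>\<theta>\<bar> ^ 3)"
      by (simp add: D_def algebra_simps)
    also have "\<dots> \<le> K * (e + e * \<bar>t\<bar> + e * \<bar>t\<bar> ^ 3)"
      using A B E K by (intro mult_left_mono add_mono) auto
    finally show ?thesis by (simp add: algebra_simps)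
  qed
  have "norm (\<psi> ^ n - \<psi>0 ^ n) \<le> real n * \<rho> ^ m * norm (\<psi> - \<psi>0)"
    unfolding m by (rule norm_power_Suc_diff_le[OF r1 r0])
  also have "\<dots> \<le> real n * (3 * exp (- t\<^sup>2 / 4)) * D"
    using rm diff by (intro mult_mono) (auto simp: \<rho>_def)
  also have "\<dots> = 3 * exp (- t\<^sup>2 / 4) * (real n * D)" by simp
  also have "\<dots> \<le> 3 * exp (- t\<^sup>2 / 4) * (K * e * (1 + \<bar>t\<bar> + \<bar>t\<bar> ^ 3))"
    using nD by (intro mult_left_mono) auto
  finally have main: "norm (\<psi> ^ n - \<psi>0 ^ n) \<le> 3 * K * e * (1 + \<bar>t\<bar> + \<bar>t\<bar> ^ 3) * exp (- t\<^sup>2 / 4)"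
    by (simp only: mult_ac)
  have na: "real n * \<alpha> = tilt_rate n h"
  proof -
    have "skew * h ^ 3 / (3 * sqrt n) = real n * (skew * b ^ 3 / 3)"
      using n sn by (simp add: h_b power_mult_distrib power3_eq_cube)
    moreover have "real n * (b\<^sup>2 / 2) = h\<^sup>2 / 2" using b2 by (simp add: mult_ac)
    ultimately show ?thesis by (simp add: \<alpha>_def tilt_rate_def right_diff_distrib)
  qed
  have p1: "tilt_mgf b w ^ n = \<psi> ^ n * exp (complex_of_real (tilt_rate n h))"
  proof -
    have "tilt_mgf b w = \<psi> * exp (complex_of_real \<alpha>)"
      by (simp add: \<psi>_def mult.assoc flip: exp_add)
    thus ?thesis by (simp add: power_mult_distrib exp_of_nat_mult[symmetric] flip: na)
  qed
  have p0: "exp (Complex (tilt_rate n h - t\<^sup>2 / 2) (h * t)) = \<psi>0 ^ n * exp (complex_of_real (tilt_rate n h))"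
  proof -
    have "\<psi>0 ^ n = exp (of_nat n * Complex (- \<theta>\<^sup>2 / 2) (b * \<theta>))"
      by (simp add: \<psi>0_def exp_of_nat_mult)
    also have "of_nat n * Complex (- \<theta>\<^sup>2 / 2) (b * \<theta>) = Complex (- t\<^sup>2 / 2) (h * t)"
      using n by (simp add: complex_eq_iff t_th h_b power_mult_distrib mult_ac)
    finally have "\<psi>0 ^ n * exp (complex_of_real (tilt_rate n h))
        = exp (Complex (- t\<^sup>2 / 2) (h * t) + complex_of_real (tilt_rate n h))"
      by (simp add: exp_add)
    also have "Complex (- t\<^sup>2 / 2) (h * t) + complex_of_real (tilt_rate n h) = Complex (tilt_rate n h - t\<^sup>2 / 2) (h * t)"
      by (simp add: complex_eq_iff)
    finally show ?thesis by simp
  qed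
  have "norm (tilt_mgf b w ^ n - exp (Complex (tilt_rate n h - t\<^sup>2 / 2) (h * t)))
      = norm (\<psi> ^ n - \<psi>0 ^ n) * exp (tilt_rate n h)"
    unfolding p1 p0 by (simp add: norm_mult flip: left_diff_distrib)
  also have "\<dots> \<le> 3 * K * e * (1 + \<bar>t\<bar> + \<bar>t\<bar> ^ 3) * exp (- t\<^sup>2 / 4) * exp (tilt_rate n h)"
    using main by (intro mult_right_mono) auto
  also have "\<dots> = 3 * K * e * (1 + \<bar>t\<bar> + \<bar>t\<bar> ^ 3) * exp (tilt_rate n h - t\<^sup>2 / 4)"
    by (simp add: mult.assoc flip: exp_add)
  finally show ?thesis by (simp add: w_def b_def \<theta>_def)
qed

end

section \<open>Gaussian smoothing and Fourier inversion\<close>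

lemma integral_iexp_gaussian:
  "(\<integral>u. complex_of_real (exp (- u\<^sup>2 / 2)) * iexp (u * y) \<partial>lborel)
     = complex_of_real (sqrt (2 * pi) * exp (- y\<^sup>2 / 2))"
proof -
  have "complex_of_real (exp (- y\<^sup>2 / 2)) = (\<integral>u. iexp (y * u) \<partial>std_normal_distribution)"
    using char_std_normal_distribution by (simp add: char_def fun_eq_iff)
  also have "\<dots> = (\<integral>u. std_normal_density u *\<^sub>R iexp (y * u) \<partial>lborel)"
    by (intro integral_density) auto
  also have "\<dots> = (\<integral>u. complex_of_real (1 / sqrt (2 * pi)) * (complex_of_real (exp (- u\<^sup>2 / 2)) * iexp (u * y)) \<partial>lborel)"
    by (intro Bochner_Integration.integral_cong refl)
       (simp add: std_normal_density_def scaleR_conv_of_real mult_ac)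
  also have "\<dots> = complex_of_real (1 / sqrt (2 * pi)) * (\<integral>u. complex_of_real (exp (- u\<^sup>2 / 2)) * iexp (u * y) \<partial>lborel)"
    by (rule integral_mult_right_zero)
  finally show ?thesis by (simp add: field_simps)
qed

lemma normal_density_Fourier:
  fixes s y :: real
  assumes "0 < s"
  shows "complex_of_real (normal_density 0 s y)
    = (\<integral>t. complex_of_real (exp (- (s\<^sup>2 * t\<^sup>2) / 2)) * iexp (t * y) \<partial>lborel) / (2 * pi)"
proof -
  have "(\<integral>u. complex_of_real (exp (- u\<^sup>2 / 2)) * iexp (u * (y / s)) \<partial>lborel)
      = \<bar>s\<bar> *\<^sub>R (\<integral>t. complex_of_real (exp (- (0 + s * t)\<^sup>2 / 2)) * iexp ((0 + s * t) * (y / s)) \<partial>lborel)"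
    using assms by (intro lborel_integral_real_affine) auto
  also have "(\<lambda>t. complex_of_real (exp (- (0 + s * t)\<^sup>2 / 2)) * iexp ((0 + s * t) * (y / s)))
      = (\<lambda>t. complex_of_real (exp (- (s\<^sup>2 * t\<^sup>2) / 2)) * iexp (t * y))"
    using assms by (auto simp: power_mult_distrib)
  finally have "complex_of_real (sqrt (2 * pi) * exp (- (y / s)\<^sup>2 / 2))
      = complex_of_real s * (\<integral>t. complex_of_real (exp (- (s\<^sup>2 * t\<^sup>2) / 2)) * iexp (t * y) \<partial>lborel)"
    using assms by (simp only: integral_iexp_gaussian scaleR_conv_of_real abs_of_pos)
  hence *: "(\<integral>t. complex_of_real (exp (- (s\<^sup>2 * t\<^sup>2) / 2)) * iexp (t * y) \<partial>lborel)
      = complex_of_real (sqrt (2 * pi) * exp (- (y / s)\<^sup>2 / 2) / s)"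
    using assms by (simp add: field_simps)
  have "sqrt (2 * pi) * exp (- (y / s)\<^sup>2 / 2) / s / (2 * pi) = normal_density 0 s y"
  proof -
    define r where "r = sqrt (2 * pi)"
    have r: "r > 0" "2 * pi = r * r" by (simp_all add: r_def)
    have "sqrt (2 * pi * s\<^sup>2) = r * s" using assms by (simp add: r_def real_sqrt_mult)
    hence "normal_density 0 s y = 1 / (r * s) * exp (- (y / s)\<^sup>2 / 2)"
      by (simp add: normal_density_def power_divide)
    moreover have "r * exp (- (y / s)\<^sup>2 / 2) / s / (r * r) = 1 / (r * s) * exp (- (y / s)\<^sup>2 / 2)"
      using r(1) assms by (simp add: field_simps)
    ultimately show ?thesis unfolding r_def[symmetric] unfolding r(2) by simp
  qed
  thus ?thesis unfolding * by (simp flip: of_real_divide of_real_mult)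
qed

lemma integrable_exp_neg_square:
  assumes "0 < c"
  shows "integrable lborel (\<lambda>t::real. exp (- (c * t\<^sup>2)))"
    and "(\<integral>t. exp (- (c * t\<^sup>2)) \<partial>lborel) = sqrt (pi / c)"
proof -
  define \<sigma> where "\<sigma> = sqrt (1 / (2 * c))"
  have s: "\<sigma> > 0" "\<sigma>\<^sup>2 = 1 / (2 * c)" using assms by (auto simp: \<sigma>_def)
  have eq: "(\<lambda>t. exp (- (c * t\<^sup>2))) = (\<lambda>t. sqrt (pi / c) * normal_density 0 \<sigma> t)"
    using assms by (auto simp: normal_density_def s(2) field_simps)
  show "integrable lborel (\<lambda>t::real. exp (- (c * t\<^sup>2)))"
    unfolding eq using integrable_normal_density[OF s(1)] by simp
  show "(\<integral>t. exp (- (c * t\<^sup>2)) \<partial>lborel) = sqrt (pi / c)"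
    unfolding eq using integral_normal_density[OF s(1)] by simp
qed

abbreviation (in prob_space) smoothed_density :: "('a \<Rightarrow> real) \<Rightarrow> real \<Rightarrow> real \<Rightarrow> real \<Rightarrow> real" where
  "smoothed_density W h s y \<equiv> \<integral>\<omega>. exp (h * W \<omega>) * normal_density 0 s (y - W \<omega>) \<partial>M"

lemma (in prob_space) gaussian_smoothing_Fourier:
  fixes W :: "'a \<Rightarrow> real" and h s y :: real
  assumes [measurable]: "W \<in> borel_measurable M"
    and int: "integrable M (\<lambda>\<omega>. exp (h * W \<omega>))" and s: "0 < s"
  shows "complex_of_real (smoothed_density W h s y)
    = (\<integral>t. complex_of_real (exp (- (s\<^sup>2 * t\<^sup>2) / 2)) * iexp (- (t * y))
          * (\<integral>\<omega>. exp (Complex h t * W \<omega>) \<partial>M) \<partial>lborel) / (2 * pi)"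
proof -
  define f where "f \<omega> t = complex_of_real (exp (h * W \<omega>) * exp (- (s\<^sup>2 * t\<^sup>2) / 2)) * iexp (t * (W \<omega> - y))" for \<omega> t
  interpret L: pair_sigma_finite M lborel ..
  have s2: "0 < s\<^sup>2 / 2" using s by simp
  have intg: "integrable lborel (\<lambda>t. exp (- (s\<^sup>2 * t\<^sup>2) / 2))"
    using integrable_exp_neg_square(1)[OF s2] by simp
  have nf: "norm (f \<omega> t) = exp (h * W \<omega>) * exp (- (s\<^sup>2 * t\<^sup>2) / 2)" for \<omega> t
    by (simp add: f_def norm_mult)
  have fm[measurable]: "(\<lambda>(\<omega>, t). f \<omega> t) \<in> borel_measurable (M \<Otimes>\<^sub>M lborel)"
    unfolding f_def by measurable
  have fint: "integrable (M \<Otimes>\<^sub>M lborel) (\<lambda>(\<omega>, t). f \<omega> t)"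
  proof (rule L.Fubini_integrable)
    show "integrable M (\<lambda>\<omega>. \<integral>t. norm (case (\<omega>, t) of (\<omega>, t) \<Rightarrow> f \<omega> t) \<partial>lborel)"
      using int by (simp add: nf)
    show "AE \<omega> in M. integrable lborel (\<lambda>t. case (\<omega>, t) of (\<omega>, t) \<Rightarrow> f \<omega> t)"
    proof (intro AE_I2)
      fix \<omega> assume "\<omega> \<in> space M"
      show "integrable lborel (\<lambda>t. case (\<omega>, t) of (\<omega>, t) \<Rightarrow> f \<omega> t)"
      proof (rule Bochner_Integration.integrable_bound)
        show "integrable lborel (\<lambda>t. exp (h * W \<omega>) * exp (- (s\<^sup>2 * t\<^sup>2) / 2))" using intg by simp
        show "(\<lambda>t. case (\<omega>, t) of (\<omega>, t) \<Rightarrow> f \<omega> t) \<in> borel_measurable lborel"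
          unfolding prod.case f_def by measurable
      qed (simp add: nf)
    qed
  qed fact
  have "(\<integral>\<omega>. (\<integral>t. f \<omega> t \<partial>lborel) \<partial>M) = (\<integral>t. (\<integral>\<omega>. f \<omega> t \<partial>M) \<partial>lborel)"
    using L.Fubini_integral[OF fint] by simp
  moreover have "(\<integral>t. f \<omega> t \<partial>lborel) = complex_of_real (exp (h * W \<omega>) * normal_density 0 s (y - W \<omega>)) * (2 * pi)" for \<omega>
  proof -
    have "(\<integral>t. f \<omega> t \<partial>lborel) = (\<integral>t. complex_of_real (exp (h * W \<omega>)) *
        (complex_of_real (exp (- (s\<^sup>2 * t\<^sup>2) / 2)) * iexp (t * (W \<omega> - y))) \<partial>lborel)"
      by (simp add: f_def mult_ac)
    also have "\<dots> = complex_of_real (exp (h * W \<omega>)) * (\<integral>t.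
        complex_of_real (exp (- (s\<^sup>2 * t\<^sup>2) / 2)) * iexp (t * (W \<omega> - y)) \<partial>lborel)"
      by (rule integral_mult_right_zero)
    also have "\<dots> = complex_of_real (exp (h * W \<omega>)) * (complex_of_real (normal_density 0 s (W \<omega> - y)) * (2 * pi))"
      using normal_density_Fourier[OF s, of "W \<omega> - y"] by simp
    also have "normal_density 0 s (W \<omega> - y) = normal_density 0 s (y - W \<omega>)"
      by (simp add: normal_density_def power2_commute)
    finally show ?thesis by simp
  qed
  moreover have "(\<integral>\<omega>. f \<omega> t \<partial>M) = complex_of_real (exp (- (s\<^sup>2 * t\<^sup>2) / 2)) * iexp (- (t * y))
          * (\<integral>\<omega>. exp (Complex h t * W \<omega>) \<partial>M)" for t
  proof -
    have "f \<omega> t = (complex_of_real (exp (- (s\<^sup>2 * t\<^sup>2) / 2)) * iexp (- (t * y))) * exp (Complex h t * W \<omega>)" for \<omega>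
    proof -
      have "Complex h t * W \<omega> = complex_of_real (h * W \<omega>) + \<i> * complex_of_real (t * W \<omega>)"
        by (simp add: complex_eq_iff)
      hence e1: "exp (Complex h t * W \<omega>) = complex_of_real (exp (h * W \<omega>)) * iexp (t * W \<omega>)"
        by (simp only: exp_add exp_of_real)
      have "\<i> * complex_of_real (t * (W \<omega> - y)) = \<i> * complex_of_real (t * W \<omega>) + \<i> * complex_of_real (- (t * y))"
        by (simp add: algebra_simps)
      hence e2: "iexp (t * (W \<omega> - y)) = iexp (t * W \<omega>) * iexp (- (t * y))"
        by (simp only: exp_add)
      show ?thesis unfolding f_def e1 e2 of_real_mult[of "exp (h * W \<omega>)"] by (simp only: mult_ac)
    qed
    thus ?thesis by simp
  qed
  ultimately have *: "(\<integral>\<omega>. complex_of_real (exp (h * W \<omega>) * normal_density 0 s (y - W \<omega>)) * (2 * pi) \<partial>M)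
    = (\<integral>t. complex_of_real (exp (- (s\<^sup>2 * t\<^sup>2) / 2)) * iexp (- (t * y))
          * (\<integral>\<omega>. exp (Complex h t * W \<omega>) \<partial>M) \<partial>lborel)" by simp
  have "(\<integral>\<omega>. complex_of_real (exp (h * W \<omega>) * normal_density 0 s (y - W \<omega>)) * (2 * pi) \<partial>M)
      = complex_of_real (smoothed_density W h s y) * (2 * pi)"
    by (simp only: integral_complex_of_real integral_mult_left_zero)
  thus ?thesis unfolding * by simp
qed

lemma gaussian_integral_bound:
  assumes "0 < c"
  shows "(\<integral>t. exp (- (c * t\<^sup>2)) \<partial>lborel) / (2 * pi) \<le> 1 / (2 * sqrt c)"
proof -
  have "sqrt pi \<le> pi"
    using pi_gt3 by (intro real_le_lsqrt) (auto simp: power2_eq_square)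
  thus ?thesis unfolding integrable_exp_neg_square(2)[OF assms]
    using assms by (simp add: real_sqrt_divide field_simps)
qed

lemma cubic_times_gaussian_le:
  fixes t :: real
  shows "(1 + \<bar>t\<bar> + \<bar>t\<bar> ^ 3) * exp (- t\<^sup>2 / 4) \<le> 64 * exp (- (1 / 8 * t\<^sup>2))"
proof -
  define u where "u = \<bar>t\<bar>"
  have u: "0 \<le> u" "t\<^sup>2 = u\<^sup>2" by (auto simp: u_def)
  have "0 \<le> (u - 1)\<^sup>2" "0 \<le> u\<^sup>2 * (u - 1)\<^sup>2" by auto
  hence "u \<le> (1 + u\<^sup>2) / 2" "u ^ 3 \<le> (u\<^sup>2 + u ^ 4) / 2"
    by (auto simp: power2_diff algebra_simps numeral_eq_Suc)
  moreover have "0 \<le> u\<^sup>2" "0 \<le> u ^ 4" by auto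
  moreover have "1 + a + c \<le> 64 + 8 * b + d / 2"
    if "a \<le> (1 + b) / 2" "c \<le> (b + d) / 2" "0 \<le> b" "0 \<le> d" for a b c d :: real
    using that by simp
  ultimately have "1 + u + u ^ 3 \<le> 64 + 8 * u\<^sup>2 + u ^ 4 / 2" by blast
  also have "\<dots> = 64 * (1 + u\<^sup>2 / 8 + (u\<^sup>2 / 8)\<^sup>2 / 2)" by (simp add: power_divide)
  also have "\<dots> \<le> 64 * exp (u\<^sup>2 / 8)"
    using exp_lower_Taylor_quadratic[of "u\<^sup>2 / 8"] by simp
  finally have "(1 + u + u ^ 3) * exp (- t\<^sup>2 / 4) \<le> 64 * exp (u\<^sup>2 / 8) * exp (- t\<^sup>2 / 4)"
    by (intro mult_right_mono) auto
  also have "\<dots> = 64 * exp (- (1 / 8 * t\<^sup>2))" by (simp add: u(2) flip: exp_add)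
  finally show ?thesis by (simp add: u_def)
qed

lemma one_minus_exp_gaussian_le:
  fixes s t :: real
  shows "(1 - exp (- (s\<^sup>2 * t\<^sup>2) / 2)) * exp (- t\<^sup>2 / 2) \<le> 2 * s\<^sup>2 * exp (- (1 / 4 * t\<^sup>2))"
proof -
  have "1 - exp (- (s\<^sup>2 * t\<^sup>2) / 2) \<le> s\<^sup>2 * t\<^sup>2 / 2"
    using exp_ge_add_one_self[of "- (s\<^sup>2 * t\<^sup>2) / 2"] by simp
  also have "\<dots> = 2 * s\<^sup>2 * (t\<^sup>2 / 4)" by simp
  also have "\<dots> \<le> 2 * s\<^sup>2 * exp (t\<^sup>2 / 4)"
  proof (rule mult_left_mono)
    show "t\<^sup>2 / 4 \<le> exp (t\<^sup>2 / 4)" using exp_ge_add_one_self[of "t\<^sup>2 / 4"] by linarith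
  qed simp
  finally have "(1 - exp (- (s\<^sup>2 * t\<^sup>2) / 2)) * exp (- t\<^sup>2 / 2) \<le> 2 * s\<^sup>2 * exp (t\<^sup>2 / 4) * exp (- t\<^sup>2 / 2)"
    by (intro mult_right_mono) auto
  also have "\<dots> = 2 * s\<^sup>2 * exp (- (1 / 4 * t\<^sup>2))" by (simp flip: exp_add)
  finally show ?thesis .
qed

abbreviation power_measure :: "nat \<Rightarrow> real measure \<Rightarrow> (nat \<Rightarrow> real) measure" where
  "power_measure n \<nu> \<equiv> Pi\<^sub>M {1..n} (\<lambda>_. \<nu>)"

definition tilt_sum :: "nat \<Rightarrow> real \<Rightarrow> (nat \<Rightarrow> real) \<Rightarrow> real" where
  "tilt_sum n h y = (\<Sum>j=1..n. tilt_arg (h / sqrt n) (y j)) / sqrt n"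

context std_law
begin

abbreviation sample_law :: "nat \<Rightarrow> (nat \<Rightarrow> real) measure" where
  "sample_law n \<equiv> power_measure n \<nu>"

lemma prob_space_sample_law: "prob_space (sample_law n)"
  by (intro prob_space_PiM prob_space_axioms)

lemma tilt_sum_measurable [measurable]: "tilt_sum n h \<in> borel_measurable (sample_law n)"
  unfolding tilt_sum_def by measurable

lemma exp_tilt_sum:
  "exp (w * complex_of_real (tilt_sum n h y))
    = (\<Prod>j\<in>{1..n}. exp (w / sqrt n * complex_of_real (tilt_arg (h / sqrt n) (y j))))"
  by (simp add: tilt_sum_def sum_divide_distrib sum_distrib_left flip: exp_sum)

lemma integral_exp_tilt_sum:
  shows "(\<integral>y. exp (w * complex_of_real (tilt_sum n h y)) \<partial>sample_law n) = tilt_mgf (h / sqrt n) (w / sqrt n) ^ n"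
    and "integrable (sample_law n) (\<lambda>y. exp (w * complex_of_real (tilt_sum n h y)))"
proof -
  interpret product_sigma_finite "\<lambda>_::nat. \<nu>" by standard
  have i: "integrable \<nu> (\<lambda>x. exp (w / sqrt n * complex_of_real (tilt_arg (h / sqrt n) x)))"
    by (intro integrable_continuous_law continuous_intros)
  show "(\<integral>y. exp (w * complex_of_real (tilt_sum n h y)) \<partial>sample_law n) = tilt_mgf (h / sqrt n) (w / sqrt n) ^ n"
    unfolding exp_tilt_sum using i by (subst product_integral_prod) (auto simp: tilt_mgf_def)
  show "integrable (sample_law n) (\<lambda>y. exp (w * complex_of_real (tilt_sum n h y)))"
    unfolding exp_tilt_sum using i by (intro product_integrable_prod) auto
qed

lemma integrable_exp_tilt_sum_real: "integrable (sample_law n) (\<lambda>y. exp (h * tilt_sum n h y))"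
proof -
  have "integrable (sample_law n) (\<lambda>y. Re (exp (complex_of_real h * complex_of_real (tilt_sum n h y))))"
    by (intro integrable_Re integral_exp_tilt_sum(2))
  thus ?thesis by (simp flip: of_real_mult add: Re_exp)
qed

lemma norm_tilt_mgf_power_le:
  "norm (tilt_mgf (h / sqrt n) (Complex h t / sqrt n) ^ n) \<le> Re (tilt_mgf (h / sqrt n) (Complex h 0 / sqrt n) ^ n)"
proof -
  have "norm (tilt_mgf (h / sqrt n) (Complex h t / sqrt n) ^ n)
      = norm (\<integral>y. exp (Complex h t * complex_of_real (tilt_sum n h y)) \<partial>sample_law n)"
    by (simp only: integral_exp_tilt_sum(1))
  also have "\<dots> \<le> (\<integral>y. norm (exp (Complex h t * complex_of_real (tilt_sum n h y))) \<partial>sample_law n)"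
    by (rule integral_norm_bound)
  also have "\<dots> = (\<integral>y. Re (exp (Complex h 0 * complex_of_real (tilt_sum n h y))) \<partial>sample_law n)"
    by (simp add: Re_exp)
  also have "\<dots> = Re (\<integral>y. exp (Complex h 0 * complex_of_real (tilt_sum n h y)) \<partial>sample_law n)"
    by (intro integral_Re integral_exp_tilt_sum(2))
  finally show ?thesis by (simp only: integral_exp_tilt_sum(1))
qed

lemma smoothed_tilt_density:
  fixes n :: nat and h e s z :: real
  defines "K \<equiv> tilt_const C"
  assumes n: "0 < n" and h: "0 \<le> h" "h\<^sup>2 \<le> e * sqrt n" and e: "1 \<le> e * sqrt n" "e \<le> 1 / (4 * K)"
    and s: "0 < s"
  shows "\<bar>(\<integral>y. exp (h * tilt_sum n h y) * normal_density 0 s (z - tilt_sum n h y) \<partial>sample_law n)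
            - exp (tilt_rate n h) * std_normal_density (z - h)\<bar>
         \<le> exp (tilt_rate n h) * (384 * K * e + 2 * s\<^sup>2 + 3 * exp (- (s\<^sup>2 * n / (1024 * K\<^sup>2))) / s)"
proof -
  interpret P: prob_space "sample_law n" by (rule prob_space_sample_law)
  define a where "a = tilt_rate n h"
  define M where "M t = tilt_mgf (h / sqrt n) (Complex h t / sqrt n) ^ n" for t
  define E where "E t = exp (Complex (a - t\<^sup>2 / 2) (h * t))" for t
  define g where "g t = exp (- (s\<^sup>2 * t\<^sup>2) / 2)" for t :: real
  define F where "F t = complex_of_real (g t) * iexp (- (t * z)) * M t" for t
  define G where "G t = iexp (- (t * z)) * E t" for t
  define L where "L = (\<integral>y. exp (h * tilt_sum n h y) * normal_density 0 s (z - tilt_sum n h y) \<partial>sample_law n)"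
  define q where "q = exp (- (s\<^sup>2 * n / (1024 * K\<^sup>2)))"
  have K: "1 \<le> K" using tilt_const_ge by (auto simp: K_def)
  have e0: "0 < e" using e(1) n by (smt (verit) mult_nonpos_nonneg real_sqrt_ge_zero of_nat_0_le_iff)
  have Kn: "sqrt n / (16 * K) > 0" using n K by simp
  have div: "Complex (h / sqrt n) (t / sqrt n) = Complex h t / complex_of_real (sqrt n)" for t
    by (simp add: complex_eq_iff)
  have close: "norm (M t - E t) \<le> 3 * K * e * (1 + \<bar>t\<bar> + \<bar>t\<bar> ^ 3) * exp (a - t\<^sup>2 / 4)"
    if "\<bar>t\<bar> \<le> sqrt n / (16 * K)" for t
    using tilt_mgf_power[OF n h e[unfolded K_def] that[unfolded K_def]]
    by (simp add: M_def E_def a_def K_def div)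
  have nE: "norm (E t) = exp a * exp (- t\<^sup>2 / 2)" for t
    by (simp add: E_def flip: exp_add)
  have M0: "Re (M 0) \<le> 2 * exp a"
  proof -
    have "Re (M 0) \<le> norm (M 0)" by (rule complex_Re_le_cmod)
    also have "\<dots> \<le> norm (E 0) + norm (M 0 - E 0)"
      by (metis add.commute diff_add_cancel norm_triangle_ineq)
    also have "\<dots> \<le> exp a + 3 * K * e * exp a"
      using close[of 0] Kn by (simp add: nE)
    also have "3 * K * e * exp a \<le> 1 * exp a"
      using e K by (intro mult_right_mono) (auto simp: field_simps)
    finally show ?thesis by simp
  qed
  have nM: "norm (M t) \<le> 2 * exp a" for t
    using norm_tilt_mgf_power_le[where n = n and h = h and t = t] M0 by (simp add: M_def)
  have g: "0 < g t" "g t \<le> 1" for t by (auto simp: g_def)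
  have meas[measurable]: "M \<in> borel_measurable borel" "E \<in> borel_measurable borel" "g \<in> borel_measurable borel"
    unfolding M_def E_def g_def tilt_mgf_def Complex_eq by measurable
  have [measurable]: "F \<in> borel_measurable borel" "G \<in> borel_measurable borel"
    unfolding F_def G_def by measurable
  have nF: "norm (F t) = g t * norm (M t)" and nG: "norm (G t) = norm (E t)" for t
    using g(1)[of t] by (simp_all add: F_def G_def norm_mult)
  have gi: "integrable lborel g"
    using integrable_exp_neg_square(1)[of "s\<^sup>2 / 2"] s by (simp add: g_def[abs_def])
  have Fi: "integrable lborel F"
  proof (rule Bochner_Integration.integrable_bound)
    show "integrable lborel (\<lambda>t. 2 * exp a * g t)" using gi by simp
    show "AE t in lborel. norm (F t) \<le> norm (2 * exp a * g t)"
      using nM g less_imp_le[OF g(1)] by (intro AE_I2) (simp add: nF mult.commute mult_right_mono)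
  qed simp
  have Gi: "integrable lborel G"
  proof (rule Bochner_Integration.integrable_bound)
    show "integrable lborel (\<lambda>t. exp a * exp (- (1 / 2 * t\<^sup>2)))"
      using integrable_exp_neg_square(1)[of "1 / 2"] by simp
  qed (auto simp: nG nE)
  have L: "complex_of_real L = (\<integral>t. F t \<partial>lborel) / (2 * pi)"
    unfolding L_def F_def g_def M_def
    by (simp only: P.gaussian_smoothing_Fourier[OF tilt_sum_measurable integrable_exp_tilt_sum_real s]
          integral_exp_tilt_sum(1))
  have G: "complex_of_real (exp a * std_normal_density (z - h)) = (\<integral>t. G t \<partial>lborel) / (2 * pi)"
  proof -
    have eq: "G t = complex_of_real (exp a) * (complex_of_real (exp (- (1\<^sup>2 * t\<^sup>2) / 2)) * iexp (t * (h - z)))" for t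
    proof -
      have "Complex (a - t\<^sup>2 / 2) (h * t) = complex_of_real a + (complex_of_real (- t\<^sup>2 / 2) + \<i> * complex_of_real (h * t))"
        by (simp add: complex_eq_iff)
      thus ?thesis
        by (simp add: G_def E_def exp_add exp_of_real[symmetric] del: exp_of_real)
           (simp add: algebra_simps flip: exp_add)
    qed
    have "(\<integral>t. G t \<partial>lborel) = complex_of_real (exp a) * (\<integral>t. complex_of_real (exp (- (1\<^sup>2 * t\<^sup>2) / 2)) * iexp (t * (h - z)) \<partial>lborel)"
      unfolding eq by (rule integral_mult_right_zero)
    also have "\<dots> / (2 * pi) = complex_of_real (exp a) * complex_of_real (normal_density 0 1 (h - z))"
      using normal_density_Fourier[of 1 "h - z"] by simp
    also have "normal_density 0 1 (h - z) = std_normal_density (z - h)"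
      by (simp add: normal_density_def power2_commute)
    finally show ?thesis by simp
  qed
  define bd where "bd t = exp a * (192 * K * e * exp (- (1 / 8 * t\<^sup>2)) + 2 * s\<^sup>2 * exp (- (1 / 4 * t\<^sup>2))
      + 3 * q * exp (- (s\<^sup>2 / 4 * t\<^sup>2)))" for t :: real
  have i3: "integrable lborel (\<lambda>t::real. exp (- (1 / 8 * t\<^sup>2)))" "integrable lborel (\<lambda>t::real. exp (- (1 / 4 * t\<^sup>2)))"
    "integrable lborel (\<lambda>t::real. exp (- (s\<^sup>2 / 4 * t\<^sup>2)))"
    using s by (intro integrable_exp_neg_square; simp)+
  have bdi: "integrable lborel bd" unfolding bd_def using i3 by simp
  have bound: "norm (F t - G t) \<le> bd t" for t
  proof -
    have eg: "norm (E t) * (1 - g t) \<le> exp a * (2 * s\<^sup>2 * exp (- (1 / 4 * t\<^sup>2)))"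
      using mult_left_mono[OF one_minus_exp_gaussian_le[of s t], of "exp a"] by (simp add: nE g_def mult_ac)
    have FG: "F t - G t = iexp (- (t * z)) * (complex_of_real (g t) * (M t - E t) - E t * complex_of_real (1 - g t))"
      by (simp add: F_def G_def algebra_simps)
    have n1: "norm (F t - G t) \<le> g t * norm (M t - E t) + norm (E t) * (1 - g t)"
    proof -
      have "norm (F t - G t) = norm (complex_of_real (g t) * (M t - E t) - E t * complex_of_real (1 - g t))"
        unfolding FG by (simp add: norm_mult)
      also have "\<dots> \<le> norm (complex_of_real (g t) * (M t - E t)) + norm (E t * complex_of_real (1 - g t))"
        by (rule norm_triangle_ineq4)
      also have "\<dots> = g t * norm (M t - E t) + norm (E t) * (1 - g t)"
        unfolding norm_mult norm_of_real using g[of t] by simp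
      finally show ?thesis .
    qed
    have n2: "g t * norm (M t - E t) \<le> exp a * (192 * K * e * exp (- (1 / 8 * t\<^sup>2))) + exp a * (3 * q * exp (- (s\<^sup>2 / 4 * t\<^sup>2)))"
    proof (cases "\<bar>t\<bar> \<le> sqrt n / (16 * K)")
      case True
      have "g t * norm (M t - E t) \<le> 1 * norm (M t - E t)" using g by (intro mult_right_mono) auto
      also have "\<dots> \<le> 3 * K * e * exp a * ((1 + \<bar>t\<bar> + \<bar>t\<bar> ^ 3) * exp (- t\<^sup>2 / 4))"
      proof -
        have "exp (a - t\<^sup>2 / 4) = exp a * exp (- t\<^sup>2 / 4)" by (simp flip: exp_add)
        thus ?thesis using close[OF True] by (simp only: mult_ac mult_1)
      qed
      also have "\<dots> \<le> 3 * K * e * exp a * (64 * exp (- (1 / 8 * t\<^sup>2)))"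
        using K e0 by (intro mult_left_mono cubic_times_gaussian_le) auto
      also have "\<dots> \<le> exp a * (192 * K * e * exp (- (1 / 8 * t\<^sup>2))) + exp a * (3 * q * exp (- (s\<^sup>2 / 4 * t\<^sup>2)))"
        by (simp add: q_def)
      finally show ?thesis .
    next
      case False
      have "norm (M t - E t) \<le> 3 * exp a"
      proof -
        have "norm (E t) \<le> exp a * 1" unfolding nE by (intro mult_left_mono) auto
        thus ?thesis using nM[of t] norm_triangle_ineq4[of "M t" "E t"] by linarith
      qed
      moreover have "g t \<le> q * exp (- (s\<^sup>2 / 4 * t\<^sup>2))"
      proof -
        have "(sqrt n / (16 * K))\<^sup>2 \<le> \<bar>t\<bar>\<^sup>2" using False Kn by (intro power_mono) auto
        hence "n / (256 * K\<^sup>2) \<le> t\<^sup>2" by (simp add: power_divide power_mult_distrib)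
        hence "s\<^sup>2 / 4 * (n / (256 * K\<^sup>2)) \<le> s\<^sup>2 / 4 * t\<^sup>2" by (intro mult_left_mono) auto
        hence "s\<^sup>2 * n / (1024 * K\<^sup>2) \<le> s\<^sup>2 / 4 * t\<^sup>2" by simp
        thus ?thesis unfolding g_def q_def exp_add[symmetric] exp_le_cancel_iff by linarith
      qed
      ultimately have "g t * norm (M t - E t) \<le> (q * exp (- (s\<^sup>2 / 4 * t\<^sup>2))) * (3 * exp a)"
        using g less_imp_le[OF g(1)] by (intro mult_mono) (auto simp: q_def)
      also have "\<dots> \<le> exp a * (192 * K * e * exp (- (1 / 8 * t\<^sup>2))) + exp a * (3 * q * exp (- (s\<^sup>2 / 4 * t\<^sup>2)))"
        using K e0 by simp
      finally show ?thesis .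
    qed
    show ?thesis using n1 n2 eg unfolding bd_def by (simp add: algebra_simps)
  qed
  have "complex_of_real (L - exp a * std_normal_density (z - h)) = (\<integral>t. F t - G t \<partial>lborel) / (2 * pi)"
    using L G Fi Gi by (simp add: diff_divide_distrib)
  hence "\<bar>L - exp a * std_normal_density (z - h)\<bar> = norm ((\<integral>t. F t - G t \<partial>lborel) / (2 * pi))"
    by (metis norm_of_real)
  also have "\<dots> = norm (\<integral>t. F t - G t \<partial>lborel) / (2 * pi)" by (simp add: norm_divide)
  also have "\<dots> \<le> (\<integral>t. bd t \<partial>lborel) / (2 * pi)"
  proof (rule divide_right_mono)
    have "norm (\<integral>t. F t - G t \<partial>lborel) \<le> (\<integral>t. norm (F t - G t) \<partial>lborel)" by (rule integral_norm_bound)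
    also have "\<dots> \<le> (\<integral>t. bd t \<partial>lborel)"
      using Fi Gi bdi bound by (intro integral_mono) auto
    finally show "norm (\<integral>t. F t - G t \<partial>lborel) \<le> (\<integral>t. bd t \<partial>lborel)" .
  qed simp
  also have "\<dots> = exp a * (192 * K * e * ((\<integral>t. exp (- (1 / 8 * t\<^sup>2)) \<partial>lborel) / (2 * pi))
      + 2 * s\<^sup>2 * ((\<integral>t. exp (- (1 / 4 * t\<^sup>2)) \<partial>lborel) / (2 * pi))
      + 3 * q * ((\<integral>t. exp (- (s\<^sup>2 / 4 * t\<^sup>2)) \<partial>lborel) / (2 * pi)))"
    unfolding bd_def using i3 by (simp add: algebra_simps add_divide_distrib)
  also have "\<dots> \<le> exp a * (192 * K * e * 2 + 2 * s\<^sup>2 * 1 + 3 * q * (1 / s))"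
  proof (intro mult_left_mono add_mono)
    have "sqrt ((1 / 4)\<^sup>2) \<le> sqrt (1 / 8 :: real)" by (intro real_sqrt_le_mono) (simp add: power2_eq_square)
    hence "1 / 4 \<le> sqrt (1 / 8 :: real)" unfolding real_sqrt_abs by simp
    hence "1 / (2 * sqrt (1 / 8 :: real)) \<le> 2" by (simp add: field_simps)
    thus "(\<integral>t. exp (- (1 / 8 * t\<^sup>2)) \<partial>lborel) / (2 * pi) \<le> 2"
      using gaussian_integral_bound[of "1 / 8"] by linarith
    show "(\<integral>t. exp (- (1 / 4 * t\<^sup>2)) \<partial>lborel) / (2 * pi) \<le> 1"
      using gaussian_integral_bound[of "1 / 4"] by (simp add: real_sqrt_divide)
    show "(\<integral>t. exp (- (s\<^sup>2 / 4 * t\<^sup>2)) \<partial>lborel) / (2 * pi) \<le> 1 / s"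
      using gaussian_integral_bound[of "s\<^sup>2 / 4"] s by (simp add: real_sqrt_divide)
  qed (use K e0 in \<open>auto simp: q_def\<close>)
  also have "\<dots> = exp a * (384 * K * e + 2 * s\<^sup>2 + 3 * q / s)" by simp
  finally show ?thesis unfolding L_def a_def q_def .
qed

end

section \<open>Tail probabilities from smoothed densities\<close>

lemma nn_integral_exp_decay:
  fixes h v :: real
  assumes "0 < h"
  shows "(\<integral>\<^sup>+y. ennreal (exp (- h * (y - v))) * indicator {v..} y \<partial>lborel) = ennreal (1 / h)"
proof -
  have "(\<integral>\<^sup>+y. ennreal (exp (- h * (y - v))) * indicator {v..} y \<partial>lborel) = ennreal (0 - (- exp (- h * (v - v)) / h))"
  proof (rule nn_integral_FTC_atLeast[where F = "\<lambda>y. - exp (- h * (y - v)) / h"])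
    show "((\<lambda>y. - exp (- h * (y - v)) / h) \<longlongrightarrow> 0) at_top"
      using assms by real_asymp
  qed (use assms in \<open>auto intro!: derivative_eq_intros\<close>)
  thus ?thesis by simp
qed

lemma nn_integral_exp_decay_Icc:
  fixes h v R :: real
  assumes "0 < h" "0 \<le> R"
  shows "(\<integral>\<^sup>+y. ennreal (exp (- h * (y - v))) * indicator {v..v + R / h} y \<partial>lborel) = ennreal ((1 - exp (- R)) / h)"
proof -
  have "(\<integral>\<^sup>+y. ennreal (exp (- h * (y - v))) * indicator {v..v + R / h} y \<partial>lborel)
      = ennreal (- exp (- h * (v + R / h - v)) / h - (- exp (- h * (v - v)) / h))"
    by (rule nn_integral_FTC_Icc) (use assms in \<open>auto intro!: derivative_eq_intros\<close>)
  thus ?thesis using assms by (simp add: diff_divide_distrib)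
qed

lemma nn_integral_exp_abs_le:
  fixes s v :: real
  assumes "0 < s"
  shows "(\<integral>\<^sup>+y. ennreal (exp (- \<bar>y - v\<bar> / s)) \<partial>lborel) \<le> ennreal (2 * s)"
proof -
  define f where "f y = ennreal (exp (- (1 / s) * (y - 0))) * indicator {0..} y" for y :: real
  have f: "(\<integral>\<^sup>+y. f y \<partial>lborel) = ennreal s"
    using nn_integral_exp_decay[of "1 / s" 0] assms by (simp add: f_def)
  have [measurable]: "f \<in> borel_measurable borel" unfolding f_def by measurable
  have 1: "(\<integral>\<^sup>+y. f (y - v) \<partial>lborel) = ennreal s"
    using nn_integral_real_affine[of f 1 "- v"] f by (simp add: add.commute)
  have 2: "(\<integral>\<^sup>+y. f (v - y) \<partial>lborel) = ennreal s"
    using nn_integral_real_affine[of f "-1" v] f by simp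
  have "(\<integral>\<^sup>+y. ennreal (exp (- \<bar>y - v\<bar> / s)) \<partial>lborel) \<le> (\<integral>\<^sup>+y. f (y - v) + f (v - y) \<partial>lborel)"
  proof (rule nn_integral_mono)
    fix y :: real
    show "ennreal (exp (- \<bar>y - v\<bar> / s)) \<le> f (y - v) + f (v - y)"
    proof (cases "v \<le> y")
      case True
      moreover from True assms have "- \<bar>y - v\<bar> / s = - (1 / s) * (y - v - 0)" by (simp add: field_simps)
      ultimately have "ennreal (exp (- \<bar>y - v\<bar> / s)) = f (y - v)" unfolding f_def by (simp only:) simp
      thus ?thesis by simp
    next
      case False
      moreover from False assms have "- \<bar>y - v\<bar> / s = - (1 / s) * (v - y - 0)" by (simp add: field_simps)
      ultimately have "ennreal (exp (- \<bar>y - v\<bar> / s)) = f (v - y)" unfolding f_def by (simp only:) simp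
      thus ?thesis by simp
    qed
  qed
  also have "\<dots> = ennreal s + ennreal s" by (subst nn_integral_add) (simp_all add: 1 2)
  also have "\<dots> = ennreal (2 * s)" using assms by (simp flip: ennreal_plus)
  finally show ?thesis .
qed

lemma nn_integral_normal_density_mgf:
  fixes l s w :: real
  assumes "0 < s"
  shows "(\<integral>\<^sup>+y. ennreal (exp (l * (y - w)) * normal_density 0 s (y - w)) \<partial>lborel) = ennreal (exp (l\<^sup>2 * s\<^sup>2 / 2))"
proof -
  have "exp (l * (y - w)) * normal_density 0 s (y - w) = exp (l\<^sup>2 * s\<^sup>2 / 2) * normal_density (w + l * s\<^sup>2) s y" for y
  proof -
    have "l * (y - w) - (y - w)\<^sup>2 / (2 * s\<^sup>2) = l\<^sup>2 * s\<^sup>2 / 2 - (y - (w + l * s\<^sup>2))\<^sup>2 / (2 * s\<^sup>2)"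
      using assms by (simp add: field_simps power2_eq_square)
    hence "exp (l * (y - w)) * exp (- (y - w)\<^sup>2 / (2 * s\<^sup>2)) = exp (l\<^sup>2 * s\<^sup>2 / 2) * exp (- (y - (w + l * s\<^sup>2))\<^sup>2 / (2 * s\<^sup>2))"
      by (simp flip: exp_add)
    thus ?thesis by (simp add: normal_density_def)
  qed
  hence "(\<integral>\<^sup>+y. ennreal (exp (l * (y - w)) * normal_density 0 s (y - w)) \<partial>lborel)
      = (\<integral>\<^sup>+y. ennreal (exp (l\<^sup>2 * s\<^sup>2 / 2) * normal_density (w + l * s\<^sup>2) s y) \<partial>lborel)" by simp
  also have "\<dots> = ennreal (\<integral>y. exp (l\<^sup>2 * s\<^sup>2 / 2) * normal_density (w + l * s\<^sup>2) s y \<partial>lborel)"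
    using integrable_normal_density[OF assms] by (intro nn_integral_eq_integral) auto
  also have "\<dots> = ennreal (exp (l\<^sup>2 * s\<^sup>2 / 2))"
    using integral_normal_density[OF assms] by simp
  finally show ?thesis .
qed

definition gauss_mass :: "real \<Rightarrow> real" where
  "gauss_mass L = measure std_normal_distribution {-L..L}"

lemma gauss_mass_scaled:
  assumes "0 < s"
  shows "(\<integral>\<^sup>+y. ennreal (normal_density 0 s (y - w)) * indicator {w - s * L..w + s * L} y \<partial>lborel) = ennreal (gauss_mass L)"
proof -
  interpret N: prob_space std_normal_distribution by (rule prob_space_normal_density) simp
  have "ennreal (gauss_mass L) = emeasure std_normal_distribution {-L..L}"
    by (simp add: gauss_mass_def N.emeasure_eq_measure)
  also have "\<dots> = (\<integral>\<^sup>+y. ennreal (std_normal_density y) * indicator {-L..L} y \<partial>lborel)"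
    by (subst emeasure_density) auto
  also have "\<dots> = ennreal \<bar>1 / s\<bar> * (\<integral>\<^sup>+y. ennreal (std_normal_density (- w / s + 1 / s * y)) * indicator {-L..L} (- w / s + 1 / s * y) \<partial>lborel)"
    using assms by (subst nn_integral_real_affine[where c = "1 / s" and t = "- w / s"]) auto
  also have "\<dots> = (\<integral>\<^sup>+y. ennreal (1 / s) * (ennreal (std_normal_density (- w / s + 1 / s * y)) * indicator {-L..L} (- w / s + 1 / s * y)) \<partial>lborel)"
    using assms by (subst nn_integral_cmult) auto
  also have "\<dots> = (\<integral>\<^sup>+y. ennreal (normal_density 0 s (y - w)) * indicator {w - s * L..w + s * L} y \<partial>lborel)"
  proof (intro nn_integral_cong)
    fix y :: real
    have e: "- w / s + 1 / s * y = (y - w) / s" using assms by (simp add: field_simps)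
    have "1 / s * std_normal_density ((y - w) / s) = normal_density 0 s (y - w)"
      using assms by (simp add: normal_density_def real_sqrt_mult power_divide mult_ac)
    hence "ennreal (1 / s) * ennreal (std_normal_density ((y - w) / s)) = ennreal (normal_density 0 s (y - w))"
      using assms by (simp flip: ennreal_mult)
    moreover have "(indicator {-L..L} ((y - w) / s) :: ennreal) = indicator {w - s * L..w + s * L} y"
      using assms by (auto simp: indicator_def field_simps)
    ultimately show "ennreal (1 / s) * (ennreal (std_normal_density (- w / s + 1 / s * y)) * indicator {-L..L} (- w / s + 1 / s * y))
        = ennreal (normal_density 0 s (y - w)) * indicator {w - s * L..w + s * L} y"
      unfolding e by (simp add: mult.assoc[symmetric])
  qed
  finally show ?thesis by simp
qed

lemma gauss_mass_large:
  assumes "p < 1"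
  obtains L where "1 \<le> L" "p < gauss_mass L"
proof -
  interpret N: prob_space std_normal_distribution by (rule prob_space_normal_density) simp
  have "(\<lambda>n. measure std_normal_distribution {- real n..real n}) \<longlonglongrightarrow> measure std_normal_distribution (\<Union>n. {- real n..real n})"
    by (intro N.finite_Lim_measure_incseq) (auto simp: incseq_def)
  also have "(\<Union>n. {- real n..real n}) = UNIV"
  proof -
    have "\<exists>n. x \<in> {- real n..real n}" for x :: real
    proof -
      obtain n where "\<bar>x\<bar> \<le> real n" using real_arch_simple by blast
      hence "x \<in> {- real n..real n}" by auto
      thus ?thesis by blast
    qed
    thus ?thesis by auto
  qed
  also have "measure std_normal_distribution UNIV = 1" using N.prob_space by simp
  finally have "eventually (\<lambda>n. p < gauss_mass (real n)) sequentially"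
    using assms unfolding gauss_mass_def by (rule order_tendstoD)
  hence "eventually (\<lambda>n. p < gauss_mass (real n) \<and> 1 \<le> n) sequentially"
    by (intro eventually_conj eventually_ge_at_top)
  then obtain n where "p < gauss_mass (real n)" "1 \<le> n" by (auto dest: eventually_happens)
  thus ?thesis by (intro that[of "real n"]) auto
qed

context prob_space
begin

lemma nn_integral_smoothed_density:
  fixes W :: "'a \<Rightarrow> real" and h s :: real and \<rho> :: "real \<Rightarrow> ennreal"
  assumes [measurable]: "W \<in> borel_measurable M" "\<rho> \<in> borel_measurable borel"
    and int: "integrable M (\<lambda>\<omega>. exp (h * W \<omega>))" and s: "0 < s"
  shows "(\<integral>\<^sup>+\<omega>. ennreal (exp (h * W \<omega>)) * (\<integral>\<^sup>+y. \<rho> y * ennreal (normal_density 0 s (y - W \<omega>)) \<partial>lborel) \<partial>M)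
    = (\<integral>\<^sup>+y. \<rho> y * ennreal (smoothed_density W h s y) \<partial>lborel)"
proof -
  interpret L: pair_sigma_finite M lborel ..
  have "(\<integral>\<^sup>+\<omega>. ennreal (exp (h * W \<omega>)) * (\<integral>\<^sup>+y. \<rho> y * ennreal (normal_density 0 s (y - W \<omega>)) \<partial>lborel) \<partial>M)
      = (\<integral>\<^sup>+\<omega>. (\<integral>\<^sup>+y. ennreal (exp (h * W \<omega>)) * (\<rho> y * ennreal (normal_density 0 s (y - W \<omega>))) \<partial>lborel) \<partial>M)"
    by (intro nn_integral_cong nn_integral_cmult[symmetric]) simp
  also have "\<dots> = (\<integral>\<^sup>+y. (\<integral>\<^sup>+\<omega>. ennreal (exp (h * W \<omega>)) * (\<rho> y * ennreal (normal_density 0 s (y - W \<omega>))) \<partial>M) \<partial>lborel)"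
    by (rule L.Fubini'[symmetric]) simp
  also have "\<dots> = (\<integral>\<^sup>+y. \<rho> y * ennreal (smoothed_density W h s y) \<partial>lborel)"
  proof (intro nn_integral_cong)
    fix y :: real
    have i: "integrable M (\<lambda>\<omega>. exp (h * W \<omega>) * normal_density 0 s (y - W \<omega>))"
    proof (rule Bochner_Integration.integrable_bound)
      show "integrable M (\<lambda>\<omega>. exp (h * W \<omega>) * (1 / sqrt (2 * pi * s\<^sup>2)))" using int by simp
      have "normal_density 0 s x \<le> 1 / sqrt (2 * pi * s\<^sup>2)" for x
        by (simp add: normal_density_def divide_right_mono)
      hence "exp (h * W \<omega>) * normal_density 0 s (y - W \<omega>) \<le> exp (h * W \<omega>) * (1 / sqrt (2 * pi * s\<^sup>2))" for \<omega>
        by (intro mult_left_mono) auto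
      thus "AE \<omega> in M. norm (exp (h * W \<omega>) * normal_density 0 s (y - W \<omega>)) \<le> norm (exp (h * W \<omega>) * (1 / sqrt (2 * pi * s\<^sup>2)))"
        by (intro AE_I2) simp
    qed simp
    have "(\<integral>\<^sup>+\<omega>. ennreal (exp (h * W \<omega>)) * (\<rho> y * ennreal (normal_density 0 s (y - W \<omega>))) \<partial>M)
        = (\<integral>\<^sup>+\<omega>. \<rho> y * ennreal (exp (h * W \<omega>) * normal_density 0 s (y - W \<omega>)) \<partial>M)"
      by (intro nn_integral_cong) (simp add: ennreal_mult mult_ac)
    also have "\<dots> = \<rho> y * (\<integral>\<^sup>+\<omega>. ennreal (exp (h * W \<omega>) * normal_density 0 s (y - W \<omega>)) \<partial>M)"
      by (intro nn_integral_cmult) simp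
    also have "\<dots> = \<rho> y * ennreal (smoothed_density W h s y)"
      using i by (subst nn_integral_eq_integral) auto
    finally show "(\<integral>\<^sup>+\<omega>. ennreal (exp (h * W \<omega>)) * (\<rho> y * ennreal (normal_density 0 s (y - W \<omega>))) \<partial>M)
        = \<rho> y * ennreal (smoothed_density W h s y)" .
  qed
  finally show ?thesis .
qed

lemma nn_integral_exp_tail:
  fixes W :: "'a \<Rightarrow> real" and h v :: real
  assumes [measurable]: "W \<in> borel_measurable M"
  shows "(\<integral>\<^sup>+\<omega>. ennreal (exp (h * W \<omega>)) * (ennreal (exp (- h * (W \<omega> - v))) * indicator {v<..} (W \<omega>)) \<partial>M)
    = ennreal (exp (h * v) * prob {\<omega> \<in> space M. v < W \<omega>})"
proof -
  have "(\<integral>\<^sup>+\<omega>. ennreal (exp (h * W \<omega>)) * (ennreal (exp (- h * (W \<omega> - v))) * indicator {v<..} (W \<omega>)) \<partial>M)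
      = (\<integral>\<^sup>+\<omega>. ennreal (exp (h * v)) * indicator {\<omega> \<in> space M. v < W \<omega>} \<omega> \<partial>M)"
  proof (intro nn_integral_cong)
    fix \<omega> assume w: "\<omega> \<in> space M"
    have "exp (h * W \<omega>) * exp (- h * (W \<omega> - v)) = exp (h * v)" by (simp add: algebra_simps flip: exp_add)
    hence "ennreal (exp (h * W \<omega>)) * ennreal (exp (- h * (W \<omega> - v))) = ennreal (exp (h * v))"
      by (simp flip: ennreal_mult)
    thus "ennreal (exp (h * W \<omega>)) * (ennreal (exp (- h * (W \<omega> - v))) * indicator {v<..} (W \<omega>))
        = ennreal (exp (h * v)) * indicator {\<omega> \<in> space M. v < W \<omega>} \<omega>"
      using w by (auto simp: indicator_def mult.assoc[symmetric])
  qed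
  also have "\<dots> = ennreal (exp (h * v)) * emeasure M {\<omega> \<in> space M. v < W \<omega>}"
    by (intro nn_integral_cmult_indicator) simp
  finally show ?thesis by (simp add: emeasure_eq_measure ennreal_mult)
qed

text \<open>The indicator of \<open>{v<..}\<close> times \<open>exp (- h (w - v))\<close> is dominated by a multiple of its own
  convolution with the noise, shifted by \<open>s L\<close>.\<close>

lemma tail_upper_of_smoothed_density:
  fixes W :: "'a \<Rightarrow> real" and h s D L v :: real
  assumes [measurable]: "W \<in> borel_measurable M"
    and int: "integrable M (\<lambda>\<omega>. exp (h * W \<omega>))" and s: "0 < s" and h: "0 < h" and L: "0 < gauss_mass L" "0 \<le> L"
    and D: "\<And>y. smoothed_density W h s y \<le> D"
  shows "prob {\<omega> \<in> space M. v < W \<omega>} \<le> exp (2 * h * s * L) / gauss_mass L * exp (- h * v) * (D / h)"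
proof -
  define r where "r y = ennreal (exp (- h * (y - (v - s * L)))) * indicator {v - s * L..} y" for y :: real
  define c where "c = exp (- 2 * h * s * L) * gauss_mass L"
  have c: "0 < c" using L by (simp add: c_def)
  have [measurable]: "r \<in> borel_measurable borel" unfolding r_def by measurable
  have D0: "0 \<le> D" by (rule order_trans[OF _ D[of 0]]) simp
  have pw: "ennreal c * (ennreal (exp (- h * (w - v))) * indicator {v<..} w)
      \<le> (\<integral>\<^sup>+y. r y * ennreal (normal_density 0 s (y - w)) \<partial>lborel)" for w
  proof (cases "v < w")
    case True
    have "ennreal c * (ennreal (exp (- h * (w - v))) * indicator {v<..} w)
        = ennreal (exp (- h * (w - v) - 2 * h * s * L)) * ennreal (gauss_mass L)"
      using True L by (simp add: c_def mult_ac exp_diff exp_minus divide_inverse flip: ennreal_mult)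
    also have "\<dots> = (\<integral>\<^sup>+y. ennreal (exp (- h * (w - v) - 2 * h * s * L)) *
        (ennreal (normal_density 0 s (y - w)) * indicator {w - s * L..w + s * L} y) \<partial>lborel)"
      by (subst nn_integral_cmult) (simp_all add: gauss_mass_scaled[OF s])
    also have "\<dots> \<le> (\<integral>\<^sup>+y. r y * ennreal (normal_density 0 s (y - w)) \<partial>lborel)"
    proof (intro nn_integral_mono)
      fix y :: real
      show "ennreal (exp (- h * (w - v) - 2 * h * s * L)) *
          (ennreal (normal_density 0 s (y - w)) * indicator {w - s * L..w + s * L} y)
        \<le> r y * ennreal (normal_density 0 s (y - w))"
      proof (cases "y \<in> {w - s * L..w + s * L}")
        case in_int: True
        have "h * y \<le> h * (w + s * L)" using in_int h by (intro mult_left_mono) auto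
        hence "- h * (w - v) - 2 * h * s * L \<le> - h * (y - (v - s * L))"
          by (simp add: algebra_simps)
        hence "ennreal (exp (- h * (w - v) - 2 * h * s * L)) \<le> ennreal (exp (- h * (y - (v - s * L))))"
          by (intro ennreal_leI) simp
        moreover have "v - s * L \<le> y" using in_int True by auto
        ultimately show ?thesis using in_int by (simp add: r_def mult_right_mono)
      qed simp
    qed
    finally show ?thesis .
  qed simp
  have "ennreal (c * (exp (h * v) * prob {\<omega> \<in> space M. v < W \<omega>}))
      = ennreal c * (\<integral>\<^sup>+\<omega>. ennreal (exp (h * W \<omega>)) * (ennreal (exp (- h * (W \<omega> - v))) * indicator {v<..} (W \<omega>)) \<partial>M)"
    using c by (subst nn_integral_exp_tail) (simp_all add: ennreal_mult)
  also have "\<dots> = (\<integral>\<^sup>+\<omega>. ennreal (exp (h * W \<omega>)) * (ennreal c * (ennreal (exp (- h * (W \<omega> - v))) * indicator {v<..} (W \<omega>))) \<partial>M)"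
    by (subst nn_integral_cmult[symmetric]) (simp_all add: mult_ac)
  also have "\<dots> \<le> (\<integral>\<^sup>+\<omega>. ennreal (exp (h * W \<omega>)) * (\<integral>\<^sup>+y. r y * ennreal (normal_density 0 s (y - W \<omega>)) \<partial>lborel) \<partial>M)"
    by (intro nn_integral_mono mult_left_mono pw) simp
  also have "\<dots> = (\<integral>\<^sup>+y. r y * ennreal (smoothed_density W h s y) \<partial>lborel)"
    by (rule nn_integral_smoothed_density[OF _ _ int s]) simp_all
  also have "\<dots> \<le> (\<integral>\<^sup>+y. r y * ennreal D \<partial>lborel)"
    by (intro nn_integral_mono mult_left_mono ennreal_leI D) simp
  also have "\<dots> = ennreal (1 / h) * ennreal D"
    unfolding r_def using nn_integral_exp_decay[OF h, of "v - s * L"] by (subst nn_integral_multc) simp_all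
  also have "\<dots> = ennreal (D / h)" using h D0 by (simp flip: ennreal_mult)
  finally have "c * (exp (h * v) * prob {\<omega> \<in> space M. v < W \<omega>}) \<le> D / h"
    using h D0 by simp
  hence "prob {\<omega> \<in> space M. v < W \<omega>} * (c * exp (h * v)) \<le> D / h"
    by (simp only: mult_ac)
  hence "prob {\<omega> \<in> space M. v < W \<omega>} \<le> (D / h) / (c * exp (h * v))"
    using c by (simp add: mult_imp_le_div_pos[of "c * exp (h * v)"] del: le_divide_eq pos_le_divide_eq divide_divide_eq_left)
  also have "\<dots> = exp (2 * h * s * L) / gauss_mass L * exp (- h * v) * (D / h)"
    by (simp add: c_def exp_minus field_simps)
  finally show ?thesis .
qed

text \<open>Here the shifted convolution leaks below \<open>v\<close>. The leak is at most a small multiple of the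
  convolution of \<open>exp (- \<bar>y - v\<bar> / s)\<close> with the noise, whose tilted expectation is of order \<open>s D\<close>.\<close>

lemma tail_lower_of_smoothed_density:
  fixes W :: "'a \<Rightarrow> real" and h s D L v d R :: real
  assumes [measurable]: "W \<in> borel_measurable M"
    and int: "integrable M (\<lambda>\<omega>. exp (h * W \<omega>))" and s: "0 < s" and h: "0 < h" and L: "0 < gauss_mass L" "1 \<le> L"
    and D: "\<And>y. smoothed_density W h s y \<le> D"
    and R: "0 \<le> R"
    and d: "\<And>y. v \<le> y \<Longrightarrow> y \<le> v + s * L + R / h \<Longrightarrow> d \<le> smoothed_density W h s y"
    and d0: "0 \<le> d"
  shows "d * ((1 - exp (- R)) / h)
    \<le> exp (h * s * L + h\<^sup>2 * s\<^sup>2 / 2) * exp (h * v) * prob {\<omega> \<in> space M. v < W \<omega>}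
        + exp (L - L\<^sup>2 / 2) / gauss_mass L * (2 * s * D)"
proof -
  define r where "r y = ennreal (exp (- h * (y - (v + s * L)))) * indicator {v + s * L..} y" for y :: real
  define Q where "Q y = ennreal (exp (- \<bar>y - v\<bar> / s))" for y :: real
  define c where "c = exp (h * s * L + h\<^sup>2 * s\<^sup>2 / 2)"
  define \<epsilon> where "\<epsilon> = exp (L - L\<^sup>2 / 2) / gauss_mass L"
  have \<epsilon>: "0 < \<epsilon>" using L by (simp add: \<epsilon>_def)
  define f where "f w = ennreal (exp (- h * (w - v))) * indicator {v<..} w" for w :: real
  have [measurable]: "r \<in> borel_measurable borel" "Q \<in> borel_measurable borel" "f \<in> borel_measurable borel"
    unfolding r_def Q_def f_def by measurable
  have D0: "0 \<le> D" by (rule order_trans[OF _ D[of 0]]) simp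
  have pw: "(\<integral>\<^sup>+y. r y * ennreal (normal_density 0 s (y - w)) \<partial>lborel)
      \<le> ennreal c * f w + ennreal \<epsilon> * (\<integral>\<^sup>+y. Q y * ennreal (normal_density 0 s (y - w)) \<partial>lborel)" for w
  proof (cases "v < w")
    case True
    have "(\<integral>\<^sup>+y. r y * ennreal (normal_density 0 s (y - w)) \<partial>lborel)
        \<le> (\<integral>\<^sup>+y. ennreal (exp (h * s * L - h * (w - v))) * ennreal (exp (- h * (y - w)) * normal_density 0 s (y - w)) \<partial>lborel)"
    proof (intro nn_integral_mono)
      fix y :: real
      have "r y \<le> ennreal (exp (- h * (y - (v + s * L))))" by (simp add: r_def indicator_def)
      also have "exp (- h * (y - (v + s * L))) = exp (h * s * L - h * (w - v)) * exp (- h * (y - w))"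
        by (simp add: algebra_simps flip: exp_add)
      finally have "r y * ennreal (normal_density 0 s (y - w))
          \<le> ennreal (exp (h * s * L - h * (w - v)) * exp (- h * (y - w))) * ennreal (normal_density 0 s (y - w))"
        by (intro mult_right_mono) auto
      thus "r y * ennreal (normal_density 0 s (y - w))
          \<le> ennreal (exp (h * s * L - h * (w - v))) * ennreal (exp (- h * (y - w)) * normal_density 0 s (y - w))"
        by (simp add: ennreal_mult mult.assoc)
    qed
    also have "\<dots> = ennreal (exp (h * s * L - h * (w - v))) * ennreal (exp (h\<^sup>2 * s\<^sup>2 / 2))"
      using nn_integral_normal_density_mgf[OF s, of "- h" w] by (subst nn_integral_cmult) simp_all
    also have "\<dots> = ennreal c * f w"
      using True by (simp add: f_def c_def flip: ennreal_mult exp_add)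
    finally show ?thesis by (rule order_trans) simp
  next
    case False
    define q where "q = (v - w) / s"
    have q: "0 \<le> q" "v = w + s * q" using False s by (auto simp: q_def)
    have "(\<integral>\<^sup>+y. r y * ennreal (normal_density 0 s (y - w)) \<partial>lborel)
        \<le> (\<integral>\<^sup>+y. ennreal (exp (- L * (q + L))) * ennreal (exp (L / s * (y - w)) * normal_density 0 s (y - w)) \<partial>lborel)"
    proof (intro nn_integral_mono)
      fix y :: real
      have "r y \<le> ennreal (exp (- L * (q + L)) * exp (L / s * (y - w)))"
      proof (cases "v + s * L \<le> y")
        case True
        have "r y = ennreal (exp (- h * (y - (v + s * L))))" using True by (simp add: r_def)
        also have "\<dots> \<le> ennreal 1"
          using True h by (intro ennreal_leI) simp
        also have "\<dots> \<le> ennreal (exp (- L * (q + L)) * exp (L / s * (y - w)))"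
        proof (intro ennreal_leI)
          have "L / s * (w + s * q + s * L - w) \<le> L / s * (y - w)"
            using True q s L by (intro mult_left_mono) auto
          moreover have "L / s * (w + s * q + s * L - w) = L * (q + L)" using s by (simp add: field_simps)
          ultimately have "L * (q + L) \<le> L / s * (y - w)" by linarith
          thus "1 \<le> exp (- L * (q + L)) * exp (L / s * (y - w))" by (simp flip: exp_add)
        qed
        finally show ?thesis .
      qed (simp add: r_def)
      hence "r y * ennreal (normal_density 0 s (y - w))
          \<le> ennreal (exp (- L * (q + L)) * exp (L / s * (y - w))) * ennreal (normal_density 0 s (y - w))"
        by (intro mult_right_mono) auto
      thus "r y * ennreal (normal_density 0 s (y - w))
          \<le> ennreal (exp (- L * (q + L))) * ennreal (exp (L / s * (y - w)) * normal_density 0 s (y - w))"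
        by (simp add: ennreal_mult mult.assoc)
    qed
    also have "\<dots> = ennreal (exp (- L * (q + L))) * ennreal (exp ((L / s)\<^sup>2 * s\<^sup>2 / 2))"
      using nn_integral_normal_density_mgf[OF s, of "L / s" w] by (subst nn_integral_cmult) simp_all
    also have "\<dots> = ennreal (exp (- L\<^sup>2 / 2 - L * q))"
      using s by (simp add: power_divide power2_eq_square algebra_simps flip: ennreal_mult exp_add)
    also have "\<dots> \<le> ennreal (exp (- L\<^sup>2 / 2 - q))"
      using q L by (intro ennreal_leI) (simp add: mult_le_cancel_right1)
    also have "\<dots> = ennreal \<epsilon> * (ennreal (exp (- q - L)) * ennreal (gauss_mass L))"
    proof -
      have "exp (- L\<^sup>2 / 2 - q) = \<epsilon> * (exp (- q - L) * gauss_mass L)"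
        using L by (simp add: \<epsilon>_def flip: exp_add)
      thus ?thesis using \<epsilon> L by (simp flip: ennreal_mult)
    qed
    also have "ennreal (exp (- q - L)) * ennreal (gauss_mass L)
        = (\<integral>\<^sup>+y. ennreal (exp (- q - L)) * (ennreal (normal_density 0 s (y - w)) * indicator {w - s * L..w + s * L} y) \<partial>lborel)"
      by (subst nn_integral_cmult) (simp_all add: gauss_mass_scaled[OF s])
    also have "\<dots> \<le> (\<integral>\<^sup>+y. Q y * ennreal (normal_density 0 s (y - w)) \<partial>lborel)"
    proof (intro nn_integral_mono)
      fix y :: real
      show "ennreal (exp (- q - L)) * (ennreal (normal_density 0 s (y - w)) * indicator {w - s * L..w + s * L} y)
        \<le> Q y * ennreal (normal_density 0 s (y - w))"
      proof (cases "y \<in> {w - s * L..w + s * L}")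
        case True
        have "0 \<le> s * q" using q s by simp
        hence "\<bar>y - v\<bar> \<le> s * L + s * q" using True unfolding q(2) atLeastAtMost_iff by linarith
        hence "\<bar>y - v\<bar> / s \<le> L + q" using s by (simp add: field_simps)
        hence "ennreal (exp (- q - L)) \<le> Q y" unfolding Q_def by (intro ennreal_leI) simp
        thus ?thesis using True by (simp add: mult_right_mono)
      qed simp
    qed
    finally have "(\<integral>\<^sup>+y. r y * ennreal (normal_density 0 s (y - w)) \<partial>lborel)
      \<le> ennreal \<epsilon> * (\<integral>\<^sup>+y. Q y * ennreal (normal_density 0 s (y - w)) \<partial>lborel)"
      by (simp add: mult_left_mono)
    thus ?thesis by (rule order_trans) simp
  qed
  let ?l = "smoothed_density W h s"
  have "ennreal (d * ((1 - exp (- R)) / h))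
      = (\<integral>\<^sup>+y. ennreal d * (ennreal (exp (- h * (y - (v + s * L)))) * indicator {v + s * L..v + s * L + R / h} y) \<partial>lborel)"
    using nn_integral_exp_decay_Icc[OF h R, of "v + s * L"] ennreal_mult[of d "(1 - exp (- R)) / h"] d0 R h
    by (subst nn_integral_cmult) simp_all
  also have "\<dots> \<le> (\<integral>\<^sup>+y. r y * ennreal (?l y) \<partial>lborel)"
  proof (intro nn_integral_mono)
    fix y :: real
    show "ennreal d * (ennreal (exp (- h * (y - (v + s * L)))) * indicator {v + s * L..v + s * L + R / h} y) \<le> r y * ennreal (?l y)"
    proof (cases "y \<in> {v + s * L..v + s * L + R / h}")
      case True
      have "0 \<le> s * L" using s L by simp
      hence "ennreal d \<le> ennreal (?l y)" using True by (intro ennreal_leI d) auto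
      hence "ennreal d * r y \<le> ennreal (?l y) * r y" by (intro mult_right_mono) auto
      moreover have "r y = ennreal (exp (- h * (y - (v + s * L)))) * indicator {v + s * L..v + s * L + R / h} y"
        using True by (simp add: r_def)
      ultimately show ?thesis by (simp only: mult.commute)
    qed simp
  qed
  also have "\<dots> = (\<integral>\<^sup>+\<omega>. ennreal (exp (h * W \<omega>)) * (\<integral>\<^sup>+y. r y * ennreal (normal_density 0 s (y - W \<omega>)) \<partial>lborel) \<partial>M)"
    by (rule nn_integral_smoothed_density[OF _ _ int s, symmetric]) simp_all
  also have "\<dots> \<le> (\<integral>\<^sup>+\<omega>. ennreal (exp (h * W \<omega>)) *
      (ennreal c * f (W \<omega>) + ennreal \<epsilon> * (\<integral>\<^sup>+y. Q y * ennreal (normal_density 0 s (y - W \<omega>)) \<partial>lborel)) \<partial>M)"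
    by (intro nn_integral_mono mult_left_mono pw) simp
  also have "\<dots> = (\<integral>\<^sup>+\<omega>. ennreal c * (ennreal (exp (h * W \<omega>)) * f (W \<omega>))
      + ennreal \<epsilon> * (ennreal (exp (h * W \<omega>)) * (\<integral>\<^sup>+y. Q y * ennreal (normal_density 0 s (y - W \<omega>)) \<partial>lborel)) \<partial>M)"
    by (simp add: distrib_left mult_ac)
  also have "\<dots> = ennreal c * (\<integral>\<^sup>+\<omega>. ennreal (exp (h * W \<omega>)) * f (W \<omega>) \<partial>M)
      + ennreal \<epsilon> * (\<integral>\<^sup>+\<omega>. ennreal (exp (h * W \<omega>)) * (\<integral>\<^sup>+y. Q y * ennreal (normal_density 0 s (y - W \<omega>)) \<partial>lborel) \<partial>M)"
    by (subst nn_integral_add) (simp_all add: nn_integral_cmult)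
  also have "(\<integral>\<^sup>+\<omega>. ennreal (exp (h * W \<omega>)) * f (W \<omega>) \<partial>M) = ennreal (exp (h * v) * prob {\<omega> \<in> space M. v < W \<omega>})"
    unfolding f_def by (rule nn_integral_exp_tail) simp
  also have "(\<integral>\<^sup>+\<omega>. ennreal (exp (h * W \<omega>)) * (\<integral>\<^sup>+y. Q y * ennreal (normal_density 0 s (y - W \<omega>)) \<partial>lborel) \<partial>M)
      = (\<integral>\<^sup>+y. Q y * ennreal (?l y) \<partial>lborel)"
    by (rule nn_integral_smoothed_density[OF _ _ int s]) simp_all
  also have "\<dots> \<le> (\<integral>\<^sup>+y. Q y * ennreal D \<partial>lborel)"
    by (intro nn_integral_mono mult_left_mono ennreal_leI D) simp
  also have "\<dots> = (\<integral>\<^sup>+y. Q y \<partial>lborel) * ennreal D" by (rule nn_integral_multc) simp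
  also have "\<dots> \<le> ennreal (2 * s) * ennreal D"
    unfolding Q_def by (intro mult_right_mono nn_integral_exp_abs_le s) simp
  finally have "ennreal (d * ((1 - exp (- R)) / h))
      \<le> ennreal c * ennreal (exp (h * v) * prob {\<omega> \<in> space M. v < W \<omega>}) + ennreal \<epsilon> * (ennreal (2 * s) * ennreal D)"
    by (simp add: mult_left_mono add_left_mono)
  also have "\<dots> = ennreal (c * (exp (h * v) * prob {\<omega> \<in> space M. v < W \<omega>}) + \<epsilon> * (2 * s * D))"
    using s D0 \<epsilon> by (simp add: c_def flip: ennreal_mult ennreal_plus)
  finally have "d * ((1 - exp (- R)) / h) \<le> c * (exp (h * v) * prob {\<omega> \<in> space M. v < W \<omega>}) + \<epsilon> * (2 * s * D)"
    by (rule ennreal_le_iff[THEN iffD1, rotated]) (use s D0 \<epsilon> in \<open>simp add: c_def\<close>)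
  thus ?thesis by (simp add: c_def \<epsilon>_def mult.assoc)
qed

end

context std_law
begin

lemma smoothed_tilt_density_scaled:
  fixes n :: nat and h e \<tau> z :: real
  defines "K \<equiv> tilt_const C"
  assumes n: "0 < n" and h: "1 \<le> h" "h\<^sup>2 \<le> e * sqrt n" and e: "1 \<le> e * sqrt n" "e \<le> 1 / (4 * K)"
    and \<tau>: "0 < \<tau>"
  shows "\<bar>(\<integral>y. exp (h * tilt_sum n h y) * normal_density 0 (\<tau> / h) (z - tilt_sum n h y) \<partial>sample_law n)
            - exp (tilt_rate n h) * std_normal_density (z - h)\<bar>
         \<le> exp (tilt_rate n h) * (384 * K * e + 2 * \<tau>\<^sup>2 / h\<^sup>2 + 3072 * K\<^sup>2 * e / \<tau> ^ 3)"
proof -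
  define s where "s = \<tau> / h"
  have s: "0 < s" using \<tau> h by (simp add: s_def)
  have K: "1 \<le> K" using tilt_const_ge by (simp add: K_def)
  have sn: "sqrt n > 0" using n by simp
  have e0: "0 < e" using e(1) sn by (smt (verit) mult_nonpos_nonneg)
  have e1: "e \<le> 1" using e(2) K by (smt (verit) divide_le_eq_1 mult_cancel_left1)
  have hn: "h \<le> sqrt n"
  proof -
    have "h * 1 \<le> h * h" using h by (intro mult_left_mono) auto
    also have "\<dots> \<le> e * sqrt n" using h by (simp add: power2_eq_square)
    also have "\<dots> \<le> 1 * sqrt n" using e1 sn by (intro mult_right_mono) auto
    finally show ?thesis by simp
  qed
  have h3: "h ^ 3 \<le> e * n"
  proof -
    have "h\<^sup>2 * h \<le> (e * sqrt n) * sqrt n" using h hn e0 by (intro mult_mono) auto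
    thus ?thesis using n by (simp add: power2_eq_square power3_eq_cube mult_ac)
  qed
  define X where "X = s\<^sup>2 * n / (1024 * K\<^sup>2)"
  have X: "0 < X" using s n K by (simp add: X_def)
  have "X \<le> exp X" using exp_ge_add_one_self[of X] by linarith
  hence "exp (- X) \<le> 1 / X" using X by (simp add: exp_minus field_simps)
  hence "3 * exp (- X) / s \<le> 3 * (1 / X) / s" using s by (intro divide_right_mono mult_left_mono) auto
  also have "\<dots> = 3072 * K\<^sup>2 * h ^ 3 / (\<tau> ^ 3 * n)"
    using s \<tau> h n K unfolding X_def s_def by (simp add: field_simps power2_eq_square power3_eq_cube)
  also have "\<dots> \<le> 3072 * K\<^sup>2 * (e * n) / (\<tau> ^ 3 * n)"
    using h3 \<tau> n by (intro divide_right_mono mult_left_mono) auto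
  also have "\<dots> = 3072 * K\<^sup>2 * e / \<tau> ^ 3" using n by simp
  finally have "384 * K * e + 2 * s\<^sup>2 + 3 * exp (- X) / s \<le> 384 * K * e + 2 * \<tau>\<^sup>2 / h\<^sup>2 + 3072 * K\<^sup>2 * e / \<tau> ^ 3"
    by (simp add: s_def power_divide)
  hence "exp (tilt_rate n h) * (384 * K * e + 2 * s\<^sup>2 + 3 * exp (- X) / s)
      \<le> exp (tilt_rate n h) * (384 * K * e + 2 * \<tau>\<^sup>2 / h\<^sup>2 + 3072 * K\<^sup>2 * e / \<tau> ^ 3)"
    by (intro mult_left_mono) auto
  moreover have "0 \<le> h" using h by simp
  ultimately show ?thesis
    using smoothed_tilt_density[OF n _ h(2) e[unfolded K_def] s, of z] unfolding K_def X_def s_def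
    by (meson order_trans)
qed

end

lemma std_normal_density_bounds:
  shows "std_normal_density x \<le> std_normal_density 0"
    and "std_normal_density 0 * (1 - x\<^sup>2 / 2) \<le> std_normal_density x"
    and "1 / 4 \<le> std_normal_density 0"
proof -
  show "std_normal_density x \<le> std_normal_density 0"
    by (simp add: std_normal_density_def divide_right_mono)
  have "1 - x\<^sup>2 / 2 \<le> exp (- x\<^sup>2 / 2)" using exp_ge_add_one_self[of "- x\<^sup>2 / 2"] by simp
  thus "std_normal_density 0 * (1 - x\<^sup>2 / 2) \<le> std_normal_density x"
    unfolding std_normal_density_def by (simp add: divide_right_mono)
  have "sqrt (2 * pi) \<le> sqrt (4\<^sup>2)" using pi_less_4 by (intro real_sqrt_le_mono) simp
  hence "sqrt (2 * pi) \<le> 4" unfolding real_sqrt_abs by simp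
  thus "1 / 4 \<le> std_normal_density 0"
    unfolding std_normal_density_def by (simp add: field_simps)
qed

definition moderate_tail :: "nat \<Rightarrow> real \<Rightarrow> real \<Rightarrow> real" where
  "moderate_tail n \<kappa> u = exp (- u\<^sup>2 / 2 - \<kappa> * u ^ 3 / (3 * sqrt n)) * std_normal_density 0 / u"

lemma (in std_law) exp_tilt_rate:
  "exp (tilt_rate n h) * exp (- h * h) * (std_normal_density 0 / h) = moderate_tail n skew h"
  by (simp add: tilt_rate_def moderate_tail_def power2_eq_square flip: exp_add)

lemma (in std_law) tilt_sum_tail_bounds:
  fixes n :: nat and h e \<tau> L x R :: real
  defines "K \<equiv> tilt_const C"
  assumes n: "0 < n" and h: "1 \<le> h" "h\<^sup>2 \<le> e * sqrt n" and e: "1 \<le> e * sqrt n" "e \<le> 1 / (4 * K)"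
    and x: "0 < x" "x \<le> 1 / 16" and L: "1 \<le> L" "1 - x < gauss_mass L"
    and \<tau>: "0 < \<tau>" "\<tau> * L \<le> x / 2" "exp (L - L\<^sup>2 / 2) / gauss_mass L * \<tau> \<le> x / 2"
    and R: "0 \<le> R" "exp (- R) \<le> x" "\<tau> * L + R \<le> x * h"
    and ex: "384 * K * e + 3072 * K\<^sup>2 * e / \<tau> ^ 3 \<le> x / 8"
  shows "\<P>(y in sample_law n. v < tilt_sum n h y)
          \<le> (1 + 6 * x) * exp (h * (h - v)) * moderate_tail n skew h" (is ?upper)
    and "(1 - 6 * x) * moderate_tail n skew h
          \<le> \<P>(y in sample_law n. h < tilt_sum n h y)" (is ?lower)
proof -
  interpret P: prob_space "sample_law n" by (rule prob_space_sample_law)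
  define \<phi>0 where "\<phi>0 = std_normal_density 0"
  have \<phi>0: "1 / 4 \<le> \<phi>0" unfolding \<phi>0_def by (rule std_normal_density_bounds)
  define A where "A = exp (tilt_rate n h)"
  have A: "0 < A" by (simp add: A_def)
  define s where "s = \<tau> / h"
  have h0: "0 < h" using h by simp
  have s: "0 < s" "h * s = \<tau>" using \<tau> h by (auto simp: s_def)
  have \<tau>x: "\<tau> \<le> x / 2"
  proof -
    have "\<tau> * 1 \<le> \<tau> * L" using \<tau> L by (intro mult_left_mono) auto
    thus ?thesis using \<tau> by linarith
  qed
  define l where "l z = (\<integral>y. exp (h * tilt_sum n h y) * normal_density 0 s (z - tilt_sum n h y) \<partial>sample_law n)" for z
  have err: "384 * K * e + 2 * \<tau>\<^sup>2 / h\<^sup>2 + 3072 * K\<^sup>2 * e / \<tau> ^ 3 \<le> x * \<phi>0"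
  proof -
    have "\<tau>\<^sup>2 / h\<^sup>2 \<le> \<tau>\<^sup>2" using h by (simp add: divide_le_eq mult_le_cancel_left1 one_le_power)
    also have "\<dots> \<le> x / 2 * (1 / 32)"
      unfolding power2_eq_square using \<tau>x \<tau> x by (intro mult_mono) auto
    finally have "2 * (\<tau>\<^sup>2 / h\<^sup>2) \<le> x / 32" by linarith
    hence "2 * \<tau>\<^sup>2 / h\<^sup>2 \<le> x / 32" by (simp only: times_divide_eq_right)
    moreover have "x * (1 / 4) \<le> x * \<phi>0" using \<phi>0 x by (intro mult_left_mono) auto
    ultimately show ?thesis using ex x by linarith
  qed
  have close: "\<bar>l z - A * std_normal_density (z - h)\<bar> \<le> A * (x * \<phi>0)" for z
    using smoothed_tilt_density_scaled[OF n h e[unfolded K_def] \<tau>(1), of z] mult_left_mono[OF err, of A] A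
    unfolding l_def A_def s_def K_def by (meson order_trans less_imp_le)
  have lD: "l z \<le> A * \<phi>0 * (1 + x)" for z
  proof -
    have "A * std_normal_density (z - h) \<le> A * \<phi>0"
      using std_normal_density_bounds(1) A unfolding \<phi>0_def by (intro mult_left_mono) auto
    thus ?thesis using close[of z] by (simp add: algebra_simps)
  qed
  have mt: "moderate_tail n skew h = A * exp (- h * h) * (\<phi>0 / h)"
    unfolding A_def \<phi>0_def by (rule exp_tilt_rate[symmetric])
  have gm: "15 / 16 < gauss_mass L" using L x by simp
  have mono: "0 \<le> \<phi>0" using \<phi>0 by simp
  show ?upper
  proof -
    have "P.prob {y \<in> space (sample_law n). v < tilt_sum n h y}
        \<le> exp (2 * h * s * L) / gauss_mass L * exp (- h * v) * (A * \<phi>0 * (1 + x) / h)"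
      by (rule P.tail_upper_of_smoothed_density)
        (use tilt_sum_measurable integrable_exp_tilt_sum_real s h0 gm L lD[unfolded l_def] in auto)
    also have "\<dots> = exp (2 * \<tau> * L) * (1 / gauss_mass L) * (1 + x) * (exp (- h * v) * (A * (\<phi>0 / h)))"
      using s by (simp add: mult_ac)
    also have "exp (- h * v) * (A * (\<phi>0 / h)) = exp (h * (h - v)) * moderate_tail n skew h"
      unfolding mt by (simp add: algebra_simps flip: exp_add)
    also have "exp (2 * \<tau> * L) * (1 / gauss_mass L) * (1 + x) * (exp (h * (h - v)) * moderate_tail n skew h)
        \<le> (1 + 6 * x) * (exp (h * (h - v)) * moderate_tail n skew h)"
    proof (rule mult_right_mono)
      have "exp (2 * \<tau> * L) \<le> exp x" using \<tau> by simp
      also have "\<dots> \<le> 1 + x + x\<^sup>2" using x by (intro exp_bound) auto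
      also have "\<dots> \<le> 1 + 2 * x" using x by (simp add: power2_eq_square mult_le_cancel_left1)
      finally have a: "exp (2 * \<tau> * L) \<le> 1 + 2 * x" .
      have "1 / gauss_mass L \<le> 1 / (1 - x)" using L x by (intro divide_left_mono) auto
      also have "\<dots> \<le> 1 + 2 * x" using x mult_left_mono[of "2 * x" 1 x] by (simp add: field_simps)
      finally have b: "1 / gauss_mass L \<le> 1 + 2 * x" .
      have xx: "x * x \<le> x / 16" "x * (x * x) \<le> x / 16"
        using x mult_mono[of x "1/16" x x] mult_mono[of x "1 / 16" "x * x" x] by (auto simp: mult_le_one mult.commute)
      have "exp (2 * \<tau> * L) * (1 / gauss_mass L) * (1 + x) \<le> (1 + 2 * x) * (1 + 2 * x) * (1 + x)"
        using a b x gm by (intro mult_mono) auto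
      also have "\<dots> = 1 + 5 * x + 8 * (x * x) + 4 * (x * (x * x))" by (simp add: algebra_simps)
      also have "\<dots> \<le> 1 + 6 * x" using xx x by linarith
      finally show "exp (2 * \<tau> * L) * (1 / gauss_mass L) * (1 + x) \<le> 1 + 6 * x" .
    qed (use h0 mono A in \<open>simp add: mt\<close>)
    finally show ?thesis by (simp add: mult.assoc)
  qed
  show ?lower
  proof -
    define p where "p = P.prob {y \<in> space (sample_law n). h < tilt_sum n h y}"
    define q where "q = exp (h * s * L + h\<^sup>2 * s\<^sup>2 / 2)"
    define \<epsilon> where "\<epsilon> = exp (L - L\<^sup>2 / 2) / gauss_mass L"
    have "A * \<phi>0 * (1 - 2 * x) * ((1 - exp (- R)) / h)
        \<le> q * exp (h * h) * p + \<epsilon> * (2 * s * (A * \<phi>0 * (1 + x)))"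
      unfolding q_def \<epsilon>_def p_def
    proof (rule P.tail_lower_of_smoothed_density)
      fix z assume z: "h \<le> z" "z \<le> h + s * L + R / h"
      have "z - h \<le> (\<tau> * L + R) / h" using z by (simp add: s_def add_divide_distrib)
      also have "\<dots> \<le> x" using R h0 by (simp add: divide_le_eq)
      finally have "(z - h)\<^sup>2 \<le> x\<^sup>2" using z by (intro power_mono) auto
      also have "\<dots> \<le> x" using x by (simp add: power2_eq_square mult_left_le)
      finally have "1 - x \<le> 1 - (z - h)\<^sup>2 / 2" using x by simp
      hence "\<phi>0 * (1 - x) \<le> \<phi>0 * (1 - (z - h)\<^sup>2 / 2)" using mono by (rule mult_left_mono)
      also have "\<dots> \<le> std_normal_density (z - h)" unfolding \<phi>0_def by (rule std_normal_density_bounds)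
      finally have "A * (\<phi>0 * (1 - x)) \<le> A * std_normal_density (z - h)" using A by (intro mult_left_mono) auto
      hence "A * \<phi>0 * (1 - 2 * x) \<le> l z" using close[of z] by (simp add: algebra_simps)
      thus "A * \<phi>0 * (1 - 2 * x) \<le> (\<integral>y. exp (h * tilt_sum n h y) * normal_density 0 s (z - tilt_sum n h y) \<partial>sample_law n)"
        by (simp add: l_def)
    qed (use tilt_sum_measurable integrable_exp_tilt_sum_real s h0 gm L lD[unfolded l_def] R A mono x in auto)
    moreover have "\<epsilon> * (2 * s * (A * \<phi>0 * (1 + x))) \<le> A * \<phi>0 * (2 * x) / h"
    proof -
      have "\<epsilon> * (2 * s * (A * \<phi>0 * (1 + x))) = (2 * (\<epsilon> * \<tau>) * (1 + x)) * (A * \<phi>0 / h)"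
        by (simp add: s_def)
      also have "\<dots> \<le> (2 * (x / 2) * 2) * (A * \<phi>0 / h)"
        using \<tau> x A mono h0 L gm unfolding \<epsilon>_def by (intro mult_right_mono mult_mono) auto
      finally show ?thesis by (simp add: mult_ac)
    qed
    moreover have "A * \<phi>0 * (1 - 2 * x) * ((1 - x) / h) \<le> A * \<phi>0 * (1 - 2 * x) * ((1 - exp (- R)) / h)"
      using A mono x R h0 by (intro mult_left_mono divide_right_mono) auto
    ultimately have "A * \<phi>0 * (1 - 2 * x) * ((1 - x) / h) - A * \<phi>0 * (2 * x) / h \<le> q * exp (h * h) * p" by linarith
    also have "A * \<phi>0 * (1 - 2 * x) * ((1 - x) / h) - A * \<phi>0 * (2 * x) / h = (A * \<phi>0 / h) * ((1 - 2 * x) * (1 - x) - 2 * x)"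
      using h0 by (simp add: field_simps)
    finally have *: "(A * \<phi>0 / h) * ((1 - 2 * x) * (1 - x) - 2 * x) \<le> q * exp (h * h) * p" .
    have q: "1 / q \<ge> 1 - x"
    proof -
      have "h * s * L + h\<^sup>2 * s\<^sup>2 / 2 \<le> x"
      proof -
        have "h\<^sup>2 * s\<^sup>2 = \<tau> * \<tau>" using s(2) unfolding power_mult_distrib[symmetric] by (simp only: power2_eq_square)
        also have "\<dots> \<le> x / 2 * 1" using \<tau>x \<tau> x by (intro mult_mono) auto
        finally show ?thesis using s \<tau> x by simp
      qed
      moreover have "1 / q = exp (- (h * s * L + h\<^sup>2 * s\<^sup>2 / 2))"
        unfolding q_def exp_minus by (simp only: inverse_eq_divide)
      ultimately show ?thesis using exp_ge_add_one_self[of "- (h * s * L + h\<^sup>2 * s\<^sup>2 / 2)"] by linarith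
    qed
    have "(1 - 6 * x) * moderate_tail n skew h \<le> ((1 - 2 * x) * (1 - x) - 2 * x) * (1 - x) * moderate_tail n skew h"
    proof (rule mult_right_mono)
      have "((1 - 2 * x) * (1 - x) - 2 * x) * (1 - x) = 1 - 6 * x + 7 * (x * x) - 2 * (x * (x * x))"
        by (simp add: algebra_simps)
      moreover have "x * (x * x) \<le> 1 * (x * x)" using x by (intro mult_right_mono) auto
      moreover have "0 \<le> x * x" by simp
      ultimately show "1 - 6 * x \<le> ((1 - 2 * x) * (1 - x) - 2 * x) * (1 - x)" by linarith
    qed (use h0 mono A in \<open>simp add: mt\<close>)
    also have "\<dots> = ((A * \<phi>0 / h) * ((1 - 2 * x) * (1 - x) - 2 * x)) * ((1 - x) * exp (- h * h))"
      unfolding mt by (simp add: mult_ac)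
    also have "\<dots> \<le> (q * exp (h * h) * p) * ((1 - x) * exp (- h * h))"
      using * x by (intro mult_right_mono) auto
    also have "\<dots> = (q * (1 - x)) * p * (exp (h * h) * exp (- h * h))" by (simp only: mult_ac)
    also have "exp (h * h) * exp (- h * h) = 1" by (simp flip: exp_add)
    also have "(q * (1 - x)) * p * 1 = (q * (1 - x)) * p" by simp
    also have "\<dots> \<le> 1 * p"
    proof (rule mult_right_mono)
      have "0 < q" by (simp add: q_def)
      thus "q * (1 - x) \<le> 1" using q by (simp add: field_simps)
    qed (simp add: p_def)
    finally show ?thesis by (simp add: p_def)
  qed
qed

lemma tilt_sum_tail:
  fixes \<eta> C :: real
  assumes \<eta>: "0 < \<eta>" and C: "1 \<le> C"
  obtains e0 h0 :: real where "0 < e0" "1 \<le> h0"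
    and "\<And>\<nu> n h e v. std_law \<nu> C \<Longrightarrow> 0 < n \<Longrightarrow> h0 \<le> h \<Longrightarrow> e \<le> e0 \<Longrightarrow> h\<^sup>2 \<le> e * sqrt (real n) \<Longrightarrow> 1 \<le> e * sqrt (real n) \<Longrightarrow>
      \<P>(y in power_measure n \<nu>. v < tilt_sum n h y)
        \<le> (1 + \<eta>) * exp (h * (h - v)) * moderate_tail n (std_law.skew \<nu>) h"
    and "\<And>\<nu> n h e. std_law \<nu> C \<Longrightarrow> 0 < n \<Longrightarrow> h0 \<le> h \<Longrightarrow> e \<le> e0 \<Longrightarrow> h\<^sup>2 \<le> e * sqrt (real n) \<Longrightarrow> 1 \<le> e * sqrt (real n) \<Longrightarrow>
      (1 - \<eta>) * moderate_tail n (std_law.skew \<nu>) h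
        \<le> \<P>(y in power_measure n \<nu>. h < tilt_sum n h y)"
proof -
  define x where "x = min (\<eta> / 6) (1 / 16)"
  have x: "0 < x" "x \<le> 1 / 16" "6 * x \<le> \<eta>" using \<eta> by (auto simp: x_def)
  obtain L where L: "1 \<le> L" "1 - x < gauss_mass L" using gauss_mass_large[of "1 - x"] x by auto
  have gm: "0 < gauss_mass L" using L x by simp
  define \<epsilon> where "\<epsilon> = exp (L - L\<^sup>2 / 2) / gauss_mass L"
  have \<epsilon>: "0 < \<epsilon>" using gm by (simp add: \<epsilon>_def)
  define \<tau> where "\<tau> = min (x / (2 * L)) (x / (2 * \<epsilon>))"
  have \<tau>: "0 < \<tau>" "\<tau> * L \<le> x / 2" "\<epsilon> * \<tau> \<le> x / 2"
  proof -
    show "0 < \<tau>" using x L \<epsilon> by (simp add: \<tau>_def)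
    have "\<tau> \<le> x / (2 * L)" "\<tau> \<le> x / (2 * \<epsilon>)" by (auto simp: \<tau>_def)
    thus "\<tau> * L \<le> x / 2" "\<epsilon> * \<tau> \<le> x / 2" using L \<epsilon> by (auto simp: field_simps)
  qed
  define R where "R = - ln x"
  have R: "0 \<le> R" "exp (- R) \<le> x" using x by (auto simp: R_def)
  define K where "K = tilt_const C"
  have K: "0 < K" using C by (simp add: K_def tilt_const_def add_pos_pos add_nonneg_pos)
  define B where "B = 384 * K + 3072 * K\<^sup>2 / \<tau> ^ 3"
  have B: "0 < B" using K \<tau> by (simp add: B_def add_pos_pos)
  define e0 where "e0 = min (1 / (4 * K)) (x / (8 * B))"
  have e0: "0 < e0" "e0 \<le> 1 / (4 * K)" "e0 \<le> x / (8 * B)" using K B x by (auto simp: e0_def)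
  define h0 where "h0 = max 1 ((\<tau> * L + R) / x)"
  have h0: "1 \<le> h0" "(\<tau> * L + R) / x \<le> h0" by (auto simp: h0_def)
  have hyps: "1 \<le> h" "e \<le> 1 / (4 * tilt_const C)" "\<tau> * L + R \<le> x * h"
     "384 * tilt_const C * e + 3072 * (tilt_const C)\<^sup>2 * e / \<tau> ^ 3 \<le> x / 8"
    if "h0 \<le> h" "e \<le> e0" for h e
  proof -
    show "1 \<le> h" "e \<le> 1 / (4 * tilt_const C)" using that h0 e0 by (auto simp: K_def)
    have "(\<tau> * L + R) / x \<le> h" using that h0 by linarith
    thus "\<tau> * L + R \<le> x * h" using x by (simp add: divide_le_eq mult.commute)
    have "384 * K * e + 3072 * K\<^sup>2 * e / \<tau> ^ 3 = B * e" by (simp add: B_def algebra_simps)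
    also have "\<dots> \<le> B * (x / (8 * B))" using that e0 B by (intro mult_left_mono) auto
    also have "\<dots> = x / 8" using B by simp
    finally show "384 * tilt_const C * e + 3072 * (tilt_const C)\<^sup>2 * e / \<tau> ^ 3 \<le> x / 8" by (simp add: K_def)
  qed
  have mt: "0 \<le> moderate_tail n \<kappa> h" if "h0 \<le> h" for n \<kappa> h
    using that h0 by (simp add: moderate_tail_def)
  show ?thesis
  proof (rule that[OF e0(1) h0(1)])
    fix \<nu> n h e v
    assume nu: "std_law \<nu> C" and a: "0 < n" "h0 \<le> h" "e \<le> e0" "h\<^sup>2 \<le> e * sqrt (real n)" "1 \<le> e * sqrt (real n)"
    interpret std_law \<nu> C by (rule nu)
    note hy = hyps[OF a(2,3)]
    have "\<P>(y in sample_law n. v < tilt_sum n h y)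
          \<le> (1 + 6 * x) * exp (h * (h - v)) * moderate_tail n skew h"
      by (rule tilt_sum_tail_bounds(1)[OF a(1) hy(1) a(4,5) hy(2) x(1,2) L \<tau>[unfolded \<epsilon>_def] R hy(3,4)])
    also have "\<dots> \<le> (1 + \<eta>) * exp (h * (h - v)) * moderate_tail n skew h"
      using x mt[OF a(2)] by (intro mult_right_mono) auto
    finally show "\<P>(y in sample_law n. v < tilt_sum n h y)
          \<le> (1 + \<eta>) * exp (h * (h - v)) * moderate_tail n skew h" .
  next
    fix \<nu> n h e
    assume nu: "std_law \<nu> C" and a: "0 < n" "h0 \<le> h" "e \<le> e0" "h\<^sup>2 \<le> e * sqrt (real n)" "1 \<le> e * sqrt (real n)"
    interpret std_law \<nu> C by (rule nu)
    note hy = hyps[OF a(2,3)]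
    have "(1 - \<eta>) * moderate_tail n skew h \<le> (1 - 6 * x) * moderate_tail n skew h"
      using x mt[OF a(2)] by (intro mult_right_mono) auto
    also have "\<dots> \<le> \<P>(y in sample_law n. h < tilt_sum n h y)"
      by (rule tilt_sum_tail_bounds(2)[OF a(1) hy(1) a(4,5) hy(2) x(1,2) L \<tau>[unfolded \<epsilon>_def] R hy(3,4)])
    finally show "(1 - \<eta>) * moderate_tail n skew h
        \<le> \<P>(y in sample_law n. h < tilt_sum n h y)" .
  qed
qed

section \<open>Moderate deviations of Student's statistic\<close>

text \<open>Thresholds are parametrised by \<open>u\<close> because \<open>t_stat\<close> exceeds \<open>crit_arg n u\<close> iff the
  self-normalised sum \<open>(\<Sum> X\<^sub>j) / sqrt (\<Sum> X\<^sub>j\<^sup>2)\<close> exceeds \<open>u\<close>, apart from constant samples.\<close>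

definition crit_arg :: "nat \<Rightarrow> real \<Rightarrow> real" where
  "crit_arg n u = u / sqrt (1 - u\<^sup>2 / n)"

definition raw_moment :: "nat \<Rightarrow> nat \<Rightarrow> (nat \<Rightarrow> real) \<Rightarrow> real" where
  "raw_moment n k y = (\<Sum>j=1..n. y j ^ k) / n"

lemma raw_moment_1: "raw_moment n 1 y = sample_mean n y"
  by (simp add: raw_moment_def sample_mean_def)

lemma sum_eq_mean: "0 < n \<Longrightarrow> (\<Sum>j=1..n. y j) = n * sample_mean n y"
  by (simp add: sample_mean_def)

lemma sum_power_eq_raw_moment: "0 < n \<Longrightarrow> (\<Sum>j=1..n. y j ^ k) = n * raw_moment n k y"
  by (simp add: raw_moment_def)

lemma sample_var_eq:
  assumes "0 < n"
  shows "(\<Sum>j=1..n. (y j - sample_mean n y)\<^sup>2) / n = raw_moment n 2 y - (sample_mean n y)\<^sup>2"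
proof -
  define m where "m = sample_mean n y"
  have "(\<Sum>j=1..n. (y j - m)\<^sup>2) = (\<Sum>j=1..n. y j ^ 2 - 2 * m * y j + m\<^sup>2)"
    by (simp add: power2_diff algebra_simps)
  also have "\<dots> = (\<Sum>j=1..n. y j ^ 2) - 2 * m * (\<Sum>j=1..n. y j) + n * m\<^sup>2"
    by (simp add: sum.distrib sum_subtractf sum_distrib_left)
  also have "\<dots> = n * (raw_moment n 2 y - m\<^sup>2)"
    unfolding sum_power_eq_raw_moment[OF assms] sum_eq_mean[OF assms] m_def[symmetric]
    by (simp add: algebra_simps power2_eq_square)
  finally show ?thesis using assms by (simp add: m_def)
qed

lemma sample_sd_eq: "0 < n \<Longrightarrow> sample_sd n y = sqrt (raw_moment n 2 y - (sample_mean n y)\<^sup>2)"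
  using sample_var_eq[of n y] by (simp add: sample_sd_def)

lemma sample_var_nonneg: "0 < n \<Longrightarrow> (sample_mean n y)\<^sup>2 \<le> raw_moment n 2 y"
  using sample_var_eq[of n y] sum_nonneg[of "{1..n}" "\<lambda>j. (y j - sample_mean n y)\<^sup>2"]
  by (smt (verit) divide_nonneg_nonneg of_nat_0_le_iff zero_le_power2)

lemma less_iff_power2_less: "0 \<le> a \<Longrightarrow> 0 \<le> b \<Longrightarrow> a < b \<longleftrightarrow> a\<^sup>2 < b\<^sup>2" for a b :: real
  using power_mono_iff[of b a 2] by (simp add: not_le[symmetric])

lemma t_stat_gt_crit_arg_iff:
  assumes n: "0 < n" and u: "0 < u" "u\<^sup>2 < n"
  shows "crit_arg n u < t_stat n y \<longleftrightarrow>
    (sample_mean n y)\<^sup>2 < raw_moment n 2 y \<and> u * sqrt (raw_moment n 2 y) < sqrt n * sample_mean n y"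
proof (cases "(sample_mean n y)\<^sup>2 < raw_moment n 2 y")
  case False
  hence "raw_moment n 2 y = (sample_mean n y)\<^sup>2" using sample_var_nonneg[OF n, of y] by simp
  hence "t_stat n y = 0" by (simp add: t_stat_def sample_sd_eq[OF n])
  moreover have "0 < crit_arg n u" using u n by (simp add: crit_arg_def)
  ultimately show ?thesis using False by simp
next
  case True
  define m where "m = sample_mean n y"
  define q where "q = raw_moment n 2 y"
  have q: "m\<^sup>2 < q" using True by (simp add: m_def q_def)
  have c: "0 < crit_arg n u" using u n by (simp add: crit_arg_def)
  have c2: "(crit_arg n u)\<^sup>2 = u\<^sup>2 * n / (n - u\<^sup>2)"
    using u n by (simp add: crit_arg_def power_divide field_simps)
  have "crit_arg n u < t_stat n y \<longleftrightarrow> crit_arg n u * sqrt (q - m\<^sup>2) < sqrt n * m"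
    using q by (simp add: t_stat_def sample_sd_eq[OF n] m_def q_def pos_less_divide_eq)
  also have "\<dots> \<longleftrightarrow> 0 < m \<and> (crit_arg n u)\<^sup>2 * (q - m\<^sup>2) < n * m\<^sup>2"
  proof -
    have l0: "0 \<le> crit_arg n u * sqrt (q - m\<^sup>2)" using c q by simp
    show ?thesis
    proof (cases "0 < m")
      case True
      have "crit_arg n u * sqrt (q - m\<^sup>2) < sqrt n * m \<longleftrightarrow> (crit_arg n u * sqrt (q - m\<^sup>2))\<^sup>2 < (sqrt n * m)\<^sup>2"
        using l0 True by (intro less_iff_power2_less) auto
      also have "\<dots> \<longleftrightarrow> (crit_arg n u)\<^sup>2 * (q - m\<^sup>2) < n * m\<^sup>2"
        using q by (simp add: power_mult_distrib)
      finally show ?thesis using True by simp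
    next
      case False
      hence "sqrt n * m \<le> 0" by (simp add: mult_nonneg_nonpos)
      thus ?thesis using l0 False by simp
    qed
  qed
  also have "(crit_arg n u)\<^sup>2 * (q - m\<^sup>2) < n * m\<^sup>2 \<longleftrightarrow> u\<^sup>2 * q < n * m\<^sup>2"
  proof -
    have "(crit_arg n u)\<^sup>2 * (q - m\<^sup>2) < n * m\<^sup>2 \<longleftrightarrow> n * (u\<^sup>2 * (q - m\<^sup>2)) < n * (m\<^sup>2 * (n - u\<^sup>2))"
      unfolding c2 using u by (simp add: pos_divide_less_eq mult_ac)
    also have "\<dots> \<longleftrightarrow> u\<^sup>2 * (q - m\<^sup>2) < m\<^sup>2 * (n - u\<^sup>2)" using n by simp
    finally show ?thesis by (simp add: algebra_simps)
  qed
  also have "0 < m \<and> u\<^sup>2 * q < n * m\<^sup>2 \<longleftrightarrow> u * sqrt q < sqrt n * m"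
  proof -
    have q0: "0 \<le> q" using q zero_le_power2[of m] by linarith
    hence l0: "0 \<le> u * sqrt q" using u by simp
    show ?thesis
    proof (cases "0 < m")
      case True
      have "u * sqrt q < sqrt n * m \<longleftrightarrow> (u * sqrt q)\<^sup>2 < (sqrt n * m)\<^sup>2"
        using l0 True by (intro less_iff_power2_less) auto
      thus ?thesis using True q0 by (simp add: power_mult_distrib)
    next
      case False
      hence "sqrt n * m \<le> 0" by (simp add: mult_nonneg_nonpos)
      thus ?thesis using l0 False by simp
    qed
  qed
  finally show ?thesis using True by (simp add: m_def q_def)
qed

lemma tilt_sum_eq:
  assumes "0 < n"
  shows "tilt_sum n h y = sqrt n * sample_mean n y - h / 2 * (raw_moment n 2 y - 1)"
proof -
  define c where "c = h / (2 * sqrt n)"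
  have "(\<Sum>j=1..n. tilt_arg (h / sqrt n) (y j)) = (\<Sum>j=1..n. y j - c * (y j ^ 2 - 1))"
    by (simp add: tilt_arg_def c_def field_simps)
  also have "\<dots> = (\<Sum>j=1..n. y j) - c * (\<Sum>j=1..n. y j ^ 2 - 1)"
    by (subst sum_distrib_left) (rule sum_subtractf)
  also have "\<dots> = (\<Sum>j=1..n. y j) - c * ((\<Sum>j=1..n. y j ^ 2) - n)"
    by (simp add: sum_subtractf)
  also have "\<dots> = n * sample_mean n y - c * (n * (raw_moment n 2 y - 1))"
    unfolding sum_power_eq_raw_moment[OF assms] sum_eq_mean[OF assms] by (simp add: algebra_simps)
  also have "\<dots> / sqrt n = sqrt n * sample_mean n y - h / 2 * (raw_moment n 2 y - 1)"
  proof -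
    have "(s * s * m - h / (2 * s) * (s * s * q)) / s = s * m - h / 2 * q" if "0 < s" for s m q :: real
    proof -
      have "h / (2 * s) * (s * s * q) = s * (h / 2 * q)" using that by simp
      hence "s * s * m - h / (2 * s) * (s * s * q) = s * (s * m - h / 2 * q)"
        by (simp add: right_diff_distrib)
      thus ?thesis using that by simp
    qed
    from this[of "sqrt n"] assms show ?thesis by (simp add: c_def)
  qed
  finally show ?thesis by (simp add: tilt_sum_def)
qed

lemma sqrt_bounds:
  fixes d :: real
  assumes "-1 \<le> d"
  shows "sqrt (1 + d) \<le> 1 + d / 2" and "1 + d / 2 - d\<^sup>2 / 2 \<le> sqrt (1 + d)"
proof -
  define r where "r = sqrt (1 + d)"
  have r: "0 \<le> r" "d = r\<^sup>2 - 1" using assms by (auto simp: r_def)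
  have "0 \<le> (r - 1)\<^sup>2" by simp
  hence "2 * r \<le> 2 + d" by (simp add: r(2) power2_eq_square algebra_simps)
  thus "sqrt (1 + d) \<le> 1 + d / 2" unfolding r_def[symmetric] by simp
  have "0 \<le> (r - 1)\<^sup>2 * (r * (r + 2))" using r by simp
  also have "\<dots> = 2 * r - 2 - d + d\<^sup>2"
    by (simp add: r(2) power2_eq_square algebra_simps)
  finally have "2 + d - d\<^sup>2 \<le> 2 * r" by simp
  thus "1 + d / 2 - d\<^sup>2 / 2 \<le> sqrt (1 + d)" unfolding r_def[symmetric] by simp
qed

lemma t_stat_gt_imp_tilt_sum:
  assumes n: "0 < n" and u: "0 < u" "u\<^sup>2 < n"
    and gt: "crit_arg n u < t_stat n y" and r: "\<bar>raw_moment n 2 y - 1\<bar> \<le> r"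
  shows "u - u * r\<^sup>2 / 2 < tilt_sum n u y"
proof -
  define d where "d = raw_moment n 2 y - 1"
  have q0: "0 \<le> raw_moment n 2 y" by (simp add: raw_moment_def sum_nonneg)
  hence d1: "-1 \<le> d" by (simp add: d_def)
  have "d\<^sup>2 \<le> r\<^sup>2" using power_mono[OF r, of 2] by (simp add: d_def)
  hence "u - u * r\<^sup>2 / 2 \<le> u - u * d\<^sup>2 / 2" using u by simp
  also have "\<dots> = u * (1 + d / 2 - d\<^sup>2 / 2) - u / 2 * d" by (simp add: algebra_simps)
  also have "\<dots> \<le> u * sqrt (1 + d) - u / 2 * d"
    using sqrt_bounds(2)[OF d1] u by simp
  also have "\<dots> < sqrt n * sample_mean n y - u / 2 * d"
    using gt t_stat_gt_crit_arg_iff[OF n u, of y] by (simp add: d_def)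
  also have "\<dots> = tilt_sum n u y" by (simp add: tilt_sum_eq[OF n] d_def)
  finally show ?thesis .
qed

lemma tilt_sum_imp_t_stat_gt:
  assumes n: "0 < n" and u: "0 < u" "u\<^sup>2 < n"
    and gt: "u < tilt_sum n u y" and r: "\<bar>raw_moment n 2 y - 1\<bar> < 1 / 2" "\<bar>sample_mean n y\<bar> < 1 / 2"
  shows "crit_arg n u < t_stat n y"
proof -
  define d where "d = raw_moment n 2 y - 1"
  have d1: "-1 \<le> d" using r unfolding d_def by linarith
  have "u * sqrt (1 + d) \<le> u * (1 + d / 2)" using sqrt_bounds(1)[OF d1] u by simp
  also have "\<dots> = u + u / 2 * d" by (simp add: algebra_simps)
  also have "\<dots> < sqrt n * sample_mean n y" using gt by (simp add: tilt_sum_eq[OF n] d_def)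
  finally have "u * sqrt (raw_moment n 2 y) < sqrt n * sample_mean n y" by (simp add: d_def)
  moreover have "(sample_mean n y)\<^sup>2 < raw_moment n 2 y"
  proof -
    have "\<bar>sample_mean n y\<bar>\<^sup>2 \<le> (1 / 2)\<^sup>2" using r by (intro power_mono) auto
    hence "(sample_mean n y)\<^sup>2 \<le> 1 / 4" by (simp add: power2_eq_square)
    moreover have "1 / 2 < raw_moment n 2 y" using r by linarith
    ultimately show ?thesis by simp
  qed
  ultimately show ?thesis using t_stat_gt_crit_arg_iff[OF n u, of y] by simp
qed

lemma indep_vars_PiM_components:
  assumes N: "prob_space N" and I: "I \<noteq> {}"
  shows "prob_space.indep_vars (Pi\<^sub>M I (\<lambda>_. N)) (\<lambda>_. N) (\<lambda>i y. y i) I"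
proof -
  interpret P: prob_space "Pi\<^sub>M I (\<lambda>_. N)" by (intro prob_space_PiM N)
  have "distr (Pi\<^sub>M I (\<lambda>_. N)) (Pi\<^sub>M I (\<lambda>_. N)) (\<lambda>x. \<lambda>i\<in>I. x i) = distr (Pi\<^sub>M I (\<lambda>_. N)) (Pi\<^sub>M I (\<lambda>_. N)) (\<lambda>x. x)"
    by (intro distr_cong) (auto simp: space_PiM)
  also have "\<dots> = Pi\<^sub>M I (\<lambda>_. N)" by (rule distr_id)
  also have "\<dots> = (\<Pi>\<^sub>M i\<in>I. distr (Pi\<^sub>M I (\<lambda>_. N)) N (\<lambda>y. y i))"
    by (intro PiM_cong refl distr_PiM_component[symmetric] N)
  finally show ?thesis using I by (subst P.indep_vars_iff_distr_eq_PiM') auto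
qed

lemma (in prob_space) iid_prob_eq:
  fixes X :: "nat \<Rightarrow> 'a \<Rightarrow> real"
  assumes n: "0 < n" and ind: "indep_vars (\<lambda>_. borel) X {1..n}"
    and d: "\<And>j. j \<in> {1..n} \<Longrightarrow> distr M borel (X j) = \<nu>"
    and A: "A \<in> sets (power_measure n borel)"
  shows "prob {\<omega> \<in> space M. (\<lambda>j\<in>{1..n}. X j \<omega>) \<in> A} = measure (power_measure n \<nu>) A"
proof -
  have rv: "\<And>j. j \<in> {1..n} \<Longrightarrow> random_variable borel (X j)"
    using ind unfolding indep_vars_def by blast
  have "distr M (power_measure n borel) (\<lambda>x. \<lambda>i\<in>{1..n}. X i x) = (\<Pi>\<^sub>M i\<in>{1..n}. distr M borel (X i))"
    using ind n rv by (subst indep_vars_iff_distr_eq_PiM'[symmetric]) auto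
  also have "\<dots> = power_measure n \<nu>" using d by (intro PiM_cong) auto
  finally have "measure (power_measure n \<nu>) A
      = measure (distr M (power_measure n borel) (\<lambda>x. \<lambda>i\<in>{1..n}. X i x)) A" by simp
  also have "\<dots> = prob ((\<lambda>x. \<lambda>i\<in>{1..n}. X i x) -` A \<inter> space M)"
    using rv A by (intro measure_distr measurable_restrict) auto
  also have "(\<lambda>x. \<lambda>i\<in>{1..n}. X i x) -` A \<inter> space M = {\<omega> \<in> space M. (\<lambda>j\<in>{1..n}. X j \<omega>) \<in> A}" by auto
  finally show ?thesis by simp
qed

lemma sample_stat_measurable_borel [measurable]:
  "sample_mean n \<in> borel_measurable (power_measure n borel)"
  "raw_moment n k \<in> borel_measurable (power_measure n borel)"
  "t_stat n \<in> borel_measurable (power_measure n borel)"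
  unfolding t_stat_def[abs_def] sample_sd_def[abs_def] sample_mean_def[abs_def] raw_moment_def[abs_def]
  by measurable

context std_law
begin

lemma sample_stat_measurable [measurable]:
  "sample_mean n \<in> borel_measurable (sample_law n)" "raw_moment n k \<in> borel_measurable (sample_law n)"
  "t_stat n \<in> borel_measurable (sample_law n)"
  using sample_stat_measurable_borel[of n]
  by (simp_all add: measurable_cong_sets[OF sets_PiM_cong[OF refl sets_law] refl])

lemma moment_deviation:
  assumes n: "0 < n" and r: "0 \<le> r"
  shows "\<P>(y in sample_law n. r \<le> \<bar>raw_moment n k y - (\<integral>x. x ^ k \<partial>\<nu>)\<bar>)
    \<le> 2 * exp (- (n * r\<^sup>2 / (2 * C ^ (2 * k))))"
proof -
  interpret P: prob_space "sample_law n" by (rule prob_space_sample_law)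
  have one: "1 \<in> {1..n}" using n by auto
  have comp: "distr (sample_law n) \<nu> (\<lambda>y. y j) = \<nu>" if "j \<in> {1..n}" for j
    using distr_PiM_component[of "{1..n}" "\<lambda>_. \<nu>" j] that prob_space_axioms by simp
  have m: "(\<lambda>y. y j) \<in> measurable (sample_law n) \<nu>" if "j \<in> {1..n}" for j
    using that by measurable
  have pw: "(\<lambda>x. x ^ k) \<in> measurable \<nu> borel" by measurable
  have dk: "distr (sample_law n) borel (\<lambda>y. y j ^ k) = distr \<nu> borel (\<lambda>x. x ^ k)" if "j \<in> {1..n}" for j
  proof -
    have "distr (sample_law n) borel (\<lambda>y. y j ^ k) = distr (distr (sample_law n) \<nu> (\<lambda>y. y j)) borel (\<lambda>x. x ^ k)"
      using m[OF that] pw by (subst distr_distr) (auto simp: comp_def)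
    thus ?thesis by (simp only: comp[OF that])
  qed
  interpret H: Hoeffding_ineq_iid "sample_law n" "{1..n}" "\<lambda>j y. y j ^ k" "\<lambda>y. y 1 ^ k" "- (C ^ k)" "C ^ k"
      "P.expectation (\<lambda>y. y 1 ^ k)"
  proof unfold_locales
    have "P.indep_vars (\<lambda>_. \<nu>) (\<lambda>j y. y j) {1..n}"
      by (rule indep_vars_PiM_components[OF prob_space_axioms]) (use n in auto)
    thus "P.indep_vars (\<lambda>_. borel) (\<lambda>j y. y j ^ k) {1..n}"
      by (rule P.indep_vars_compose2) measurable
    show "distr (sample_law n) borel (\<lambda>y. y i ^ k) = distr (sample_law n) borel (\<lambda>y. y 1 ^ k)" if "i \<in> {1..n}" for i
      using dk[OF that] dk[OF one] by simp
    show "P.random_variable borel (\<lambda>y. y 1 ^ k)" using one by measurable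
    have "AE x in \<nu>. x ^ k \<in> {- (C ^ k)..C ^ k}"
      using bounded_law
    proof eventually_elim
      case (elim x)
      hence "\<bar>x\<bar> ^ k \<le> C ^ k" by (intro power_mono) auto
      thus ?case by (simp flip: power_abs add: abs_le_iff)
    qed
    thus "AE y in sample_law n. y 1 ^ k \<in> {- (C ^ k)..C ^ k}"
      by (intro AE_PiM_component[where P = "\<lambda>x. x ^ k \<in> {- (C ^ k)..C ^ k}"] one prob_space_axioms)
  qed auto
  have E: "P.expectation (\<lambda>y. y 1 ^ k) = (\<integral>x. x ^ k \<partial>\<nu>)"
  proof -
    have "P.expectation (\<lambda>y. y 1 ^ k) = (\<integral>x. x ^ k \<partial>distr (sample_law n) \<nu> (\<lambda>y. y 1))"
      using m[OF one] pw by (subst integral_distr) auto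
    thus ?thesis by (simp only: comp[OF one])
  qed
  have Ck: "0 < C ^ k" using C_ge_1 by simp
  have "P.prob {y \<in> space (sample_law n). r \<le> \<bar>(\<Sum>j\<in>{1..n}. y j ^ k) / real (card {1..n}) - P.expectation (\<lambda>y. y 1 ^ k)\<bar>}
      \<le> 2 * exp (- 2 * real (card {1..n}) * r\<^sup>2 / (C ^ k - - (C ^ k))\<^sup>2)"
    by (rule H.Hoeffding_ineq_abs_ge'[OF r]) (use Ck n in auto)
  also have "- 2 * real (card {1..n}) * r\<^sup>2 / (C ^ k - - (C ^ k))\<^sup>2 = - (n * r\<^sup>2 / (2 * C ^ (2 * k)))"
  proof -
    have "- 2 * N * R / (c - - c)\<^sup>2 = - (N * R / (2 * c\<^sup>2))" for N R c :: real
      by (simp add: power2_eq_square)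
    thus ?thesis by (simp only: power_even_eq card_atLeastAtMost diff_Suc_1)
  qed
  finally show ?thesis unfolding E raw_moment_def by simp
qed

end

text \<open>At this deviation Hoeffding's bound is \<open>exp (- c sqrt n)\<close>, while the effect on the tails at
  \<open>u = o(n\<^sup>1\<^sup>/\<^sup>4)\<close> is still negligible.\<close>

definition slow_radius :: "nat \<Rightarrow> real" where
  "slow_radius n = 1 / sqrt (sqrt n)"

lemma slow_radius:
  assumes "0 < n"
  shows "0 < slow_radius n" "(slow_radius n)\<^sup>2 = 1 / sqrt n" "n * (slow_radius n)\<^sup>2 = sqrt n"
proof -
  show "0 < slow_radius n" "(slow_radius n)\<^sup>2 = 1 / sqrt n" using assms by (auto simp: slow_radius_def power_divide)
  thus "n * (slow_radius n)\<^sup>2 = sqrt n" by (simp add: real_div_sqrt)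
qed

lemma slow_radius_less_half:
  assumes "16 < n"
  shows "slow_radius n < 1 / 2"
proof -
  have "sqrt (4\<^sup>2) < sqrt n" using assms by (intro real_sqrt_less_mono) simp
  hence "4 < sqrt n" by (simp only: real_sqrt_abs abs_numeral)
  hence "sqrt (2\<^sup>2) < sqrt (sqrt n)" by (intro real_sqrt_less_mono) simp
  hence "2 < sqrt (sqrt n)" by (simp only: real_sqrt_abs abs_numeral)
  thus ?thesis unfolding slow_radius_def using assms by (intro divide_strict_left_mono) auto
qed

context std_law
begin

lemma moment_deviation_slow:
  assumes n: "0 < n" and k: "k \<le> 3"
  shows "\<P>(y in sample_law n. slow_radius n \<le> \<bar>raw_moment n k y - (\<integral>x. x ^ k \<partial>\<nu>)\<bar>)
    \<le> 2 * exp (- (sqrt n / (2 * C ^ 6)))"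
proof -
  have "C ^ (2 * k) \<le> C ^ 6" using C_ge_1 k by (intro power_increasing) auto
  moreover have "0 < C ^ (2 * k)" using C_ge_1 by simp
  ultimately have "sqrt n / (2 * C ^ 6) \<le> sqrt n / (2 * C ^ (2 * k))"
    using C_ge_1 by (intro divide_left_mono) auto
  hence "2 * exp (- (n * (slow_radius n)\<^sup>2 / (2 * C ^ (2 * k)))) \<le> 2 * exp (- (sqrt n / (2 * C ^ 6)))"
    unfolding slow_radius(3)[OF n] by simp
  thus ?thesis using moment_deviation[OF n less_imp_le[OF slow_radius(1)[OF n]], of k] by linarith
qed

lemma t_stat_tail_vs_tilt_sum:
  assumes n: "16 < n" and u: "0 < u" "u\<^sup>2 < n"
  shows "\<P>(y in sample_law n. crit_arg n u < t_stat n y)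
      \<le> \<P>(y in sample_law n. u - u / (2 * sqrt n) < tilt_sum n u y) + 4 * exp (- (sqrt n / (2 * C ^ 6)))"
    and "\<P>(y in sample_law n. u < tilt_sum n u y) - 4 * exp (- (sqrt n / (2 * C ^ 6)))
      \<le> \<P>(y in sample_law n. crit_arg n u < t_stat n y)"
proof -
  interpret P: prob_space "sample_law n" by (rule prob_space_sample_law)
  let ?S = "space (sample_law n)"
  have n0: "0 < n" using n by simp
  define b where "b = exp (- (sqrt n / (2 * C ^ 6)))"
  define D1 where "D1 = {y \<in> ?S. slow_radius n \<le> \<bar>raw_moment n 1 y - (\<integral>x. x ^ 1 \<partial>\<nu>)\<bar>}"
  define D2 where "D2 = {y \<in> ?S. slow_radius n \<le> \<bar>raw_moment n 2 y - (\<integral>x. x ^ 2 \<partial>\<nu>)\<bar>}"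
  have D: "P.prob D1 \<le> 2 * b" "P.prob D2 \<le> 2 * b"
    unfolding D1_def D2_def b_def by (rule moment_deviation_slow[OF n0]; simp)+
  have [measurable]: "D1 \<in> P.events" "D2 \<in> P.events" unfolding D1_def D2_def by measurable
  have notD: "\<bar>sample_mean n y\<bar> < slow_radius n" if "y \<in> ?S" "y \<notin> D1" for y
    using that raw_moment_1[of n y] by (simp add: D1_def mean_law)
  have notD2: "\<bar>raw_moment n 2 y - 1\<bar> < slow_radius n" if "y \<in> ?S" "y \<notin> D2" for y
    using that by (simp add: D2_def variance_law)
  have "P.prob {y \<in> ?S. crit_arg n u < t_stat n y} \<le> P.prob ({y \<in> ?S. u - u / (2 * sqrt n) < tilt_sum n u y} \<union> D2)"
  proof (intro P.finite_measure_mono subsetI)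
    fix y assume y: "y \<in> {y \<in> ?S. crit_arg n u < t_stat n y}"
    show "y \<in> {y \<in> ?S. u - u / (2 * sqrt n) < tilt_sum n u y} \<union> D2"
    proof (cases "y \<in> D2")
      case False
      have "u - u * (slow_radius n)\<^sup>2 / 2 < tilt_sum n u y"
        using y notD2[of y] False by (intro t_stat_gt_imp_tilt_sum[OF n0 u]) auto
      thus ?thesis using y by (simp add: slow_radius(2)[OF n0] mult.commute)
    qed simp
  qed measurable
  also have "\<dots> \<le> P.prob {y \<in> ?S. u - u / (2 * sqrt n) < tilt_sum n u y} + P.prob D2"
    by (rule measure_Un_le) measurable
  finally show "P.prob {y \<in> ?S. crit_arg n u < t_stat n y}
      \<le> P.prob {y \<in> ?S. u - u / (2 * sqrt n) < tilt_sum n u y} + 4 * exp (- (sqrt n / (2 * C ^ 6)))"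
    using D exp_ge_zero[of "- (sqrt n / (2 * C ^ 6))"] unfolding b_def by linarith
  have "P.prob {y \<in> ?S. u < tilt_sum n u y} \<le> P.prob ({y \<in> ?S. crit_arg n u < t_stat n y} \<union> (D1 \<union> D2))"
  proof (intro P.finite_measure_mono subsetI)
    fix y assume y: "y \<in> {y \<in> ?S. u < tilt_sum n u y}"
    show "y \<in> {y \<in> ?S. crit_arg n u < t_stat n y} \<union> (D1 \<union> D2)"
    proof (cases "y \<in> D1 \<union> D2")
      case False
      have "crit_arg n u < t_stat n y"
        using y notD[of y] notD2[of y] False slow_radius_less_half[OF n]
        by (intro tilt_sum_imp_t_stat_gt[OF n0 u]) auto
      thus ?thesis using y by simp
    qed simp
  qed measurable
  also have "\<dots> \<le> P.prob {y \<in> ?S. crit_arg n u < t_stat n y} + P.prob (D1 \<union> D2)"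
    by (rule measure_Un_le) measurable
  also have "P.prob (D1 \<union> D2) \<le> P.prob D1 + P.prob D2" by (rule measure_Un_le) measurable
  finally show "P.prob {y \<in> ?S. u < tilt_sum n u y} - 4 * exp (- (sqrt n / (2 * C ^ 6)))
      \<le> P.prob {y \<in> ?S. crit_arg n u < t_stat n y}"
    using D exp_ge_zero[of "- (sqrt n / (2 * C ^ 6))"] unfolding b_def by linarith
qed

lemma std_law_uminus:
  "std_law (distr \<nu> borel uminus) C" "std_law.skew (distr \<nu> borel uminus) = - skew"
proof -
  interpret N: prob_space "distr \<nu> borel uminus" by (rule prob_space_distr) measurable
  have i: "(\<integral>x. f x \<partial>distr \<nu> borel uminus) = (\<integral>x. f (- x) \<partial>\<nu>)"
    if [measurable]: "f \<in> borel_measurable borel" for f :: "real \<Rightarrow> real"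
    by (rule integral_distr) measurable
  show *: "std_law (distr \<nu> borel uminus) C"
  proof
    show "AE x in distr \<nu> borel uminus. \<bar>x\<bar> \<le> C"
      by (subst AE_distr_iff) (use bounded_law in auto)
  qed (use mean_law variance_law in \<open>simp_all add: i\<close>)
  interpret U: std_law "distr \<nu> borel uminus" C by (rule *)
  show "U.skew = - skew" by (simp add: U.skew_def skew_def i)
qed

lemma t_stat_uminus: "t_stat n (\<lambda>j. - y j) = - t_stat n y"
proof -
  have m: "sample_mean n (\<lambda>j. - y j) = - sample_mean n y" by (simp add: sample_mean_def sum_negf)
  have "(- a - - b)\<^sup>2 = (a - b)\<^sup>2" for a b :: real by (simp add: power2_commute)
  hence "sample_sd n (\<lambda>j. - y j) = sample_sd n y" unfolding sample_sd_def m by (simp only:)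
  thus ?thesis by (simp add: t_stat_def m)
qed

lemma t_stat_cong: "(\<And>j. j \<in> {1..n} \<Longrightarrow> y j = z j) \<Longrightarrow> t_stat n y = t_stat n z"
  by (simp add: t_stat_def sample_sd_def sample_mean_def)

lemma measure_abs_t_stat:
  assumes n: "0 < n" and x: "0 < x"
  shows "\<P>(y in sample_law n. x < \<bar>t_stat n y\<bar>)
    = \<P>(y in sample_law n. x < t_stat n y)
    + \<P>(y in power_measure n (distr \<nu> borel uminus). x < t_stat n y)"
proof -
  interpret P: prob_space "sample_law n" by (rule prob_space_sample_law)
  let ?S = "space (sample_law n)"
  have sp: "space (power_measure n (distr \<nu> borel uminus)) = space (power_measure n borel)"
    by (simp add: space_PiM)
  have comp: "distr (sample_law n) \<nu> (\<lambda>y. y j) = \<nu>" if "j \<in> {1..n}" for j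
    using distr_PiM_component[of "{1..n}" "\<lambda>_. \<nu>" j] that prob_space_axioms by simp
  have A: "{y \<in> space (power_measure n borel). x < t_stat n y} \<in> sets (power_measure n borel)"
    by measurable
  have "P.indep_vars (\<lambda>_. \<nu>) (\<lambda>j y. y j) {1..n}"
    by (rule indep_vars_PiM_components[OF prob_space_axioms]) (use n in auto)
  hence ind: "P.indep_vars (\<lambda>_. borel) (\<lambda>j y. - y j) {1..n}"
    by (rule P.indep_vars_compose2) measurable
  have d: "distr (sample_law n) borel (\<lambda>y. - y j) = distr \<nu> borel uminus" if "j \<in> {1..n}" for j
  proof -
    have "distr (sample_law n) borel (\<lambda>y. - y j) = distr (distr (sample_law n) \<nu> (\<lambda>y. y j)) borel uminus"
      using that by (subst distr_distr) (auto simp: comp_def)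
    thus ?thesis by (simp only: comp[OF that])
  qed
  have "t_stat n (\<lambda>j\<in>{1..n}. - y j) = - t_stat n y" for y
    using t_stat_cong[of n "\<lambda>j\<in>{1..n}. - y j" "\<lambda>j. - y j"] by (simp add: t_stat_uminus)
  hence eq: "{y \<in> ?S. (\<lambda>j\<in>{1..n}. - y j) \<in> {y \<in> space (power_measure n borel). x < t_stat n y}} = {y \<in> ?S. x < - t_stat n y}"
    by (auto simp: space_PiM)
  have neg: "P.prob {y \<in> ?S. x < - t_stat n y} = \<P>(y in power_measure n (distr \<nu> borel uminus). x < t_stat n y)"
    using P.iid_prob_eq[OF n ind d A] unfolding eq sp by simp
  have "{y \<in> ?S. x < \<bar>t_stat n y\<bar>} = {y \<in> ?S. x < t_stat n y} \<union> {y \<in> ?S. x < - t_stat n y}"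
    using x by (auto simp: abs_if split: if_splits)
  also have "P.prob \<dots> = P.prob {y \<in> ?S. x < t_stat n y} + P.prob {y \<in> ?S. x < - t_stat n y}"
  proof (rule P.finite_measure_Union)
    show "{y \<in> ?S. x < t_stat n y} \<in> P.events" "{y \<in> ?S. x < - t_stat n y} \<in> P.events" by measurable
  qed (use x in auto)
  finally show ?thesis by (simp only: neg)
qed

end

lemma moderate_tail_lower:
  assumes "0 < n" "1 \<le> u" "u\<^sup>2 \<le> e * sqrt n" "1 \<le> e * sqrt n" "\<bar>\<kappa>\<bar> \<le> C" "C * e \<le> 3 / 4" "1 \<le> C"
  shows "exp (- (e * sqrt n)) / 4 \<le> moderate_tail n \<kappa> u"
proof -
  have sn: "0 < sqrt n" using assms(1) by simp
  have e0: "0 < e" using assms(4) sn by (smt (verit) mult_nonpos_nonneg)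
  have ue: "u \<le> e * sqrt n"
  proof (rule power2_le_imp_le)
    have "u\<^sup>2 \<le> e * sqrt n * 1" using assms by simp
    also have "\<dots> \<le> e * sqrt n * (e * sqrt n)" using assms e0 sn by (intro mult_left_mono) auto
    finally show "u\<^sup>2 \<le> (e * sqrt n)\<^sup>2" by (simp add: power2_eq_square)
  qed (use e0 sn in simp)
  have "\<kappa> * u ^ 3 / (3 * sqrt n) \<le> u\<^sup>2 / 4"
  proof -
    have "\<kappa> * u ^ 3 \<le> C * (u\<^sup>2 * u)"
      using assms by (intro mult_mono) (auto simp: power2_eq_square power3_eq_cube)
    also have "\<dots> \<le> C * (u\<^sup>2 * (e * sqrt n))" using assms ue by (intro mult_left_mono) auto
    also have "\<dots> = (C * e) * (u\<^sup>2 * sqrt n)" by simp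
    also have "\<dots> \<le> 3 / 4 * (u\<^sup>2 * sqrt n)" using assms by (intro mult_right_mono) auto
    finally have "\<kappa> * u ^ 3 \<le> u\<^sup>2 / 4 * (3 * sqrt n)" by simp
    thus ?thesis using sn by (simp add: pos_divide_le_eq)
  qed
  hence a: "exp (- (3 / 4 * u\<^sup>2)) \<le> exp (- u\<^sup>2 / 2 - \<kappa> * u ^ 3 / (3 * sqrt n))" by simp
  have b: "exp (- (u\<^sup>2 / 4)) \<le> 1 / u"
  proof -
    have "0 \<le> (u / 2 - 1)\<^sup>2" by simp
    hence "u \<le> 1 + u\<^sup>2 / 4" by (simp add: power2_eq_square algebra_simps)
    also have "\<dots> \<le> exp (u\<^sup>2 / 4)" by (rule exp_ge_add_one_self)
    finally show ?thesis using assms by (simp add: exp_minus field_simps)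
  qed
  have "exp (- (e * sqrt n)) / 4 \<le> exp (- u\<^sup>2) * (1 / 4)" using assms by simp
  also have "exp (- u\<^sup>2) = exp (- (3 / 4 * u\<^sup>2)) * exp (- (u\<^sup>2 / 4))" by (simp flip: exp_add)
  also have "\<dots> * (1 / 4) \<le> (exp (- u\<^sup>2 / 2 - \<kappa> * u ^ 3 / (3 * sqrt n)) * (1 / u)) * std_normal_density 0"
    using a b std_normal_density_bounds(3) assms by (intro mult_mono) auto
  also have "\<dots> = moderate_tail n \<kappa> u" by (simp add: moderate_tail_def)
  finally show ?thesis .
qed

lemma eventually_mult_sqrt_ge:
  fixes c B :: real
  assumes "0 < c"
  shows "eventually (\<lambda>n. B \<le> c * sqrt (real n)) sequentially"
  unfolding eventually_sequentially
proof (intro exI allI impI)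
  fix n assume "nat \<lceil>(\<bar>B\<bar> / c)\<^sup>2\<rceil> \<le> n"
  hence "(\<bar>B\<bar> / c)\<^sup>2 \<le> real n" by linarith
  hence "\<bar>B\<bar> / c \<le> sqrt (real n)" by (rule real_le_rsqrt)
  hence "\<bar>B\<bar> \<le> c * sqrt (real n)" using assms by (simp add: divide_le_eq mult.commute)
  thus "B \<le> c * sqrt (real n)" by linarith
qed

lemma eventually_exp_sqrt_small:
  fixes c \<eta> :: real
  assumes "0 < c" "0 < \<eta>"
  shows "eventually (\<lambda>n. exp (- (c * sqrt (real n))) \<le> \<eta>) sequentially"
  using eventually_mult_sqrt_ge[OF assms(1), of "- ln \<eta>"]
proof eventually_elim
  case (elim n)
  hence "exp (- (c * sqrt (real n))) \<le> exp (ln \<eta>)" by simp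
  thus ?case using assms(2) by simp
qed

lemma t_stat_tail:
  fixes \<eta> C :: real
  assumes \<eta>: "0 < \<eta>" and C: "1 \<le> C"
  obtains e u0 :: real and n0 :: nat where "0 < e" "1 \<le> u0" "e \<le> 1 / 2" "0 < n0"
    and "\<And>\<nu> n u. std_law \<nu> C \<Longrightarrow> n0 \<le> n \<Longrightarrow> u0 \<le> u \<Longrightarrow> u\<^sup>2 \<le> e * sqrt (real n) \<Longrightarrow>
      \<bar>\<P>(y in power_measure n \<nu>. crit_arg n u < t_stat n y)
         - moderate_tail n (std_law.skew \<nu>) u\<bar> \<le> \<eta> * moderate_tail n (std_law.skew \<nu>) u"
proof -
  define x where "x = min (\<eta> / 5) 1"
  have x: "0 < x" "x \<le> 1" "5 * x \<le> \<eta>" using \<eta> by (auto simp: x_def)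
  obtain e0 u0 where e0: "0 < e0" and u0: "1 \<le> u0"
    and up: "\<And>\<nu> n h e v. std_law \<nu> C \<Longrightarrow> 0 < n \<Longrightarrow> u0 \<le> h \<Longrightarrow> e \<le> e0 \<Longrightarrow> h\<^sup>2 \<le> e * sqrt (real n) \<Longrightarrow> 1 \<le> e * sqrt (real n) \<Longrightarrow>
      \<P>(y in power_measure n \<nu>. v < tilt_sum n h y)
        \<le> (1 + x) * exp (h * (h - v)) * moderate_tail n (std_law.skew \<nu>) h"
    and lo: "\<And>\<nu> n h e. std_law \<nu> C \<Longrightarrow> 0 < n \<Longrightarrow> u0 \<le> h \<Longrightarrow> e \<le> e0 \<Longrightarrow> h\<^sup>2 \<le> e * sqrt (real n) \<Longrightarrow> 1 \<le> e * sqrt (real n) \<Longrightarrow>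
      (1 - x) * moderate_tail n (std_law.skew \<nu>) h
        \<le> \<P>(y in power_measure n \<nu>. h < tilt_sum n h y)"
    by (rule tilt_sum_tail[OF x(1) C]) blast
  have C6: "1 \<le> C ^ 6" using C by (rule one_le_power)
  define e where "e = Min {e0, 1 / (4 * C ^ 6), x, 1 / (2 * C), 1 / 2}"
  have e_le: "e \<le> z" if "z \<in> {e0, 1 / (4 * C ^ 6), x, 1 / (2 * C), 1 / 2}" for z
    unfolding e_def using that by (intro Min_le) auto
  have "0 < e" using e0 C6 x C unfolding e_def by (subst Min_gr_iff) auto
  hence e: "0 < e" "e \<le> e0" "e \<le> 1 / (4 * C ^ 6)" "e \<le> x" "e \<le> 1 / (2 * C)" "e \<le> 1 / 2"
    using e_le[of e0] e_le[of x] e_le[of "1 / (4 * C ^ 6)"] e_le[of "1 / (2 * C)"] e_le[of "1 / 2"]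
    by (simp_all only: insert_iff simp_thms)
  have C60: "0 < C ^ 6" using C6 by linarith
  have c4: "0 < 1 / (4 * C ^ 6)" using C60 by (intro divide_pos_pos mult_pos_pos zero_less_numeral zero_less_one)
  have x16: "0 < x / 16" using x(1) by simp
  have "eventually (\<lambda>n. exp (- (1 / (4 * C ^ 6) * sqrt (real n))) \<le> x / 16) sequentially"
    by (rule eventually_exp_sqrt_small[OF c4 x16])
  moreover have "eventually (\<lambda>n. 1 \<le> e * sqrt (real n)) sequentially" by (rule eventually_mult_sqrt_ge[OF e(1)])
  ultimately have "eventually (\<lambda>n. exp (- (1 / (4 * C ^ 6) * sqrt (real n))) \<le> x / 16 \<and> 1 \<le> e * sqrt (real n) \<and> 16 < n) sequentially"
    using eventually_gt_at_top[of 16] by eventually_elim auto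
  then obtain n0 where n0: "\<And>n. n0 \<le> n \<Longrightarrow> exp (- (1 / (4 * C ^ 6) * sqrt (real n))) \<le> x / 16 \<and> 1 \<le> e * sqrt (real n) \<and> 16 < n"
    unfolding eventually_sequentially by blast
  show ?thesis
  proof (rule that[OF e(1) u0 e(6)])
    show "0 < Suc n0" by simp
    fix \<nu> n u
    assume nu: "std_law \<nu> C" and "Suc n0 \<le> n" and u: "u0 \<le> u" "u\<^sup>2 \<le> e * sqrt (real n)"
    hence n: "n0 \<le> n" by simp
    interpret std_law \<nu> C by (rule nu)
    have n16: "16 < n" and en: "1 \<le> e * sqrt n" and small: "exp (- (1 / (4 * C ^ 6) * sqrt (real n))) \<le> x / 16"
      using n0[OF n] by auto
    have npos: "0 < n" using n16 by simp
    define g where "g = moderate_tail n skew u"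
    define b where "b = exp (- (sqrt n / (2 * C ^ 6)))"
    have u1: "1 \<le> u" using u u0 by simp
    have sn: "1 \<le> sqrt n" using n16 by simp
    have un: "u\<^sup>2 < n"
    proof -
      have "u\<^sup>2 \<le> e * sqrt n" by (rule u)
      also have "\<dots> < 1 * sqrt n" using e sn by (intro mult_strict_right_mono) auto
      also have "\<dots> \<le> sqrt n * sqrt n" using sn by (intro mult_right_mono) auto
      finally show ?thesis by simp
    qed
    have g: "exp (- (e * sqrt n)) / 4 \<le> g"
      unfolding g_def
    proof (rule moderate_tail_lower[OF npos u1 u(2) en abs_skew_le _ C])
      have "C * e \<le> C * (1 / (2 * C))" using e C by (intro mult_left_mono) auto
      thus "C * e \<le> 3 / 4" using C by simp
    qed
    have b: "4 * b \<le> x * g"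
    proof -
      have "b = exp (- (1 / (4 * C ^ 6) * sqrt n)) * exp (- (1 / (4 * C ^ 6) * sqrt n))"
        unfolding b_def by (simp flip: exp_add add: field_simps)
      also have "\<dots> \<le> x / 16 * exp (- (e * sqrt n))"
      proof (rule mult_mono)
        have "e * sqrt n \<le> 1 / (4 * C ^ 6) * sqrt n" using e(3) sn by (intro mult_right_mono) auto
        thus "exp (- (1 / (4 * C ^ 6) * sqrt n)) \<le> exp (- (e * sqrt n))" by simp
      qed (use small x in auto)
      finally have "4 * b \<le> x * (exp (- (e * sqrt n)) / 4)" by simp
      also have "\<dots> \<le> x * g" using g x by (intro mult_left_mono) auto
      finally show ?thesis .
    qed
    have g0: "0 \<le> g" using g exp_gt_zero[of "- (e * sqrt n)"] by linarith
    have upper: "\<P>(y in sample_law n. crit_arg n u < t_stat n y) \<le> (1 + \<eta>) * g"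
    proof -
      have "\<P>(y in sample_law n. u - u / (2 * sqrt n) < tilt_sum n u y)
          \<le> (1 + x) * exp (u * (u - (u - u / (2 * sqrt n)))) * g"
        unfolding g_def by (rule up[OF nu npos u(1) e(2) u(2) en])
      also have "u * (u - (u - u / (2 * sqrt n))) = u\<^sup>2 / (2 * sqrt n)" by (simp add: power2_eq_square)
      also have "(1 + x) * exp (u\<^sup>2 / (2 * sqrt n)) * g \<le> (1 + x) * (1 + x) * g"
      proof (intro mult_right_mono mult_left_mono)
        have "u\<^sup>2 / (2 * sqrt n) \<le> x / 2"
        proof -
          have "e * sqrt n \<le> x * sqrt n" using e(4) sn by (intro mult_right_mono) auto
          hence "u\<^sup>2 \<le> x * sqrt n" using u(2) by linarith
          thus ?thesis using sn by (simp add: field_simps)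
        qed
        hence "exp (u\<^sup>2 / (2 * sqrt n)) \<le> exp (x / 2)" by simp
        also have "\<dots> \<le> 1 + x / 2 + (x / 2)\<^sup>2" using x by (intro exp_bound) auto
        also have "(x / 2)\<^sup>2 \<le> x / 2" using x by (simp add: power2_eq_square mult_le_one)
        finally show "exp (u\<^sup>2 / (2 * sqrt n)) \<le> 1 + x" by simp
      qed (use x g0 in auto)
      finally have "\<P>(y in sample_law n. crit_arg n u < t_stat n y) \<le> (1 + x) * (1 + x) * g + x * g"
        using t_stat_tail_vs_tilt_sum(1)[OF n16 _ un] u1 b by (simp add: b_def)
      also have "\<dots> = (1 + 3 * x + x * x) * g" by (simp add: algebra_simps)
      also have "\<dots> \<le> (1 + \<eta>) * g"
      proof (rule mult_right_mono)
        have "x * x \<le> 1 * x" using x by (intro mult_right_mono) auto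
        thus "1 + 3 * x + x * x \<le> 1 + \<eta>" using x by linarith
      qed (rule g0)
      finally show ?thesis .
    qed
    have lower: "(1 - \<eta>) * g \<le> \<P>(y in sample_law n. crit_arg n u < t_stat n y)"
    proof -
      have "(1 - \<eta>) * g \<le> (1 - 2 * x) * g" using x g0 by (intro mult_right_mono) auto
      also have "\<dots> = (1 - x) * g - x * g" by (simp add: algebra_simps)
      also have "\<dots> \<le> \<P>(y in sample_law n. crit_arg n u < t_stat n y)"
        using t_stat_tail_vs_tilt_sum(2)[OF n16 _ un] u1 b lo[OF nu npos u(1) e(2) u(2) en]
        by (simp add: b_def g_def)
      finally show ?thesis .
    qed
    show "\<bar>\<P>(y in sample_law n. crit_arg n u < t_stat n y) - moderate_tail n skew u\<bar>
        \<le> \<eta> * moderate_tail n skew u"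
      using upper lower unfolding g_def by (simp add: abs_le_iff algebra_simps)
  qed
qed

definition two_sided_tail :: "nat \<Rightarrow> real \<Rightarrow> real \<Rightarrow> real" where
  "two_sided_tail n \<kappa> u = moderate_tail n \<kappa> u + moderate_tail n (- \<kappa>) u"

lemma abs_t_stat_tail:
  fixes \<eta> C :: real
  assumes \<eta>: "0 < \<eta>" and C: "1 \<le> C"
  obtains e u0 :: real and n0 :: nat where "0 < e" "1 \<le> u0" "e \<le> 1 / 2" "0 < n0"
    and "\<And>\<nu> n u. std_law \<nu> C \<Longrightarrow> n0 \<le> n \<Longrightarrow> u0 \<le> u \<Longrightarrow> u\<^sup>2 \<le> e * sqrt (real n) \<Longrightarrow>
      \<bar>\<P>(y in power_measure n \<nu>. crit_arg n u < \<bar>t_stat n y\<bar>)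
         - two_sided_tail n (std_law.skew \<nu>) u\<bar> \<le> \<eta> * two_sided_tail n (std_law.skew \<nu>) u"
proof -
  obtain e u0 n0 where *: "0 < e" "1 \<le> u0" "e \<le> 1 / 2" "0 < n0"
    and t: "\<And>\<nu> n u. std_law \<nu> C \<Longrightarrow> n0 \<le> n \<Longrightarrow> u0 \<le> u \<Longrightarrow> u\<^sup>2 \<le> e * sqrt (real n) \<Longrightarrow>
      \<bar>\<P>(y in power_measure n \<nu>. crit_arg n u < t_stat n y)
         - moderate_tail n (std_law.skew \<nu>) u\<bar> \<le> \<eta> * moderate_tail n (std_law.skew \<nu>) u"
    by (rule t_stat_tail[OF \<eta> C]) blast
  show ?thesis
  proof (rule that[OF *])
    fix \<nu> n u
    assume nu: "std_law \<nu> C" and n: "n0 \<le> n" and u: "u0 \<le> u" "u\<^sup>2 \<le> e * sqrt (real n)"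
    interpret std_law \<nu> C by (rule nu)
    have n1: "0 < n" and u1: "1 \<le> u" using n * u by auto
    have sn: "1 \<le> sqrt n" using n1 by simp
    have "u\<^sup>2 < n"
    proof -
      have "u\<^sup>2 \<le> e * sqrt n" by (rule u)
      also have "\<dots> < 1 * sqrt n" using * sn by (intro mult_strict_right_mono) auto
      also have "\<dots> \<le> sqrt n * sqrt n" using sn by (intro mult_right_mono) auto
      finally show ?thesis by simp
    qed
    hence c: "0 < crit_arg n u" using n1 u1 by (simp add: crit_arg_def)
    show "\<bar>\<P>(y in sample_law n. crit_arg n u < \<bar>t_stat n y\<bar>)
         - two_sided_tail n skew u\<bar> \<le> \<eta> * two_sided_tail n skew u"
      using t[OF nu n u] t[OF std_law_uminus(1) n u]
      unfolding measure_abs_t_stat[OF n1 c] std_law_uminus(2) two_sided_tail_def distrib_left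
      by linarith
  qed
qed

section \<open>Critical points\<close>

lemma prob_space_std_normal: "prob_space std_normal_distribution"
  by (rule prob_space_normal_density) simp

lemma std_normal_interval_bounds:
  assumes "a \<le> b"
  shows "measure std_normal_distribution {a<..b} \<le> b - a"
    and "0 \<le> a \<Longrightarrow> std_normal_density b * (b - a) \<le> measure std_normal_distribution {a<..b}"
proof -
  interpret N: prob_space std_normal_distribution by (rule prob_space_std_normal)
  have em: "emeasure std_normal_distribution {a<..b} = (\<integral>\<^sup>+x. ennreal (std_normal_density x) * indicator {a<..b} x \<partial>lborel)"
    by (subst emeasure_density) auto
  have le1: "std_normal_density x \<le> 1" for x
  proof -
    have "1 \<le> sqrt (2 * pi)" using pi_gt3 by simp
    hence "std_normal_density 0 \<le> 1" by (simp add: std_normal_density_def divide_le_eq_1)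
    thus ?thesis using std_normal_density_bounds(1)[of x] by linarith
  qed
  have "emeasure std_normal_distribution {a<..b} \<le> (\<integral>\<^sup>+x. ennreal 1 * indicator {a<..b} x \<partial>lborel)"
    unfolding em by (intro nn_integral_mono mult_right_mono ennreal_leI le1) auto
  also have "\<dots> = ennreal (b - a)" using assms by (simp add: nn_integral_cmult_indicator)
  finally show "measure std_normal_distribution {a<..b} \<le> b - a"
    using assms by (simp add: N.emeasure_eq_measure)
  assume a: "0 \<le> a"
  have "ennreal (std_normal_density b * (b - a)) = (\<integral>\<^sup>+x. ennreal (std_normal_density b) * indicator {a<..b} x \<partial>lborel)"
    using assms by (simp add: nn_integral_cmult_indicator ennreal_mult)
  also have "\<dots> \<le> emeasure std_normal_distribution {a<..b}"
    unfolding em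
  proof (intro nn_integral_mono)
    fix x :: real
    show "ennreal (std_normal_density b) * indicator {a<..b} x \<le> ennreal (std_normal_density x) * indicator {a<..b} x"
    proof (cases "x \<in> {a<..b}")
      case True
      hence "x\<^sup>2 \<le> b\<^sup>2" using a by (intro power_mono) auto
      hence "std_normal_density b \<le> std_normal_density x"
        by (simp add: std_normal_density_def divide_right_mono)
      thus ?thesis using True by (simp add: ennreal_leI)
    qed simp
  qed
  finally show "std_normal_density b * (b - a) \<le> measure std_normal_distribution {a<..b}"
    by (simp add: N.emeasure_eq_measure)
qed

lemma std_normal_singleton: "measure std_normal_distribution {c} = 0"
proof -
  interpret N: prob_space std_normal_distribution by (rule prob_space_std_normal)
  have "measure std_normal_distribution {c} \<le> 0 + e" if "0 < e" for e :: real
  proof -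
    have "measure std_normal_distribution {c} \<le> measure std_normal_distribution {c - e<..c}"
      using that by (intro N.finite_measure_mono) auto
    also have "\<dots> \<le> c - (c - e)" using that by (intro std_normal_interval_bounds) auto
    finally show ?thesis by simp
  qed
  hence "measure std_normal_distribution {c} \<le> 0" by (rule field_le_epsilon)
  thus ?thesis by (intro antisym measure_nonneg)
qed

lemma gauss_mass_diff:
  assumes "0 \<le> a" "a \<le> b"
  shows "gauss_mass b - gauss_mass a \<le> 2 * (b - a)"
    and "std_normal_density b * (b - a) \<le> gauss_mass b - gauss_mass a"
proof -
  interpret N: prob_space std_normal_distribution by (rule prob_space_std_normal)
  let ?m = "measure std_normal_distribution"
  have sub: "{-b..b} \<subseteq> {-a..a} \<union> ({a<..b} \<union> ({-b} \<union> {-b<..-a}))" using assms by auto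
  have "?m {-b..b} \<le> ?m ({-a..a} \<union> ({a<..b} \<union> ({-b} \<union> {-b<..-a})))"
    by (intro N.finite_measure_mono sub) auto
  also have "\<dots> \<le> ?m {-a..a} + ?m ({a<..b} \<union> ({-b} \<union> {-b<..-a}))" by (rule measure_Un_le) auto
  also have "?m ({a<..b} \<union> ({-b} \<union> {-b<..-a})) \<le> ?m {a<..b} + ?m ({-b} \<union> {-b<..-a})" by (rule measure_Un_le) auto
  also have "?m ({-b} \<union> {-b<..-a}) \<le> ?m {-b} + ?m {-b<..-a}" by (rule measure_Un_le) auto
  finally show "gauss_mass b - gauss_mass a \<le> 2 * (b - a)"
    using std_normal_interval_bounds(1)[of a b] std_normal_interval_bounds(1)[of "-b" "-a"] assms
    unfolding gauss_mass_def by (simp add: std_normal_singleton)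
  have "?m {-a..a} + ?m {a<..b} = ?m ({-a..a} \<union> {a<..b})"
    by (intro N.finite_measure_Union[symmetric]) auto
  also have "\<dots> \<le> ?m {-b..b}" using assms by (intro N.finite_measure_mono) auto
  finally show "std_normal_density b * (b - a) \<le> gauss_mass b - gauss_mass a"
    using std_normal_interval_bounds(2)[of a b] assms unfolding gauss_mass_def by simp
qed

lemma gauss_mass_strict_mono:
  assumes "0 \<le> a" "a < b"
  shows "gauss_mass a < gauss_mass b"
proof -
  have "0 < std_normal_density b * (b - a)" using assms by (intro mult_pos_pos normal_density_pos) auto
  thus ?thesis using gauss_mass_diff(2)[of a b] assms by simp
qed

lemma gauss_mass_less_iff:
  assumes "0 \<le> a" "0 \<le> b"
  shows "gauss_mass a < gauss_mass b \<longleftrightarrow> a < b"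
  using gauss_mass_strict_mono assms by (metis less_asym linorder_neqE_linordered_idom)

lemma gauss_mass_bounds: "0 \<le> gauss_mass z" "gauss_mass 0 = 0" "0 \<le> z \<Longrightarrow> gauss_mass z < 1"
proof -
  interpret N: prob_space std_normal_distribution by (rule prob_space_std_normal)
  show "0 \<le> gauss_mass z" by (simp add: gauss_mass_def)
  show "gauss_mass 0 = 0" by (simp add: gauss_mass_def std_normal_singleton)
  assume "0 \<le> z"
  hence "gauss_mass z < gauss_mass (z + 1)" by (intro gauss_mass_strict_mono) auto
  also have "\<dots> \<le> 1" by (simp add: gauss_mass_def)
  finally show "gauss_mass z < 1" .
qed

lemma gauss_mass_surj:
  assumes "0 \<le> p" "p < 1"
  obtains z where "0 \<le> z" "gauss_mass z = p"
proof -
  obtain L where L: "1 \<le> L" "p < gauss_mass L" by (rule gauss_mass_large[OF assms(2)])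
  have "continuous_on {0..L} gauss_mass"
  proof (rule continuous_onI)
    fix x e :: real assume "x \<in> {0..L}" "0 < e"
    show "\<exists>d>0. \<forall>x'\<in>{0..L}. dist x' x < d \<longrightarrow> dist (gauss_mass x') (gauss_mass x) \<le> e"
    proof (intro exI[of _ "e / 2"] conjI ballI impI)
      fix x' assume x': "x' \<in> {0..L}" "dist x' x < e / 2"
      show "dist (gauss_mass x') (gauss_mass x) \<le> e"
      proof (cases "x \<le> x'")
        case True
        thus ?thesis using x' gauss_mass_diff[of x x'] gauss_mass_strict_mono[of x x'] \<open>x \<in> {0..L}\<close>
          by (cases "x = x'") (auto simp: dist_real_def)
      next
        case False
        thus ?thesis using x' gauss_mass_diff[of x' x] gauss_mass_strict_mono[of x' x] \<open>x \<in> {0..L}\<close>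
          by (auto simp: dist_real_def)
      qed
    qed (use \<open>0 < e\<close> in simp)
  qed
  hence "\<exists>z. 0 \<le> z \<and> z \<le> L \<and> gauss_mass z = p"
    using L assms by (intro IVT') (auto simp: gauss_mass_bounds)
  thus ?thesis using that by blast
qed

lemma std_normal_tail_eq:
  assumes "0 \<le> z"
  shows "measure std_normal_distribution {x. z < \<bar>x\<bar>} = 1 - gauss_mass z"
proof -
  interpret N: prob_space std_normal_distribution by (rule prob_space_std_normal)
  have "{x. z < \<bar>x\<bar>} = space std_normal_distribution - {-z..z}" using assms by (auto simp: abs_if split: if_splits)
  thus ?thesis using N.prob_compl[of "{-z..z}"] by (simp add: gauss_mass_def)
qed

lemma level_less_iff:
  assumes "0 < N" "\<xi> \<le> 1" "\<xi>' \<le> 1"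
  shows "level N \<xi> < level N \<xi>' \<longleftrightarrow> \<xi> < \<xi>'"
proof -
  have "(1 - \<xi>') powr (1 / N) < (1 - \<xi>) powr (1 / N) \<longleftrightarrow> 1 - \<xi>' < 1 - \<xi>"
    using assms powr_less_mono2[of "1 / N" "1 - \<xi>'" "1 - \<xi>"] powr_mono2[of "1 / N" "1 - \<xi>" "1 - \<xi>'"]
    by (smt (verit) divide_pos_pos of_nat_0_less_iff)
  thus ?thesis by (simp add: level_def)
qed

lemma level_bounds:
  assumes "0 < N" "0 < \<xi>" "\<xi> \<le> 1"
  shows "0 < level N \<xi>" "level N \<xi> \<le> 1"
proof -
  have "level N 0 < level N \<xi>" using assms by (subst level_less_iff) auto
  thus "0 < level N \<xi>" by (simp add: level_def)
  show "level N \<xi> \<le> 1" by (simp add: level_def)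
qed

lemma normal_crit_props:
  assumes "0 < N" "0 < \<xi>" "\<xi> \<le> 1"
  shows "0 \<le> normal_crit N \<xi>" "1 - gauss_mass (normal_crit N \<xi>) = level N \<xi>"
proof -
  have "0 \<le> 1 - level N \<xi>" "1 - level N \<xi> < 1" using level_bounds[OF assms] by auto
  then obtain z where z: "0 \<le> z" "gauss_mass z = 1 - level N \<xi>" by (rule gauss_mass_surj)
  have "normal_crit N \<xi> = z"
    unfolding normal_crit_def
  proof (rule the_equality)
    show "0 \<le> z \<and> measure std_normal_distribution {x. z < \<bar>x\<bar>} = level N \<xi>"
      using z by (simp add: std_normal_tail_eq)
    fix w assume w: "0 \<le> w \<and> measure std_normal_distribution {x. w < \<bar>x\<bar>} = level N \<xi>"
    hence "gauss_mass w = gauss_mass z" using z std_normal_tail_eq[of w] by simp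
    thus "w = z" using gauss_mass_strict_mono[of w z] gauss_mass_strict_mono[of z w] w z
      by (metis less_irrefl linorder_neqE_linordered_idom)
  qed
  thus "0 \<le> normal_crit N \<xi>" "1 - gauss_mass (normal_crit N \<xi>) = level N \<xi>" using z by auto
qed

definition normal_level :: "nat \<Rightarrow> real \<Rightarrow> real" where
  "normal_level N z = 1 - gauss_mass z ^ N"

lemma normal_level:
  assumes "0 < N" "0 < z"
  shows "0 < normal_level N z" "normal_level N z < 1" "level N (normal_level N z) = 1 - gauss_mass z"
proof -
  have g: "0 < gauss_mass z" "gauss_mass z < 1"
    using gauss_mass_strict_mono[of 0 z] gauss_mass_bounds assms by auto
  show "0 < normal_level N z" "normal_level N z < 1"
    using g assms power_strict_decreasing[of 0 N "gauss_mass z"] by (auto simp: normal_level_def)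
  have "(gauss_mass z ^ N) powr (1 / N) = gauss_mass z"
    using g assms by (simp add: powr_realpow[symmetric] powr_powr)
  thus "level N (normal_level N z) = 1 - gauss_mass z" by (simp add: level_def normal_level_def)
qed

lemma normal_crit_normal_level:
  assumes "0 < N" "0 < z"
  shows "normal_crit N (normal_level N z) = z"
proof -
  note l = normal_level[OF assms]
  have "0 \<le> normal_crit N (normal_level N z)" "gauss_mass (normal_crit N (normal_level N z)) = gauss_mass z"
    using normal_crit_props[of N "normal_level N z"] l assms by auto
  thus ?thesis using gauss_mass_less_iff assms by (metis less_imp_le less_irrefl linorder_neqE_linordered_idom)
qed

lemma boot_tail_mono: "z \<le> z' \<Longrightarrow> boot_tail n y z' \<le> boot_tail n y z"
  unfolding boot_tail_def by (intro measure_pmf.finite_measure_mono) auto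

lemma boot_tail_small:
  assumes "0 < l"
  obtains z where "0 < z" "boot_tail n y z \<le> l"
proof -
  let ?A = "\<lambda>k::nat. {yd. \<bar>boot_t_stat n y yd\<bar> > real k}"
  have "(\<lambda>k. measure_pmf.prob (resample n y) (?A k)) \<longlonglongrightarrow> measure_pmf.prob (resample n y) (\<Inter>k. ?A k)"
    by (intro measure_pmf.finite_Lim_measure_decseq) (auto simp: decseq_def)
  also have "(\<Inter>k. ?A k) = {}"
  proof -
    have "\<exists>k. \<not> real k < \<bar>boot_t_stat n y yd\<bar>" for yd
      using real_arch_simple[of "\<bar>boot_t_stat n y yd\<bar>"] by (auto simp: not_less)
    thus ?thesis by blast
  qed
  finally have "eventually (\<lambda>k. boot_tail n y (real k) < l) sequentially"
    using assms unfolding boot_tail_def by (intro order_tendstoD) auto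
  hence "eventually (\<lambda>k. boot_tail n y (real k) < l \<and> 0 < k) sequentially"
    by (intro eventually_conj eventually_gt_at_top)
  then obtain k where "boot_tail n y (real k) < l" "0 < k" by (auto dest: eventually_happens)
  thus ?thesis by (intro that[of "real k"]) auto
qed

lemma boot_level_bounds:
  assumes "0 < N" "0 < \<alpha>" "\<alpha> < 1"
  shows "0 < boot_level n N y \<alpha>" "boot_level n N y \<alpha> \<le> 1"
    and "0 < \<xi> \<Longrightarrow> \<xi> < 1 \<Longrightarrow> boot_tail n y (normal_crit N \<xi>) \<le> level N \<alpha> \<Longrightarrow> \<xi> \<le> boot_level n N y \<alpha>"
    and "(\<And>\<xi>. 0 < \<xi> \<Longrightarrow> \<xi> < 1 \<Longrightarrow> boot_tail n y (normal_crit N \<xi>) \<le> level N \<alpha> \<Longrightarrow> \<xi> \<le> b) \<Longrightarrow> boot_level n N y \<alpha> \<le> b"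
proof -
  define S where "S = {\<xi>. 0 < \<xi> \<and> \<xi> < 1 \<and> boot_tail n y (normal_crit N \<xi>) \<le> level N \<alpha>}"
  have S: "boot_level n N y \<alpha> = Sup S" by (simp add: boot_level_def S_def)
  have bdd: "bdd_above S" by (rule bdd_aboveI[of _ 1]) (auto simp: S_def)
  have "0 < level N \<alpha>" using assms by (intro level_bounds) auto
  then obtain z where z: "0 < z" "boot_tail n y z \<le> level N \<alpha>" by (rule boot_tail_small)
  have in_S: "normal_level N z \<in> S"
    using z normal_level[OF assms(1) z(1)] normal_crit_normal_level[OF assms(1) z(1)] by (simp add: S_def)
  show "0 < boot_level n N y \<alpha>" unfolding S
    using cSup_upper[OF in_S bdd] normal_level(1)[OF assms(1) z(1)] by linarith
  show "boot_level n N y \<alpha> \<le> 1" unfolding S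
    using in_S by (intro cSup_least) (auto simp: S_def)
  show "\<xi> \<le> boot_level n N y \<alpha>" if "0 < \<xi>" "\<xi> < 1" "boot_tail n y (normal_crit N \<xi>) \<le> level N \<alpha>"
    unfolding S using that by (intro cSup_upper bdd) (auto simp: S_def)
  show "boot_level n N y \<alpha> \<le> b" if "\<And>\<xi>. 0 < \<xi> \<Longrightarrow> \<xi> < 1 \<Longrightarrow> boot_tail n y (normal_crit N \<xi>) \<le> level N \<alpha> \<Longrightarrow> \<xi> \<le> b"
    unfolding S using that in_S by (intro cSup_least) (auto simp: S_def)
qed

lemma boot_crit_nonneg:
  assumes "0 < N" "0 < \<alpha>" "\<alpha> < 1"
  shows "0 \<le> boot_crit n N y \<alpha>"
  unfolding boot_crit_def using boot_level_bounds[OF assms] assms by (intro normal_crit_props) auto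

lemma boot_crit_le:
  assumes "0 < N" "0 < \<alpha>" "\<alpha> < 1" and z: "0 < z" "boot_tail n y z \<le> level N \<alpha>"
  shows "boot_crit n N y \<alpha> \<le> z"
proof -
  note bl = boot_level_bounds[OF assms(1-3), where n = n and y = y]
  have "normal_level N z \<le> boot_level n N y \<alpha>"
    using z normal_level[OF assms(1) z(1)] normal_crit_normal_level[OF assms(1) z(1)] by (intro bl(3)) auto
  hence "level N (normal_level N z) \<le> level N (boot_level n N y \<alpha>)"
    using level_less_iff[OF assms(1) bl(2), of "normal_level N z"] normal_level(2)[OF assms(1) z(1)] by linarith
  hence "gauss_mass (boot_crit n N y \<alpha>) \<le> gauss_mass z"
    using normal_level(3)[OF assms(1) z(1)] normal_crit_props(2)[OF assms(1) bl(1,2)]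
    by (simp add: boot_crit_def)
  thus ?thesis
    using gauss_mass_less_iff[of z "boot_crit n N y \<alpha>"] boot_crit_nonneg[OF assms(1-3), of n y] z by linarith
qed

lemma boot_crit_ge:
  assumes "0 < N" "0 < \<alpha>" "\<alpha> < 1" and z: "0 < z" "level N \<alpha> < boot_tail n y z"
  shows "z \<le> boot_crit n N y \<alpha>"
proof -
  note bl = boot_level_bounds[OF assms(1-3), where n = n and y = y]
  have "boot_level n N y \<alpha> \<le> normal_level N z"
  proof (rule bl(4))
    fix \<xi> assume \<xi>: "0 < \<xi>" "\<xi> < 1" "boot_tail n y (normal_crit N \<xi>) \<le> level N \<alpha>"
    have "z < normal_crit N \<xi>"
      using \<xi>(3) z boot_tail_mono[of "normal_crit N \<xi>" z n y] by (rule_tac ccontr) simp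
    hence "gauss_mass z < gauss_mass (normal_crit N \<xi>)" using z by (intro gauss_mass_strict_mono) auto
    hence "level N \<xi> < level N (normal_level N z)"
      using normal_crit_props(2)[of N \<xi>] \<xi> assms normal_level(3)[OF assms(1) z(1)] by simp
    thus "\<xi> \<le> normal_level N z"
      using level_less_iff[OF assms(1), of \<xi> "normal_level N z"] \<xi> normal_level(2)[OF assms(1) z(1)] by simp
  qed
  hence "level N (boot_level n N y \<alpha>) \<le> level N (normal_level N z)"
    using level_less_iff[OF assms(1) _ bl(2), of "normal_level N z"] normal_level(2)[OF assms(1) z(1)] by linarith
  hence "gauss_mass z \<le> gauss_mass (boot_crit n N y \<alpha>)"
    using normal_level(3)[OF assms(1) z(1)] normal_crit_props(2)[OF assms(1) bl(1,2)]
    by (simp add: boot_crit_def)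
  thus ?thesis
    using gauss_mass_less_iff[of "boot_crit n N y \<alpha>" z] boot_crit_nonneg[OF assms(1-3), of n y] z by linarith
qed

text \<open>The countable union makes the rejection region measurable.\<close>

lemma rejection_iff:
  assumes "0 < N" "0 < \<alpha>" "\<alpha> < 1"
  shows "boot_crit n N y \<alpha> < t \<longleftrightarrow> (\<exists>q\<in>{q\<in>\<rat>. 0 < q}. q < t \<and> boot_tail n y q \<le> level N \<alpha>)"
proof
  assume "boot_crit n N y \<alpha> < t"
  then obtain q where q: "q \<in> \<rat>" "boot_crit n N y \<alpha> < q" "q < t" by (rule Rats_dense_in_real[THEN bexE]) blast
  have "0 < q" using q boot_crit_nonneg[OF assms, of n y] by linarith
  moreover have "boot_tail n y q \<le> level N \<alpha>"
    using boot_crit_ge[OF assms \<open>0 < q\<close>, of n y] q by linarith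
  ultimately show "\<exists>q\<in>{q\<in>\<rat>. 0 < q}. q < t \<and> boot_tail n y q \<le> level N \<alpha>" using q by blast
next
  assume "\<exists>q\<in>{q\<in>\<rat>. 0 < q}. q < t \<and> boot_tail n y q \<le> level N \<alpha>"
  thus "boot_crit n N y \<alpha> < t" using boot_crit_le[OF assms] by force
qed

lemma t_stat_scale:
  assumes "0 < c"
  shows "t_stat n (\<lambda>j. c * y j) = t_stat n y"
proof -
  have m: "sample_mean n (\<lambda>j. c * y j) = c * sample_mean n y"
    by (simp add: sample_mean_def sum_distrib_left)
  have "(c * a - c * b)\<^sup>2 = c\<^sup>2 * (a - b)\<^sup>2" for a b :: real
    by (simp add: power_mult_distrib flip: right_diff_distrib)
  hence "sample_sd n (\<lambda>j. c * y j) = sqrt (c\<^sup>2 * ((\<Sum>j=1..n. (y j - sample_mean n y)\<^sup>2) / n))"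
    unfolding sample_sd_def m by (simp flip: sum_distrib_left)
  also have "\<dots> = c * sample_sd n y" using assms by (simp only: sample_sd_def real_sqrt_mult real_sqrt_abs abs_of_pos)
  finally show ?thesis using assms by (simp add: t_stat_def m)
qed

lemma t_stat_restrict: "t_stat n (restrict y {1..n}) = t_stat n y"
  by (simp add: t_stat_def sample_sd_def sample_mean_def)

definition uniform_index :: "nat \<Rightarrow> nat pmf" where
  "uniform_index n = pmf_of_set {1..n}"

definition index_resample :: "nat \<Rightarrow> (nat \<Rightarrow> nat) pmf" where
  "index_resample n = Pi_pmf {1..n} 0 (\<lambda>_. uniform_index n)"

lemma set_uniform_index: "0 < n \<Longrightarrow> set_pmf (uniform_index n) = {1..n}"
  unfolding uniform_index_def by (subst set_pmf_of_set) auto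

lemma set_index_resample:
  assumes "0 < n" "J \<in> set_pmf (index_resample n)" "j \<in> {1..n}"
  shows "J j \<in> {1..n}"
  using assms set_uniform_index[OF assms(1)]
  by (auto simp: index_resample_def set_Pi_pmf PiE_dflt_def)

lemma finite_set_index_resample:
  assumes "0 < n"
  shows "finite (set_pmf (index_resample n))"
proof -
  have "set_pmf (index_resample n) = PiE_dflt {1..n} 0 (\<lambda>_. {1..n})"
    using set_uniform_index[OF assms] by (simp add: index_resample_def set_Pi_pmf)
  thus ?thesis by (simp add: finite_PiE_dflt)
qed

lemma boot_tail_eq_index:
  assumes n: "0 < n"
  shows "boot_tail n y z = measure_pmf.prob (index_resample n)
    {J. z < \<bar>t_stat n (\<lambda>j. y (J j) - sample_mean n y)\<bar>}"
proof -
  define y' where "y' = y(0 := 0)"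
  have "map_pmf y (uniform_index n) = map_pmf y' (uniform_index n)"
    by (intro map_pmf_cong refl) (auto simp: y'_def set_uniform_index[OF n])
  hence "resample n y = Pi_pmf {1..n} 0 (\<lambda>_. map_pmf y' (uniform_index n))"
    by (simp add: resample_def uniform_index_def)
  also have "\<dots> = map_pmf (\<lambda>h. y' \<circ> h) (index_resample n)"
    unfolding index_resample_def by (rule Pi_pmf_map) (auto simp: y'_def)
  finally have "boot_tail n y z = measure_pmf.prob (index_resample n) {J. z < \<bar>boot_t_stat n y (y' \<circ> J)\<bar>}"
    by (simp add: boot_tail_def)
  also have "\<dots> = measure_pmf.prob (index_resample n) {J. z < \<bar>t_stat n (\<lambda>j. y (J j) - sample_mean n y)\<bar>}"
  proof (rule measure_pmf.finite_measure_eq_AE)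
    show "AE J in measure_pmf (index_resample n). J \<in> {J. z < \<bar>boot_t_stat n y (y' \<circ> J)\<bar>} \<longleftrightarrow>
        J \<in> {J. z < \<bar>t_stat n (\<lambda>j. y (J j) - sample_mean n y)\<bar>}"
    proof (rule AE_pmfI)
      fix J assume J: "J \<in> set_pmf (index_resample n)"
      have "y' (J j) = y (J j)" if "j \<in> {1..n}" for j
        using set_index_resample[OF n J that] by (auto simp: y'_def)
      hence "boot_t_stat n y (y' \<circ> J) = t_stat n (\<lambda>j. y (J j) - sample_mean n y)"
        unfolding boot_t_stat_def by (simp add: t_stat_def sample_sd_def sample_mean_def)
      thus "J \<in> {J. z < \<bar>boot_t_stat n y (y' \<circ> J)\<bar>} \<longleftrightarrow>
        J \<in> {J. z < \<bar>t_stat n (\<lambda>j. y (J j) - sample_mean n y)\<bar>}" by simp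
    qed
  qed auto
  finally show ?thesis .
qed

lemma boot_tail_cong:
  assumes n: "0 < n" and eq: "\<And>j. j \<in> {1..n} \<Longrightarrow> y j = y' j"
  shows "boot_tail n y z = boot_tail n y' z"
  unfolding boot_tail_eq_index[OF n]
proof (rule measure_pmf.finite_measure_eq_AE)
  have m: "sample_mean n y = sample_mean n y'" using eq by (simp add: sample_mean_def)
  show "AE J in measure_pmf (index_resample n). J \<in> {J. z < \<bar>t_stat n (\<lambda>j. y (J j) - sample_mean n y)\<bar>} \<longleftrightarrow>
      J \<in> {J. z < \<bar>t_stat n (\<lambda>j. y' (J j) - sample_mean n y')\<bar>}"
  proof (rule AE_pmfI)
    fix J assume J: "J \<in> set_pmf (index_resample n)"
    have "y (J j) = y' (J j)" if "j \<in> {1..n}" for j using set_index_resample[OF n J that] eq by blast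
    hence "t_stat n (\<lambda>j. y (J j) - sample_mean n y) = t_stat n (\<lambda>j. y' (J j) - sample_mean n y')"
      unfolding m by (simp add: t_stat_def sample_sd_def sample_mean_def)
    thus "J \<in> {J. z < \<bar>t_stat n (\<lambda>j. y (J j) - sample_mean n y)\<bar>} \<longleftrightarrow>
      J \<in> {J. z < \<bar>t_stat n (\<lambda>j. y' (J j) - sample_mean n y')\<bar>}" by simp
  qed
qed auto

lemma boot_tail_scale:
  assumes n: "0 < n" and c: "0 < c"
  shows "boot_tail n (\<lambda>j. c * y j) z = boot_tail n y z"
proof -
  have m: "sample_mean n (\<lambda>j. c * y j) = c * sample_mean n y"
    by (simp add: sample_mean_def sum_distrib_left)
  have "t_stat n (\<lambda>j. c * y (J j) - c * sample_mean n y) = t_stat n (\<lambda>j. y (J j) - sample_mean n y)" for J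
    using t_stat_scale[OF c, of n "\<lambda>j. y (J j) - sample_mean n y"] by (simp add: right_diff_distrib)
  thus ?thesis unfolding boot_tail_eq_index[OF n] m by simp
qed

lemma t_stat_measurable_comp:
  assumes "\<And>j. j \<in> {1..n} \<Longrightarrow> (\<lambda>y. f y j) \<in> borel_measurable N"
  shows "(\<lambda>y. t_stat n (f y)) \<in> borel_measurable N"
  unfolding t_stat_def sample_sd_def sample_mean_def
  by (intro borel_measurable_divide borel_measurable_times borel_measurable_const borel_measurable_sum
    measurable_compose[OF _ borel_measurable_continuous_onI[OF continuous_on_real_sqrt[OF continuous_on_id]]]
      borel_measurable_power borel_measurable_diff assms)

lemma boot_tail_measurable:
  assumes n: "0 < n"
  shows "(\<lambda>y. boot_tail n y z) \<in> borel_measurable (power_measure n borel)"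
proof -
  let ?N = "power_measure n borel"
  let ?S = "set_pmf (index_resample n)"
  let ?t = "\<lambda>J y. t_stat n (\<lambda>j. y (J j) - sample_mean n y)"
  have "boot_tail n y z = (\<Sum>J\<in>?S. pmf (index_resample n) J * indicator {t. z < \<bar>t\<bar>} (?t J y))" for y
  proof -
    have "boot_tail n y z = measure_pmf.prob (index_resample n) ({J. z < \<bar>?t J y\<bar>} \<inter> ?S)"
      unfolding boot_tail_eq_index[OF n] by (rule measure_Int_set_pmf[symmetric])
    also have "\<dots> = (\<Sum>J\<in>{J. z < \<bar>?t J y\<bar>} \<inter> ?S. pmf (index_resample n) J)"
      using finite_set_index_resample[OF n] by (intro measure_measure_pmf_finite) auto
    also have "\<dots> = (\<Sum>J\<in>?S. pmf (index_resample n) J * indicator {t. z < \<bar>t\<bar>} (?t J y))"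
      using finite_set_index_resample[OF n] by (intro sum.mono_neutral_cong_left) (auto simp: indicator_def)
    finally show ?thesis .
  qed
  moreover have "(\<lambda>y. indicator {t. z < \<bar>t\<bar>} (?t J y) :: real) \<in> borel_measurable ?N" if J: "J \<in> ?S" for J
  proof -
    have "?t J \<in> borel_measurable ?N"
    proof (rule t_stat_measurable_comp)
      fix j assume "j \<in> {1..n}"
      hence "J j \<in> {1..n}" by (rule set_index_resample[OF n J])
      hence "(\<lambda>y. y (J j)) \<in> borel_measurable ?N" by (rule measurable_component_singleton)
      thus "(\<lambda>y. y (J j) - sample_mean n y) \<in> borel_measurable ?N"
        by (intro borel_measurable_diff sample_stat_measurable_borel(1))
    qed
    moreover have "(indicator {t. z < \<bar>t\<bar>} :: real \<Rightarrow> real) \<in> borel_measurable borel" by measurable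
    ultimately show ?thesis by (rule measurable_compose)
  qed
  ultimately show ?thesis by (simp add: borel_measurable_sum borel_measurable_times)
qed

lemma rejection_measurable:
  assumes "0 < N" "0 < \<alpha>" "\<alpha> < 1" and n: "0 < n"
  shows "{y \<in> space (power_measure n borel). boot_crit n N y \<alpha> < \<bar>t_stat n y\<bar>} \<in> sets (power_measure n borel)"
proof -
  note [measurable] = boot_tail_measurable[OF n]
  have c: "countable {q\<in>\<rat>. (0::real) < q}" by (rule countable_subset[OF _ countable_rat]) auto
  have "{y \<in> space (power_measure n borel). boot_crit n N y \<alpha> < \<bar>t_stat n y\<bar>}
    = (\<Union>q\<in>{q\<in>\<rat>. 0 < q}. {y \<in> space (power_measure n borel). q < \<bar>t_stat n y\<bar> \<and> boot_tail n y q \<le> level N \<alpha>})"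
    unfolding rejection_iff[OF assms(1-3)] by auto
  also have "\<dots> \<in> sets (power_measure n borel)"
  proof (intro sets.countable_UN'' c)
    fix q :: real
    show "{y \<in> space (power_measure n borel). q < \<bar>t_stat n y\<bar> \<and> boot_tail n y q \<le> level N \<alpha>} \<in> sets (power_measure n borel)"
      by measurable
  qed
  finally show ?thesis .
qed

lemma boot_crit_cong:
  assumes "\<And>z. boot_tail n y z = boot_tail n y' z"
  shows "boot_crit n N y \<alpha> = boot_crit n N y' \<alpha>"
  by (simp add: boot_crit_def boot_level_def assms)

section \<open>The bootstrap distribution\<close>

definition empirical_law :: "nat \<Rightarrow> (nat \<Rightarrow> real) \<Rightarrow> real measure" where
  "empirical_law n y = distr (measure_pmf (map_pmf y (uniform_index n))) borel
     (\<lambda>x. (x - sample_mean n y) / sample_sd n y)"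

lemma integral_empirical_law:
  fixes f :: "real \<Rightarrow> real"
  assumes n: "0 < n" and [measurable]: "f \<in> borel_measurable borel"
  shows "(\<integral>x. f x \<partial>empirical_law n y) = (\<Sum>j=1..n. f ((y j - sample_mean n y) / sample_sd n y)) / n"
proof -
  have "(\<integral>x. f x \<partial>empirical_law n y)
      = measure_pmf.expectation (map_pmf y (uniform_index n)) (\<lambda>x. f ((x - sample_mean n y) / sample_sd n y))"
    unfolding empirical_law_def by (rule integral_distr) auto
  also have "\<dots> = measure_pmf.expectation (uniform_index n) (\<lambda>j. f ((y j - sample_mean n y) / sample_sd n y))"
    by simp
  also have "\<dots> = (\<Sum>j=1..n. f ((y j - sample_mean n y) / sample_sd n y)) / n"
    unfolding uniform_index_def using n by (subst integral_pmf_of_set) auto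
  finally show ?thesis .
qed

lemma empirical_law_std_law:
  assumes n: "0 < n" and S: "0 < sample_sd n y"
    and bd: "\<And>j. j \<in> {1..n} \<Longrightarrow> \<bar>(y j - sample_mean n y) / sample_sd n y\<bar> \<le> C"
  shows "std_law (empirical_law n y) C"
    and "std_law.skew (empirical_law n y)
      = (raw_moment n 3 y - 3 * sample_mean n y * raw_moment n 2 y + 2 * sample_mean n y ^ 3) / sample_sd n y ^ 3"
proof -
  define m where "m = sample_mean n y"
  define S where "S = sample_sd n y"
  have S0: "0 < S" using S by (simp add: S_def)
  interpret N: prob_space "empirical_law n y"
    unfolding empirical_law_def by (intro prob_space.prob_space_distr measure_pmf.prob_space_axioms) auto
  show law: "std_law (empirical_law n y) C"
  proof
    show "sets (empirical_law n y) = sets borel" by (simp add: empirical_law_def)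
    show "AE x in empirical_law n y. \<bar>x\<bar> \<le> C"
      unfolding empirical_law_def
      by (subst AE_distr_iff) (use bd in \<open>auto simp: AE_measure_pmf_iff set_uniform_index[OF n]\<close>)
    have "(\<Sum>j=1..n. (y j - m) / S) = ((\<Sum>j=1..n. y j) - n * m) / S"
      by (simp add: sum_subtractf flip: sum_divide_distrib)
    also have "\<dots> = 0" unfolding m_def sum_eq_mean[OF n] by simp
    finally show "(\<integral>x. x \<partial>empirical_law n y) = 0"
      by (simp add: integral_empirical_law[OF n] m_def S_def)
    have S2: "S\<^sup>2 = (\<Sum>j=1..n. (y j - m)\<^sup>2) / n"
      unfolding S_def sample_sd_def m_def by (intro real_sqrt_pow2 divide_nonneg_nonneg sum_nonneg) auto
    have "(\<Sum>j=1..n. ((y j - m) / S)\<^sup>2) / n = ((\<Sum>j=1..n. (y j - m)\<^sup>2) / n) / S\<^sup>2"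
      by (simp add: power_divide flip: sum_divide_distrib)
    also have "\<dots> = 1" unfolding S2[symmetric] using S0 by simp
    finally show "(\<integral>x. x\<^sup>2 \<partial>empirical_law n y) = 1"
      by (simp add: integral_empirical_law[OF n] m_def S_def)
  qed
  interpret std_law "empirical_law n y" C by (rule law)
  have "skew = (\<Sum>j=1..n. ((y j - m) / S) ^ 3) / n"
    unfolding skew_def by (simp add: integral_empirical_law[OF n] m_def S_def)
  also have "\<dots> = (\<Sum>j=1..n. y j ^ 3 - 3 * m * y j ^ 2 + 3 * m\<^sup>2 * y j - m ^ 3) / n / S ^ 3"
  proof -
    have "((a - m) / S) ^ 3 = (a ^ 3 - 3 * m * a ^ 2 + 3 * m\<^sup>2 * a - m ^ 3) / S ^ 3" for a
      unfolding power_divide by (simp add: power3_eq_cube power2_eq_square algebra_simps)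
    thus ?thesis by (simp flip: sum_divide_distrib)
  qed
  also have "(\<Sum>j=1..n. y j ^ 3 - 3 * m * y j ^ 2 + 3 * m\<^sup>2 * y j - m ^ 3)
      = (\<Sum>j=1..n. y j ^ 3) - 3 * m * (\<Sum>j=1..n. y j ^ 2) + 3 * m\<^sup>2 * (\<Sum>j=1..n. y j) - n * m ^ 3"
    by (simp add: sum.distrib sum_subtractf sum_distrib_left)
  also have "\<dots> = n * (raw_moment n 3 y - 3 * m * raw_moment n 2 y + 2 * m ^ 3)"
    unfolding sum_power_eq_raw_moment[OF n] sum_eq_mean[OF n] m_def[symmetric]
    by (simp add: algebra_simps power2_eq_square power3_eq_cube)
  finally show "skew = (raw_moment n 3 y - 3 * sample_mean n y * raw_moment n 2 y + 2 * sample_mean n y ^ 3) / sample_sd n y ^ 3"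
    using n by (simp add: m_def S_def)
qed

lemma boot_tail_eq_empirical:
  assumes n: "0 < n" and S: "0 < sample_sd n y"
  shows "boot_tail n y z = \<P>(x in power_measure n (empirical_law n y). z < \<bar>t_stat n x\<bar>)"
proof -
  define m where "m = sample_mean n y"
  define S where "S = sample_sd n y"
  have S0: "0 < S" using S by (simp add: S_def)
  define P where "P = resample n y"
  define X where "X j yd = (yd j - m) / S" for j and yd :: "nat \<Rightarrow> real"
  have P_def': "P = Pi_pmf {1..n} 0 (\<lambda>_. map_pmf y (uniform_index n))"
    by (simp add: P_def resample_def uniform_index_def)
  have "prob_space.indep_vars (measure_pmf P) (\<lambda>_. count_space UNIV) (\<lambda>j yd. yd j) {1..n}"
    unfolding P_def' by (rule indep_vars_Pi_pmf) simp
  hence ind: "prob_space.indep_vars (measure_pmf P) (\<lambda>_. borel) X {1..n}"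
    unfolding X_def by (rule prob_space.indep_vars_compose2[OF measure_pmf.prob_space_axioms]) auto
  have d: "distr (measure_pmf P) borel (X j) = empirical_law n y" if j: "j \<in> {1..n}" for j
  proof -
    have "map_pmf (\<lambda>yd. yd j) P = map_pmf y (uniform_index n)"
      unfolding P_def' using j by (subst Pi_pmf_component) auto
    hence "empirical_law n y = distr (measure_pmf (map_pmf (\<lambda>yd. yd j) P)) borel (\<lambda>x. (x - m) / S)"
      by (simp add: empirical_law_def m_def S_def)
    also have "\<dots> = distr (measure_pmf P) borel ((\<lambda>x. (x - m) / S) \<circ> (\<lambda>yd. yd j))"
      unfolding map_pmf_rep_eq by (rule distr_distr) auto
    finally show ?thesis by (simp add: X_def[abs_def] comp_def)
  qed
  have A: "{x \<in> space (power_measure n borel). z < \<bar>t_stat n x\<bar>} \<in> sets (power_measure n borel)"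
    by measurable
  have t: "t_stat n (\<lambda>j\<in>{1..n}. X j yd) = boot_t_stat n y yd" for yd
  proof -
    have "t_stat n (\<lambda>j\<in>{1..n}. X j yd) = t_stat n (\<lambda>j. 1 / S * (yd j - m))"
      using t_stat_restrict[of n "\<lambda>j. X j yd"] by (simp add: X_def)
    also have "\<dots> = t_stat n (\<lambda>j. yd j - m)" using S0 by (intro t_stat_scale) simp
    finally show ?thesis by (simp add: boot_t_stat_def m_def)
  qed
  have sp: "space (power_measure n (empirical_law n y)) = space (power_measure n borel)"
    by (simp add: space_PiM empirical_law_def)
  have mem: "(\<lambda>j\<in>{1..n}. X j yd) \<in> {x \<in> space (power_measure n borel). z < \<bar>t_stat n x\<bar>} \<longleftrightarrow> z < \<bar>boot_t_stat n y yd\<bar>" for yd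
    unfolding mem_Collect_eq t by (simp add: space_PiM)
  have "boot_tail n y z = measure_pmf.prob P {yd \<in> space (measure_pmf P). (\<lambda>j\<in>{1..n}. X j yd) \<in> {x \<in> space (power_measure n borel). z < \<bar>t_stat n x\<bar>}}"
    unfolding boot_tail_def P_def[symmetric] mem by simp
  also have "\<dots> = measure (power_measure n (empirical_law n y)) {x \<in> space (power_measure n borel). z < \<bar>t_stat n x\<bar>}"
    by (rule prob_space.iid_prob_eq[OF measure_pmf.prob_space_axioms n ind d A])
  finally show ?thesis by (simp only: sp)
qed

lemma sample_skew_close:
  fixes m M2 M3 \<kappa> r C :: real
  assumes m: "\<bar>m\<bar> \<le> r" and M2: "\<bar>M2 - 1\<bar> \<le> r" and M3: "\<bar>M3 - \<kappa>\<bar> \<le> r"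
    and r: "r \<le> 1 / 4" and \<kappa>: "\<bar>\<kappa>\<bar> \<le> C" "1 \<le> C"
  defines "S \<equiv> sqrt (M2 - m\<^sup>2)"
  shows "1 / 2 \<le> S" and "\<bar>(M3 - 3 * m * M2 + 2 * m ^ 3) / S ^ 3 - \<kappa>\<bar> \<le> 160 * C * r"
proof -
  have r0: "0 \<le> r" using m by linarith
  have mm: "m\<^sup>2 \<le> r / 4"
  proof -
    have "\<bar>m\<bar> * \<bar>m\<bar> \<le> r * (1 / 4)" using m r by (intro mult_mono) auto
    thus ?thesis by (simp add: power2_eq_square)
  qed
  define q where "q = M2 - m\<^sup>2"
  have q1: "\<bar>q - 1\<bar> \<le> 2 * r" using mm M2 zero_le_power2[of m] r0 unfolding q_def abs_le_iff by linarith
  have q: "1 / 4 \<le> q" "q \<le> 9 / 4" using q1 r by (auto simp: abs_le_iff)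
  have S2: "S\<^sup>2 = q" using q by (simp add: S_def q_def)
  have S0: "0 \<le> S" using q by (simp add: S_def q_def)
  have "(1 / 2)\<^sup>2 \<le> S\<^sup>2" unfolding S2 using q by (simp add: power2_eq_square)
  thus Sl: "1 / 2 \<le> S" using S0 by (rule power2_le_imp_le)
  have "S\<^sup>2 \<le> (3 / 2)\<^sup>2" unfolding S2 using q by (simp add: power2_eq_square)
  hence Su: "S \<le> 3 / 2" by (rule power2_le_imp_le) simp
  have S1: "\<bar>S - 1\<bar> \<le> 2 * r"
  proof -
    have "\<bar>S - 1\<bar> * 1 \<le> \<bar>S - 1\<bar> * (S + 1)" using S0 by (intro mult_left_mono) auto
    also have "\<dots> = \<bar>(S - 1) * (S + 1)\<bar>" using S0 by (simp add: abs_mult)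
    also have "(S - 1) * (S + 1) = q - 1" using S2 by (simp add: power2_eq_square algebra_simps)
    finally show ?thesis using q1 by simp
  qed
  have S3: "\<bar>S ^ 3 - 1\<bar> \<le> 10 * r"
  proof -
    have "S ^ 3 - 1 = (S - 1) * (q + S + 1)"
      by (simp add: S2[symmetric] power2_eq_square power3_eq_cube algebra_simps)
    hence "\<bar>S ^ 3 - 1\<bar> = \<bar>S - 1\<bar> * (q + S + 1)" using q S0 by (simp add: abs_mult)
    also have "\<dots> \<le> (2 * r) * 5" using S1 q Su S0 r0 by (intro mult_mono) auto
    finally show ?thesis by simp
  qed
  have S38: "1 / 8 \<le> S ^ 3"
    using power_mono[OF Sl, of 3] by (simp add: power3_eq_cube)
  define A where "A = M3 - 3 * m * M2 + 2 * m ^ 3"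
  have A: "\<bar>A - \<kappa>\<bar> \<le> 10 * r"
  proof -
    have "\<bar>m * M2\<bar> \<le> r * (5 / 4)"
      unfolding abs_mult using m M2 r r0 by (intro mult_mono) (auto simp: abs_le_iff)
    moreover have "\<bar>m ^ 3\<bar> \<le> r"
    proof -
      have "\<bar>m ^ 3\<bar> = m\<^sup>2 * \<bar>m\<bar>" by (simp add: power3_eq_cube power2_eq_square abs_mult)
      also have "\<dots> \<le> (r / 4) * 1" using mm m r r0 by (intro mult_mono) auto
      finally show ?thesis using r0 by simp
    qed
    ultimately show ?thesis using M3 r0 unfolding A_def abs_le_iff by linarith
  qed
  have num: "\<bar>A - \<kappa> * S ^ 3\<bar> \<le> 20 * C * r"
  proof -
    have "\<bar>\<kappa> * (S ^ 3 - 1)\<bar> \<le> C * (10 * r)" unfolding abs_mult using \<kappa> S3 by (intro mult_mono) auto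
    moreover have "A - \<kappa> * S ^ 3 = (A - \<kappa>) - \<kappa> * (S ^ 3 - 1)" by (simp add: algebra_simps)
    moreover have "1 * r \<le> C * r" using \<kappa> r0 by (intro mult_right_mono) auto
    ultimately show ?thesis using A unfolding abs_le_iff by linarith
  qed
  have quot: "A / S ^ 3 - \<kappa> = (A - \<kappa> * S ^ 3) / S ^ 3"
  proof -
    have "S ^ 3 \<noteq> 0" using S38 by linarith
    thus ?thesis by (simp add: diff_divide_distrib)
  qed
  have s3: "\<bar>S ^ 3\<bar> = S ^ 3" "0 \<le> S ^ 3" using S38 by linarith+
  have "\<bar>A / S ^ 3 - \<kappa>\<bar> \<le> (20 * C * r) / S ^ 3"
    unfolding quot abs_divide s3(1) using num s3(2) by (rule divide_right_mono)
  also have "\<dots> \<le> (20 * C * r) / (1 / 8)" using S38 Sl \<kappa> r0 by (intro divide_left_mono) auto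
  finally show "\<bar>(M3 - 3 * m * M2 + 2 * m ^ 3) / S ^ 3 - \<kappa>\<bar> \<le> 160 * C * r" by (simp add: A_def)
qed

lemma moderate_tail_skew_change:
  assumes n: "0 < n" and u: "0 < u" "u\<^sup>2 \<le> e * sqrt n" and e: "e \<le> 1"
    and d: "\<bar>\<kappa>' - \<kappa>\<bar> \<le> D * slow_radius n"
  shows "moderate_tail n \<kappa>' u \<le> exp (D * e) * moderate_tail n \<kappa> u"
proof -
  have sn: "0 < sqrt n" using n by simp
  have e0: "0 < e"
  proof (rule ccontr)
    assume "\<not> 0 < e"
    hence "e * sqrt n \<le> 0" using sn by (simp add: mult_nonpos_nonneg)
    moreover have "0 < u\<^sup>2" using u by simp
    ultimately show False using u by linarith
  qed
  note sr = slow_radius[OF n]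
  have D: "0 \<le> D * slow_radius n" using d by linarith
  hence D0: "0 \<le> D" using sr(1) by (simp add: zero_le_mult_iff)
  have ur: "u * slow_radius n \<le> 1"
  proof (rule power2_le_imp_le)
    have "(u * slow_radius n)\<^sup>2 = u\<^sup>2 / sqrt n" by (simp add: power_mult_distrib sr)
    also have "\<dots> \<le> e" using u sn by (simp add: divide_le_eq)
    finally show "(u * slow_radius n)\<^sup>2 \<le> 1\<^sup>2" using e by simp
  qed simp
  have "(\<kappa> - \<kappa>') * u ^ 3 / (3 * sqrt n) \<le> (D * slow_radius n) * u ^ 3 / (3 * sqrt n)"
    using d u sn by (intro divide_right_mono mult_right_mono) auto
  also have "\<dots> = D * ((u * slow_radius n) * (u\<^sup>2 / sqrt n)) / 3"
    by (simp add: power3_eq_cube power2_eq_square mult_ac)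
  also have "\<dots> \<le> D * (1 * e) / 3"
    using u sn ur D0 sr(1) by (intro divide_right_mono mult_left_mono mult_mono) (auto simp: divide_le_eq)
  also have "\<dots> \<le> D * e" using D0 e0 by simp
  finally have "\<kappa> * u ^ 3 / (3 * sqrt n) - \<kappa>' * u ^ 3 / (3 * sqrt n) \<le> D * e"
    by (simp add: left_diff_distrib diff_divide_distrib)
  hence "exp (- u\<^sup>2 / 2 - \<kappa>' * u ^ 3 / (3 * sqrt n)) \<le> exp (D * e + (- u\<^sup>2 / 2 - \<kappa> * u ^ 3 / (3 * sqrt n)))"
    by simp
  hence "exp (- u\<^sup>2 / 2 - \<kappa>' * u ^ 3 / (3 * sqrt n)) * (std_normal_density 0 / u)
      \<le> exp (D * e + (- u\<^sup>2 / 2 - \<kappa> * u ^ 3 / (3 * sqrt n))) * (std_normal_density 0 / u)"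
    using u by (intro mult_right_mono) auto
  thus ?thesis by (simp only: moderate_tail_def exp_add mult.assoc times_divide_eq_right)
qed

lemma two_sided_tail_skew_change:
  assumes "0 < n" "0 < u" "u\<^sup>2 \<le> e * sqrt n" "e \<le> 1" "\<bar>\<kappa>' - \<kappa>\<bar> \<le> D * slow_radius n"
  shows "two_sided_tail n \<kappa>' u \<le> exp (D * e) * two_sided_tail n \<kappa> u"
proof -
  have "\<bar>- \<kappa>' - - \<kappa>\<bar> \<le> D * slow_radius n" using assms(5) by (simp add: abs_minus_commute)
  from moderate_tail_skew_change[OF assms] moderate_tail_skew_change[OF assms(1-4) this] show ?thesis
    unfolding two_sided_tail_def distrib_left by (rule add_mono)
qed

lemma continuous_on_two_sided_tail:
  assumes "0 < n" "0 < a"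
  shows "continuous_on {a..b} (two_sided_tail n \<kappa>)"
  unfolding two_sided_tail_def moderate_tail_def using assms
  by (intro continuous_intros) auto

lemma two_sided_tail_lower:
  assumes "0 < u"
  shows "exp (- u\<^sup>2 / 2) * std_normal_density 0 / u \<le> two_sided_tail n \<kappa> u"
proof -
  define x where "x = \<kappa> * u ^ 3 / (3 * sqrt n)"
  have "exp (- u\<^sup>2 / 2) \<le> exp (- u\<^sup>2 / 2 - x) + exp (- u\<^sup>2 / 2 + x)"
  proof (cases "0 \<le> x")
    case True
    hence "exp (- u\<^sup>2 / 2) \<le> exp (- u\<^sup>2 / 2 + x)" by simp
    thus ?thesis using exp_gt_zero[of "- u\<^sup>2 / 2 - x"] by linarith
  next
    case False
    hence "exp (- u\<^sup>2 / 2) \<le> exp (- u\<^sup>2 / 2 - x)" by simp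
    thus ?thesis using exp_gt_zero[of "- u\<^sup>2 / 2 + x"] by linarith
  qed
  hence "exp (- u\<^sup>2 / 2) * (std_normal_density 0 / u) \<le> (exp (- u\<^sup>2 / 2 - x) + exp (- u\<^sup>2 / 2 + x)) * (std_normal_density 0 / u)"
    using assms by (intro mult_right_mono) auto
  also have "\<dots> = two_sided_tail n \<kappa> u"
  proof -
    have "moderate_tail n \<kappa> u = exp (- u\<^sup>2 / 2 - x) * (std_normal_density 0 / u)"
      by (simp add: moderate_tail_def x_def)
    moreover have "moderate_tail n (- \<kappa>) u = exp (- u\<^sup>2 / 2 + x) * (std_normal_density 0 / u)"
      by (simp add: moderate_tail_def x_def)
    ultimately show ?thesis by (simp only: two_sided_tail_def distrib_right)
  qed
  finally show ?thesis by simp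
qed

lemma two_sided_tail_upper:
  assumes "0 < n" "1 \<le> u" "u\<^sup>2 = e * sqrt n" "1 \<le> e * sqrt n" "\<bar>\<kappa>\<bar> \<le> C" "C * e \<le> 3 / 4" "1 \<le> C"
  shows "two_sided_tail n \<kappa> u \<le> exp (- (e / 4 * sqrt n))"
proof -
  have sn: "0 < sqrt n" using assms(1) by simp
  have ue: "u \<le> e * sqrt n"
  proof -
    have "u * 1 \<le> u * u" using assms by (intro mult_left_mono) auto
    thus ?thesis using assms(3) by (simp add: power2_eq_square)
  qed
  have *: "moderate_tail n k u \<le> exp (- (e / 4 * sqrt n)) * (1 / 2)" if k: "\<bar>k\<bar> \<le> C" for k
  proof -
    have "- (k * u ^ 3) \<le> C * (u\<^sup>2 * u)"
    proof -
      have "- k * u ^ 3 \<le> C * u ^ 3" using k assms by (intro mult_right_mono) auto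
      thus ?thesis by (simp add: power2_eq_square power3_eq_cube)
    qed
    also have "\<dots> \<le> C * (u\<^sup>2 * (e * sqrt n))" using assms ue by (intro mult_left_mono) auto
    also have "\<dots> = (C * e) * (u\<^sup>2 * sqrt n)" by simp
    also have "\<dots> \<le> 3 / 4 * (u\<^sup>2 * sqrt n)" using assms by (intro mult_right_mono) auto
    finally have "- (k * u ^ 3) \<le> u\<^sup>2 / 4 * (3 * sqrt n)" by simp
    hence "- (k * u ^ 3) / (3 * sqrt n) \<le> u\<^sup>2 / 4" using sn by (subst pos_divide_le_eq) auto
    hence a: "exp (- u\<^sup>2 / 2 - k * u ^ 3 / (3 * sqrt n)) \<le> exp (- (e / 4 * sqrt n))"
      using assms(3) by simp
    have "std_normal_density 0 \<le> 1 / 2"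
    proof -
      have "sqrt (2\<^sup>2) \<le> sqrt (2 * pi)" using pi_gt3 by (intro real_sqrt_le_mono) simp
      hence "2 \<le> sqrt (2 * pi)" by (simp only: real_sqrt_abs abs_numeral)
      thus ?thesis unfolding std_normal_density_def by (simp add: field_simps)
    qed
    hence "std_normal_density 0 / u \<le> 1 / 2" using assms
      by (simp add: divide_le_eq)
    hence "exp (- u\<^sup>2 / 2 - k * u ^ 3 / (3 * sqrt n)) * (std_normal_density 0 / u) \<le> exp (- (e / 4 * sqrt n)) * (1 / 2)"
      using a assms by (intro mult_mono) auto
    thus ?thesis by (simp add: moderate_tail_def)
  qed
  show ?thesis using *[of \<kappa>] *[of "- \<kappa>"] assms unfolding two_sided_tail_def by simp
qed

context std_law
begin

definition regular_samples :: "nat \<Rightarrow> (nat \<Rightarrow> real) set" where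
  "regular_samples n = {y \<in> space (sample_law n). (\<forall>j\<in>{1..n}. \<bar>y j\<bar> \<le> C) \<and>
     \<bar>raw_moment n 1 y\<bar> < slow_radius n \<and> \<bar>raw_moment n 2 y - 1\<bar> < slow_radius n \<and> \<bar>raw_moment n 3 y - skew\<bar> < slow_radius n}"

lemma regular_samples_sets [measurable]: "regular_samples n \<in> sets (sample_law n)"
  unfolding regular_samples_def by measurable

lemma prob_not_regular:
  assumes n: "0 < n"
  shows "measure (sample_law n) (space (sample_law n) - regular_samples n) \<le> 6 * exp (- (sqrt n / (2 * C ^ 6)))"
proof -
  interpret P: prob_space "sample_law n" by (rule prob_space_sample_law)
  let ?S = "space (sample_law n)"
  define b where "b = exp (- (sqrt n / (2 * C ^ 6)))"
  define D where "D k = {y \<in> ?S. slow_radius n \<le> \<bar>raw_moment n k y - (\<integral>x. x ^ k \<partial>\<nu>)\<bar>}" for k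
  have D: "P.prob (D k) \<le> 2 * b" if "k \<le> 3" for k
    unfolding D_def b_def by (rule moment_deviation_slow[OF n that])
  have [measurable]: "D k \<in> P.events" for k unfolding D_def by measurable
  have bdd: "AE y in sample_law n. \<forall>j\<in>{1..n}. \<bar>y j\<bar> \<le> C"
    by (subst AE_finite_all) (auto intro!: AE_PiM_component[where P = "\<lambda>x. \<bar>x\<bar> \<le> C"] prob_space_axioms bounded_law)
  have "P.prob (?S - regular_samples n) \<le> P.prob (D 1 \<union> (D 2 \<union> D 3))"
  proof (rule P.finite_measure_mono_AE)
    show "AE y in sample_law n. y \<in> ?S - regular_samples n \<longrightarrow> y \<in> D 1 \<union> (D 2 \<union> D 3)"
      using bdd by eventually_elim
        (auto simp: regular_samples_def D_def mean_law variance_law skew_def not_less)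
  qed measurable
  also have "\<dots> \<le> P.prob (D 1) + P.prob (D 2 \<union> D 3)" by (rule measure_Un_le) measurable
  also have "P.prob (D 2 \<union> D 3) \<le> P.prob (D 2) + P.prob (D 3)" by (rule measure_Un_le) measurable
  finally show ?thesis using D[of 1] D[of 2] D[of 3] by (simp add: b_def)
qed

lemma regular_samples_empirical:
  assumes n: "256 \<le> n" and y: "y \<in> regular_samples n"
  shows "0 < sample_sd n y" "std_law (empirical_law n y) (4 * C)"
    and "\<bar>std_law.skew (empirical_law n y) - skew\<bar> \<le> 160 * C * slow_radius n"
proof -
  have n0: "0 < n" using n by simp
  have r: "slow_radius n \<le> 1 / 4"
  proof -
    have "sqrt (16\<^sup>2) \<le> sqrt n" using n by (intro real_sqrt_le_mono) simp
    hence "16 \<le> sqrt n" by (simp only: real_sqrt_abs abs_numeral)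
    hence "sqrt (4\<^sup>2) \<le> sqrt (sqrt n)" by (intro real_sqrt_le_mono) simp
    hence "4 \<le> sqrt (sqrt n)" by (simp only: real_sqrt_abs abs_numeral)
    thus ?thesis unfolding slow_radius_def using n0 by (intro divide_left_mono) auto
  qed
  define m where "m = sample_mean n y"
  define S where "S = sample_sd n y"
  have m: "\<bar>m\<bar> \<le> slow_radius n" "\<bar>raw_moment n 2 y - 1\<bar> \<le> slow_radius n" "\<bar>raw_moment n 3 y - skew\<bar> \<le> slow_radius n"
    and yC: "\<And>j. j \<in> {1..n} \<Longrightarrow> \<bar>y j\<bar> \<le> C"
    using y raw_moment_1[of n y] by (auto simp: regular_samples_def m_def)
  have S_eq: "S = sqrt (raw_moment n 2 y - m\<^sup>2)" by (simp add: S_def m_def sample_sd_eq[OF n0])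
  note close = sample_skew_close[OF m r abs_skew_le C_ge_1, folded S_eq]
  have S: "1 / 2 \<le> S" by (rule close(1))
  show S0: "0 < sample_sd n y" using S by (simp add: S_def)
  have bd: "\<bar>(y j - sample_mean n y) / sample_sd n y\<bar> \<le> 4 * C" if "j \<in> {1..n}" for j
  proof -
    have "\<bar>y j - m\<bar> \<le> 2 * C" using yC[OF that] m(1) r C_ge_1 unfolding abs_le_iff by linarith
    also have "\<dots> = 4 * C * (1 / 2)" by simp
    also have "\<dots> \<le> 4 * C * S" using S C_nonneg by (intro mult_left_mono) auto
    finally show ?thesis using S0 by (simp add: abs_divide divide_le_eq m_def S_def)
  qed
  show "std_law (empirical_law n y) (4 * C)" by (rule empirical_law_std_law(1)[OF n0 S0 bd])
  show "\<bar>std_law.skew (empirical_law n y) - skew\<bar> \<le> 160 * C * slow_radius n"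
    using close(2) empirical_law_std_law(2)[OF n0 S0 bd] by (simp add: m_def S_def)
qed

end

lemma bootstrap_rejection:
  fixes \<eta> C :: real
  assumes \<eta>: "0 < \<eta>" "\<eta> \<le> 1 / 10" and C: "1 \<le> C"
  obtains e1 l1 :: real and n0 :: nat where "0 < e1" "0 < l1" "0 < n0"
    and "\<And>\<nu> n N \<alpha>. std_law \<nu> C \<Longrightarrow> n0 \<le> n \<Longrightarrow> 0 < N \<Longrightarrow> 0 < \<alpha> \<Longrightarrow> \<alpha> < 1 \<Longrightarrow>
      exp (- (e1 * sqrt (real n))) \<le> level N \<alpha> \<Longrightarrow> level N \<alpha> \<le> l1 \<Longrightarrow>
      \<bar>\<P>(y in power_measure n \<nu>. boot_crit n N y \<alpha> < \<bar>t_stat n y\<bar>)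
         - level N \<alpha>\<bar> \<le> 10 * \<eta> * level N \<alpha>"
proof -
  obtain ea ua na where a: "0 < ea" "1 \<le> ua" "ea \<le> 1 / 2" "0 < na"
    and ta: "\<And>\<nu> n u. std_law \<nu> C \<Longrightarrow> na \<le> n \<Longrightarrow> ua \<le> u \<Longrightarrow> u\<^sup>2 \<le> ea * sqrt (real n) \<Longrightarrow>
      \<bar>\<P>(y in power_measure n \<nu>. crit_arg n u < \<bar>t_stat n y\<bar>)
         - two_sided_tail n (std_law.skew \<nu>) u\<bar> \<le> \<eta> * two_sided_tail n (std_law.skew \<nu>) u"
    by (rule abs_t_stat_tail[OF \<eta>(1) C]) blast
  have C4: "1 \<le> 4 * C" using C by simp
  obtain eb ub nb where b: "0 < eb" "1 \<le> ub" "eb \<le> 1 / 2" "0 < nb"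
    and tb: "\<And>\<nu> n u. std_law \<nu> (4 * C) \<Longrightarrow> nb \<le> n \<Longrightarrow> ub \<le> u \<Longrightarrow> u\<^sup>2 \<le> eb * sqrt (real n) \<Longrightarrow>
      \<bar>\<P>(y in power_measure n \<nu>. crit_arg n u < \<bar>t_stat n y\<bar>)
         - two_sided_tail n (std_law.skew \<nu>) u\<bar> \<le> \<eta> * two_sided_tail n (std_law.skew \<nu>) u"
    by (rule abs_t_stat_tail[OF \<eta>(1) C4]) blast
  have C6: "0 < C ^ 6" using C by simp
  define Z where "Z = {ea, eb, ln (1 + \<eta>) / (160 * C), 3 / (4 * C), 1 / (4 * C ^ 6)}"
  define e where "e = Min Z"
  have Z: "finite Z" "Z \<noteq> {}" unfolding Z_def by (rule finite.intros | rule insert_not_empty)+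
  have ln: "0 < ln (1 + \<eta>)" using \<eta> by simp
  have e_le: "e \<le> z" if "z \<in> Z" for z unfolding e_def using Z(1) that by (rule Min_le)
  have pos: "0 < ln (1 + \<eta>) / (160 * C)" "0 < 3 / (4 * C)" "0 < 1 / (4 * C ^ 6)"
    using ln C C6 by (intro divide_pos_pos mult_pos_pos; simp)+
  have "\<forall>z\<in>Z. 0 < z" unfolding Z_def using a(1) b(1) pos by blast
  hence e0: "0 < e" unfolding e_def using Min_gr_iff[OF Z] by blast
  have e: "e \<le> ea" "e \<le> eb" "e \<le> ln (1 + \<eta>) / (160 * C)" "e \<le> 3 / (4 * C)" "e \<le> 1 / (4 * C ^ 6)"
    by (rule e_le, simp only: Z_def insert_iff simp_thms)+
  have e1: "e \<le> 1" using e a by linarith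
  have Ce: "C * e \<le> 3 / 4"
  proof -
    have "C * e \<le> C * (3 / (4 * C))" using e C by (intro mult_left_mono) auto
    thus ?thesis using C by simp
  qed
  have eln: "exp (160 * C * e) \<le> 1 + \<eta>"
  proof -
    have "160 * C * e \<le> 160 * C * (ln (1 + \<eta>) / (160 * C))" using e C by (intro mult_left_mono) auto
    hence "160 * C * e \<le> ln (1 + \<eta>)" using C by simp
    hence "exp (160 * C * e) \<le> exp (ln (1 + \<eta>))" by simp
    thus ?thesis using \<eta> by simp
  qed
  define U where "U = max ua ub"
  have U: "1 \<le> U" "ua \<le> U" "ub \<le> U" using a b by (auto simp: U_def)
  define l1 where "l1 = exp (- U\<^sup>2 / 2) * std_normal_density 0 / U / 2"
  have l1: "0 < l1" using U by (simp add: l1_def std_normal_density_def)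
  have "eventually (\<lambda>n. U\<^sup>2 \<le> e * sqrt (real n)) sequentially" by (rule eventually_mult_sqrt_ge[OF e0])
  moreover have "eventually (\<lambda>n. exp (- (e / 8 * sqrt (real n))) \<le> 1 / 2) sequentially"
    using e0 by (intro eventually_exp_sqrt_small) simp_all
  moreover have "eventually (\<lambda>n. exp (- (1 / (4 * C ^ 6) * sqrt (real n))) \<le> \<eta> / 6) sequentially"
    using pos(3) \<eta> by (intro eventually_exp_sqrt_small) simp_all
  moreover have "eventually (\<lambda>n. na + nb + 256 \<le> n) sequentially" by (rule eventually_ge_at_top)
  ultimately have "eventually (\<lambda>n. U\<^sup>2 \<le> e * sqrt (real n) \<and> exp (- (e / 8 * sqrt (real n))) \<le> 1 / 2 \<and>
      exp (- (1 / (4 * C ^ 6) * sqrt (real n))) \<le> \<eta> / 6 \<and> na + nb + 256 \<le> n) sequentially"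
    by eventually_elim blast
  then obtain n0 where n0: "\<And>n. n0 \<le> n \<Longrightarrow> U\<^sup>2 \<le> e * sqrt (real n) \<and> exp (- (e / 8 * sqrt (real n))) \<le> 1 / 2 \<and>
      exp (- (1 / (4 * C ^ 6) * sqrt (real n))) \<le> \<eta> / 6 \<and> na + nb + 256 \<le> n"
    unfolding eventually_sequentially by blast
  have e8: "0 < e / 8" using e0 by simp
  show ?thesis
  proof (rule that[OF e8 l1, of "Suc n0"])
    show "0 < Suc n0" by simp
    fix \<nu> n N \<alpha>
    assume nu: "std_law \<nu> C" and "Suc n0 \<le> n" and N: "0 < N" and \<alpha>: "0 < \<alpha>" "\<alpha> < 1"
      and lv: "exp (- (e / 8 * sqrt (real n))) \<le> level N \<alpha>" "level N \<alpha> \<le> l1"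
    interpret std_law \<nu> C by (rule nu)
    interpret P: prob_space "sample_law n" by (rule prob_space_sample_law)
    define l where "l = level N \<alpha>"
    define G where "G = two_sided_tail n skew"
    let ?S = "space (sample_law n)"
    have nn: "U\<^sup>2 \<le> e * sqrt n" "exp (- (e / 8 * sqrt n)) \<le> 1 / 2"
      "exp (- (1 / (4 * C ^ 6) * sqrt n)) \<le> \<eta> / 6" "na \<le> n" "nb \<le> n" "256 \<le> n"
      using n0[of n] \<open>Suc n0 \<le> n\<close> by auto
    have npos: "0 < n" using nn(6) by simp
    have sn: "0 < sqrt n" using npos by simp
    have l0: "0 < l" using lv(1) exp_gt_zero[of "- (e / 8 * sqrt n)"] unfolding l_def by linarith
    define Bad where "Bad = ?S - regular_samples n"
    have [measurable]: "Bad \<in> P.events" unfolding Bad_def by measurable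
    have bad: "P.prob Bad \<le> \<eta> * l"
    proof -
      have "P.prob Bad \<le> 6 * exp (- (sqrt n / (2 * C ^ 6)))"
        unfolding Bad_def by (rule prob_not_regular[OF npos])
      also have "exp (- (sqrt n / (2 * C ^ 6))) = exp (- (1 / (4 * C ^ 6) * sqrt n)) * exp (- (1 / (4 * C ^ 6) * sqrt n))"
        by (simp flip: exp_add)
      also have "\<dots> \<le> \<eta> / 6 * l"
      proof (rule mult_mono)
        have "e / 8 * sqrt n \<le> 1 / (4 * C ^ 6) * sqrt n" using e(5) e0 sn by (intro mult_right_mono) linarith+
        hence "exp (- (1 / (4 * C ^ 6) * sqrt n)) \<le> exp (- (e / 8 * sqrt n))" by simp
        thus "exp (- (1 / (4 * C ^ 6) * sqrt n)) \<le> l" using lv(1) unfolding l_def by linarith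
      qed (use nn \<eta> in auto)
      finally show ?thesis by simp
    qed
    have F: "\<bar>P.prob {y \<in> ?S. crit_arg n u < \<bar>t_stat n y\<bar>} - G u\<bar> \<le> \<eta> * G u"
      and c0: "0 < crit_arg n u"
      and Fhat: "\<And>y. y \<in> regular_samples n \<Longrightarrow> (1 - \<eta>) / (1 + \<eta>) * G u \<le> boot_tail n y (crit_arg n u)"
        "\<And>y. y \<in> regular_samples n \<Longrightarrow> boot_tail n y (crit_arg n u) \<le> (1 + \<eta>)\<^sup>2 * G u"
      if u: "U \<le> u" "u\<^sup>2 \<le> e * sqrt n" for u
    proof -
      have u1: "1 \<le> u" "0 < u" using u U by auto
      have ua: "u\<^sup>2 \<le> ea * sqrt n" "u\<^sup>2 \<le> eb * sqrt n"
      proof -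
        have "e * sqrt n \<le> ea * sqrt n" "e * sqrt n \<le> eb * sqrt n" using e sn by (intro mult_right_mono; simp)+
        thus "u\<^sup>2 \<le> ea * sqrt n" "u\<^sup>2 \<le> eb * sqrt n" using u(2) by linarith+
      qed
      show "\<bar>P.prob {y \<in> ?S. crit_arg n u < \<bar>t_stat n y\<bar>} - G u\<bar> \<le> \<eta> * G u"
        unfolding G_def using u U by (intro ta nu nn ua) auto
      have "u\<^sup>2 < n"
      proof -
        have "u\<^sup>2 \<le> 1 / 2 * sqrt n" using ua(1) mult_right_mono[OF a(3), of "sqrt n"] sn by linarith
        also have "\<dots> < 1 * sqrt n" using sn by (intro mult_strict_right_mono) auto
        also have "\<dots> \<le> sqrt n * sqrt n" using npos by (intro mult_right_mono) auto
        finally show ?thesis by simp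
      qed
      thus "0 < crit_arg n u" using u1 npos by (simp add: crit_arg_def)
      fix y assume y: "y \<in> regular_samples n"
      define E where "E = two_sided_tail n (std_law.skew (empirical_law n y)) u"
      note emp = regular_samples_empirical[OF nn(6) y]
      have "\<bar>boot_tail n y (crit_arg n u) - E\<bar> \<le> \<eta> * E"
        unfolding E_def boot_tail_eq_empirical[OF npos emp(1)] using u U by (intro tb emp nn ua) auto
      hence B: "(1 - \<eta>) * E \<le> boot_tail n y (crit_arg n u)" "boot_tail n y (crit_arg n u) \<le> (1 + \<eta>) * E"
        by (auto simp: abs_le_iff algebra_simps)
      have G0: "0 \<le> G u" "0 \<le> E"
        unfolding G_def E_def two_sided_tail_def moderate_tail_def using u1 by auto
      have "E \<le> exp (160 * C * e) * G u"
        unfolding E_def G_def by (rule two_sided_tail_skew_change[OF npos u1(2) u(2) e1 emp(3)])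
      also have "\<dots> \<le> (1 + \<eta>) * G u" using eln G0(1) by (rule mult_right_mono)
      finally have E1: "E \<le> (1 + \<eta>) * G u" .
      have "G u \<le> exp (160 * C * e) * E"
        unfolding E_def G_def using emp(3)
        by (intro two_sided_tail_skew_change[OF npos u1(2) u(2) e1]) (simp add: abs_minus_commute)
      also have "\<dots> \<le> (1 + \<eta>) * E" using eln G0 by (intro mult_right_mono) auto
      finally have E2: "G u / (1 + \<eta>) \<le> E" using \<eta> by (simp add: divide_le_eq mult.commute)
      have "(1 - \<eta>) * (G u / (1 + \<eta>)) \<le> (1 - \<eta>) * E" using E2 \<eta> by (intro mult_left_mono) auto
      thus "(1 - \<eta>) / (1 + \<eta>) * G u \<le> boot_tail n y (crit_arg n u)" using B by simp
      have "(1 + \<eta>) * E \<le> (1 + \<eta>) * ((1 + \<eta>) * G u)" using E1 \<eta> by (intro mult_left_mono) auto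
      thus "boot_tail n y (crit_arg n u) \<le> (1 + \<eta>)\<^sup>2 * G u" using B by (simp add: power2_eq_square mult.assoc)
    qed
    define V where "V = sqrt (e * sqrt n)"
    have V2: "V\<^sup>2 = e * sqrt n" using e0 sn by (simp add: V_def)
    have V0: "0 \<le> V" using e0 sn by (simp add: V_def)
    have UV: "U \<le> V" using nn(1) unfolding V2[symmetric] using V0 by (rule power2_le_imp_le)
    have GU: "2 * l \<le> G U"
    proof -
      have "2 * l \<le> 2 * l1" using lv by (simp add: l_def)
      also have "\<dots> \<le> G U" using two_sided_tail_lower[of U n skew] U by (simp add: l1_def G_def)
      finally show ?thesis .
    qed
    have GV: "G V \<le> l / 2"
    proof -
      have "1 \<le> V" using UV U by simp
      moreover have "1 \<le> e * sqrt n" using nn(1) U one_le_power[of U 2] by linarith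
      ultimately have "G V \<le> exp (- (e / 4 * sqrt n))"
        unfolding G_def using V2 abs_skew_le Ce C npos by (intro two_sided_tail_upper[where C = C]) auto
      also have "\<dots> = exp (- (e / 8 * sqrt n)) * exp (- (e / 8 * sqrt n))" by (simp flip: exp_add)
      also have "\<dots> \<le> l * (1 / 2)" using lv(1) nn(2) l0 unfolding l_def by (intro mult_mono) auto
      finally show ?thesis by simp
    qed
    have ivt: "\<exists>u\<ge>U. u \<le> V \<and> G u = c" if "l / 2 \<le> c" "c \<le> 2 * l" for c
    proof (rule IVT2')
      show "G V \<le> c" "c \<le> G U" using GU GV that by auto
      show "continuous_on {U..V} G" unfolding G_def using U npos by (intro continuous_on_two_sided_tail) auto
    qed (rule UV)
    have uV: "u\<^sup>2 \<le> e * sqrt n" if "U \<le> u" "u \<le> V" for u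
      unfolding V2[symmetric] using that U by (intro power_mono) auto
    define R where "R = {y \<in> ?S. boot_crit n N y \<alpha> < \<bar>t_stat n y\<bar>}"
    have [measurable]: "R \<in> P.events"
    proof -
      have sp: "?S = space (power_measure n borel)" by (simp add: space_PiM)
      have "sets (sample_law n) = sets (power_measure n borel)" by (intro sets_PiM_cong refl sets_law)
      thus ?thesis unfolding R_def sp using rejection_measurable[OF N \<alpha> npos] by simp
    qed
    have upper: "P.prob R \<le> (1 + 10 * \<eta>) * l"
    proof -
      define c where "c = (1 + \<eta>)\<^sup>2 / (1 - \<eta>)"
      have c: "1 \<le> c" "c \<le> 1 + 6 * \<eta>" "c \<le> 2"
      proof -
        have hh: "0 \<le> \<eta> * \<eta>" "\<eta> * \<eta> \<le> \<eta> / 10" using \<eta> mult_left_mono[OF \<eta>(2), of \<eta>] by auto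
        show "1 \<le> c" using \<eta> hh by (simp add: c_def power2_eq_square le_divide_eq algebra_simps)
        have "(1 + \<eta>)\<^sup>2 \<le> (1 + 6 * \<eta>) * (1 - \<eta>)" using hh \<eta> by (simp add: power2_eq_square algebra_simps)
        thus "c \<le> 1 + 6 * \<eta>" using \<eta> by (simp add: c_def divide_le_eq)
        thus "c \<le> 2" using \<eta> by simp
      qed
      have "l / 2 \<le> c * l" "c * l \<le> 2 * l" using c l0 by auto
      then obtain u where u: "U \<le> u" "u \<le> V" "G u = c * l" using ivt by blast
      note u' = u(1) uV[OF u(1,2)]
      have "R \<subseteq> {y \<in> ?S. crit_arg n u < \<bar>t_stat n y\<bar>} \<union> Bad"
      proof
        fix y assume y: "y \<in> R"
        show "y \<in> {y \<in> ?S. crit_arg n u < \<bar>t_stat n y\<bar>} \<union> Bad"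
        proof (cases "y \<in> regular_samples n")
          case True
          have "l < (1 + \<eta>) * l" using l0 \<eta> by simp
          also have "\<dots> = (1 - \<eta>) / (1 + \<eta>) * G u"
          proof -
            have "q / p * (p\<^sup>2 / q * l) = p * l" if "0 < p" "0 < q" for p q :: real
              using that by (simp add: power2_eq_square)
            from this[of "1 + \<eta>" "1 - \<eta>"] show ?thesis unfolding u(3) c_def using \<eta> by simp
          qed
          also have "\<dots> \<le> boot_tail n y (crit_arg n u)" by (rule Fhat(1)[OF u' True])
          finally have "crit_arg n u \<le> boot_crit n N y \<alpha>"
            unfolding l_def by (intro boot_crit_ge[OF N \<alpha> c0[OF u']])
          thus ?thesis using y by (simp add: R_def)
        qed (use y in \<open>simp add: R_def Bad_def\<close>)
      qed
      hence "P.prob R \<le> P.prob ({y \<in> ?S. crit_arg n u < \<bar>t_stat n y\<bar>} \<union> Bad)"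
        by (intro P.finite_measure_mono) measurable
      also have "\<dots> \<le> P.prob {y \<in> ?S. crit_arg n u < \<bar>t_stat n y\<bar>} + P.prob Bad"
        by (rule measure_Un_le) measurable
      also have "\<dots> \<le> (1 + \<eta>) * (c * l) + \<eta> * l"
        using F[OF u'] bad unfolding u(3) by (simp add: abs_le_iff algebra_simps)
      also have "\<dots> \<le> (1 + \<eta>) * ((1 + 6 * \<eta>) * l) + \<eta> * l"
        using c l0 \<eta> by (intro add_mono mult_left_mono mult_right_mono) auto
      also have "\<dots> = (1 + 8 * \<eta> + 6 * (\<eta> * \<eta>)) * l" by (simp add: algebra_simps)
      also have "\<dots> \<le> (1 + 10 * \<eta>) * l"
        using \<eta> l0 mult_left_mono[OF \<eta>(2), of \<eta>] by (intro mult_right_mono) auto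
      finally show ?thesis .
    qed
    have lower: "(1 - 10 * \<eta>) * l \<le> P.prob R"
    proof -
      define c where "c = 1 / (1 + \<eta>)\<^sup>2"
      have p1: "0 < (1 + \<eta>)\<^sup>2" using \<eta> by simp
      have c: "1 - 2 * \<eta> \<le> c" "c \<le> 1" "1 / 2 \<le> c"
      proof -
        have hh: "0 \<le> \<eta> * \<eta>" "0 \<le> \<eta> * (\<eta> * \<eta>)" using \<eta> by auto
        have "(1 - 2 * \<eta>) * (1 + \<eta>)\<^sup>2 = 1 - 3 * (\<eta> * \<eta>) - 2 * (\<eta> * (\<eta> * \<eta>))"
          by (simp add: power2_eq_square algebra_simps)
        hence "(1 - 2 * \<eta>) * (1 + \<eta>)\<^sup>2 \<le> 1" using hh by linarith
        thus "1 - 2 * \<eta> \<le> c" unfolding c_def using p1 by (subst pos_le_divide_eq)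
        thus "1 / 2 \<le> c" using \<eta> by simp
        have "1 \<le> (1 + \<eta>)\<^sup>2" using \<eta> by (intro one_le_power) simp
        thus "c \<le> 1" unfolding c_def by (simp add: divide_le_eq)
      qed
      have "l / 2 \<le> c * l" "c * l \<le> 2 * l" using c l0 mult_right_mono[OF c(3), of l] mult_right_mono[OF c(2), of l] by auto
      then obtain u where u: "U \<le> u" "u \<le> V" "G u = c * l" using ivt by blast
      note u' = u(1) uV[OF u(1,2)]
      have "{y \<in> ?S. crit_arg n u < \<bar>t_stat n y\<bar>} \<subseteq> R \<union> Bad"
      proof
        fix y assume y: "y \<in> {y \<in> ?S. crit_arg n u < \<bar>t_stat n y\<bar>}"
        show "y \<in> R \<union> Bad"
        proof (cases "y \<in> regular_samples n")
          case True
          have "boot_tail n y (crit_arg n u) \<le> (1 + \<eta>)\<^sup>2 * G u" by (rule Fhat(2)[OF u' True])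
          also have "\<dots> = l" unfolding u(3) c_def using p1 by simp
          finally have "boot_crit n N y \<alpha> \<le> crit_arg n u"
            unfolding l_def by (intro boot_crit_le[OF N \<alpha> c0[OF u']])
          thus ?thesis using y by (simp add: R_def)
        qed (use y in \<open>simp add: Bad_def\<close>)
      qed
      hence "P.prob {y \<in> ?S. crit_arg n u < \<bar>t_stat n y\<bar>} \<le> P.prob (R \<union> Bad)"
        by (intro P.finite_measure_mono) measurable
      also have "\<dots> \<le> P.prob R + P.prob Bad" by (rule measure_Un_le) measurable
      finally have "(1 - \<eta>) * (c * l) \<le> P.prob R + \<eta> * l"
        using F[OF u'] bad unfolding u(3) by (simp add: abs_le_iff algebra_simps)
      moreover have "(1 - \<eta>) * ((1 - 2 * \<eta>) * l) \<le> (1 - \<eta>) * (c * l)"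
        using c l0 \<eta> by (intro mult_left_mono mult_right_mono) auto
      moreover have "(1 - 10 * \<eta>) * l \<le> (1 - \<eta>) * ((1 - 2 * \<eta>) * l) - \<eta> * l"
      proof -
        have "(1 - \<eta>) * ((1 - 2 * \<eta>) * l) - \<eta> * l = (1 - 4 * \<eta> + 2 * (\<eta> * \<eta>)) * l" by (simp add: algebra_simps)
        moreover have "(1 - 10 * \<eta>) * l \<le> (1 - 4 * \<eta> + 2 * (\<eta> * \<eta>)) * l"
          using \<eta> l0 by (intro mult_right_mono) (auto simp: add_nonneg_nonneg)
        ultimately show ?thesis by simp
      qed
      ultimately show ?thesis by linarith
    qed
    show "\<bar>P.prob {y \<in> ?S. boot_crit n N y \<alpha> < \<bar>t_stat n y\<bar>} - level N \<alpha>\<bar> \<le> 10 * \<eta> * level N \<alpha>"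
      using upper lower unfolding R_def l_def by (simp add: abs_le_iff algebra_simps)
  qed
qed

lemma (in prob_space) standardized_law:
  fixes X :: "'a \<Rightarrow> real" and C :: real
  assumes [measurable]: "random_variable borel X"
    and int: "integrable M X" "expectation X = 0"
    and var: "0 < expectation (\<lambda>\<omega>. (X \<omega>)\<^sup>2)"
    and bd: "prob {\<omega> \<in> space M. \<bar>X \<omega> / sqrt (expectation (\<lambda>\<omega>. (X \<omega>)\<^sup>2))\<bar> \<le> C} = 1"
  shows "std_law (distr M borel (\<lambda>\<omega>. X \<omega> / sqrt (expectation (\<lambda>\<omega>. (X \<omega>)\<^sup>2)))) C"
proof -
  define s where "s = sqrt (expectation (\<lambda>\<omega>. (X \<omega>)\<^sup>2))"
  have s: "0 < s" "s\<^sup>2 = expectation (\<lambda>\<omega>. (X \<omega>)\<^sup>2)" using var by (auto simp: s_def)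
  interpret D: prob_space "distr M borel (\<lambda>\<omega>. X \<omega> / s)" by (rule prob_space_distr) measurable
  have i: "(\<integral>x. f x \<partial>distr M borel (\<lambda>\<omega>. X \<omega> / s)) = expectation (\<lambda>\<omega>. f (X \<omega> / s))"
    if [measurable]: "f \<in> borel_measurable borel" for f :: "real \<Rightarrow> real"
    by (rule integral_distr) measurable
  have "std_law (distr M borel (\<lambda>\<omega>. X \<omega> / s)) C"
  proof
    have "AE \<omega> in M. \<bar>X \<omega> / s\<bar> \<le> C"
      using bd unfolding s_def[symmetric] by (subst (asm) prob_Collect_eq_1) measurable
    thus "AE x in distr M borel (\<lambda>\<omega>. X \<omega> / s). \<bar>x\<bar> \<le> C" by (subst AE_distr_iff) auto
    show "(\<integral>x. x \<partial>distr M borel (\<lambda>\<omega>. X \<omega> / s)) = 0" by (simp add: i int)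
    have "(\<integral>x. x\<^sup>2 \<partial>distr M borel (\<lambda>\<omega>. X \<omega> / s)) = expectation (\<lambda>\<omega>. (X \<omega>)\<^sup>2 / s\<^sup>2)"
      by (simp add: i power_divide)
    also have "\<dots> = 1" using s(2) var by simp
    finally show "(\<integral>x. x\<^sup>2 \<partial>distr M borel (\<lambda>\<omega>. X \<omega> / s)) = 1" .
  qed simp
  thus ?thesis by (simp add: s_def)
qed

lemma (in prob_space) rejection_prob_eq:
  fixes X :: "nat \<Rightarrow> 'a \<Rightarrow> real" and c \<alpha> :: real
  assumes n: "0 < n" and N: "0 < N" and \<alpha>: "0 < \<alpha>" "\<alpha> < 1" and c: "0 < c"
    and ind: "indep_vars (\<lambda>_. borel) X {1..n}"
    and d: "\<And>j. j \<in> {1..n} \<Longrightarrow> distr M borel (X j) = distr M borel (X 1)"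
  defines "\<nu> \<equiv> distr M borel (\<lambda>\<omega>. X 1 \<omega> / c)"
  shows "rejection_prob M n N \<alpha> 0 X = \<P>(y in power_measure n \<nu>. boot_crit n N y \<alpha> < \<bar>t_stat n y\<bar>)"
proof -
  have rv: "random_variable borel (X j)" if "j \<in> {1..n}" for j
    using ind that unfolding indep_vars_def by blast
  have one: "1 \<in> {1..n}" using n by auto
  define Y where "Y j \<omega> = X j \<omega> / c" for j \<omega>
  have indY: "indep_vars (\<lambda>_. borel) Y {1..n}"
    unfolding Y_def by (rule indep_vars_compose2[OF ind]) measurable
  have dY': "distr M borel (Y j) = distr (distr M borel (X j)) borel (\<lambda>x. x / c)" if "j \<in> {1..n}" for j
    using rv[OF that] by (subst distr_distr) (auto simp: Y_def[abs_def] comp_def)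
  have dY: "distr M borel (Y j) = \<nu>" if "j \<in> {1..n}" for j
    using dY'[OF that] dY'[OF one] d[OF that] by (simp add: \<nu>_def Y_def[abs_def])
  define A where "A = {y \<in> space (power_measure n borel). boot_crit n N y \<alpha> < \<bar>t_stat n y\<bar>}"
  have A: "A \<in> sets (power_measure n borel)" unfolding A_def by (rule rejection_measurable[OF N \<alpha> n])
  have mem: "(\<lambda>j\<in>{1..n}. Y j \<omega>) \<in> A \<longleftrightarrow> boot_crit n N (\<lambda>j. 0 + X j \<omega>) \<alpha> < \<bar>t_stat n (\<lambda>j. 0 + X j \<omega>)\<bar>" for \<omega>
  proof -
    have ic: "0 < 1 / c" using c by simp
    have t: "t_stat n (\<lambda>j\<in>{1..n}. Y j \<omega>) = t_stat n (\<lambda>j. X j \<omega>)"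
      using t_stat_restrict[of n "\<lambda>j. Y j \<omega>"] t_stat_scale[OF ic, of n "\<lambda>j. X j \<omega>"] by (simp add: Y_def)
    have "boot_tail n (\<lambda>j\<in>{1..n}. Y j \<omega>) z = boot_tail n (\<lambda>j. X j \<omega>) z" for z
    proof -
      have "boot_tail n (\<lambda>j\<in>{1..n}. Y j \<omega>) z = boot_tail n (\<lambda>j. 1 / c * X j \<omega>) z"
        by (rule boot_tail_cong[OF n]) (simp add: Y_def)
      also have "\<dots> = boot_tail n (\<lambda>j. X j \<omega>) z" by (rule boot_tail_scale[OF n ic])
      finally show ?thesis .
    qed
    hence "boot_crit n N (\<lambda>j\<in>{1..n}. Y j \<omega>) \<alpha> = boot_crit n N (\<lambda>j. X j \<omega>) \<alpha>" by (rule boot_crit_cong)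
    moreover have "(\<lambda>j\<in>{1..n}. Y j \<omega>) \<in> space (power_measure n borel)"
      by (simp add: space_PiM)
    ultimately show ?thesis unfolding A_def mem_Collect_eq t by simp
  qed
  have "rejection_prob M n N \<alpha> 0 X = prob {\<omega> \<in> space M. (\<lambda>j\<in>{1..n}. Y j \<omega>) \<in> A}"
    unfolding rejection_prob_def mem ..
  also have "\<dots> = measure (power_measure n \<nu>) A" by (rule iid_prob_eq[OF n indY dY A])
  also have "A = {y \<in> space (power_measure n \<nu>). boot_crit n N y \<alpha> < \<bar>t_stat n y\<bar>}"
    by (simp add: A_def space_PiM \<nu>_def)
  finally show ?thesis .
qed

lemma level_limits:
  fixes \<alpha> :: real and N :: "nat \<Rightarrow> nat"
  assumes \<alpha>: "0 < \<alpha>" "\<alpha> < 1" and N: "filterlim N at_top sequentially"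
  shows "(\<lambda>n. real (N n) * level (N n) \<alpha>) \<longlonglongrightarrow> - ln (1 - \<alpha>)"
    and "(\<lambda>n. level (N n) \<alpha>) \<longlonglongrightarrow> 0"
proof -
  define c where "c = ln (1 - \<alpha>)"
  have c: "c < 0" using \<alpha> by (simp add: c_def)
  have lev: "level (N n) \<alpha> = 1 - exp (c / real (N n))" for n
    using \<alpha> by (simp add: level_def powr_def c_def)
  have RN: "filterlim (\<lambda>n. real (N n)) at_top sequentially"
    by (rule filterlim_compose[OF filterlim_real_sequentially N])
  have "((\<lambda>x::real. x * (1 - exp (c / x))) \<longlongrightarrow> - c) at_top" using c by real_asymp
  from filterlim_compose[OF this RN] show "(\<lambda>n. real (N n) * level (N n) \<alpha>) \<longlonglongrightarrow> - ln (1 - \<alpha>)"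
    by (simp add: lev c_def)
  have "((\<lambda>x::real. 1 - exp (c / x)) \<longlongrightarrow> 0) at_top" by real_asymp
  from filterlim_compose[OF this RN] show "(\<lambda>n. level (N n) \<alpha>) \<longlonglongrightarrow> 0"
    by (simp add: lev)
qed

lemma level_not_too_small:
  fixes \<alpha> e :: real and N :: "nat \<Rightarrow> nat"
  assumes \<alpha>: "0 < \<alpha>" "\<alpha> < 1" and N: "filterlim N at_top sequentially"
    and small: "(\<lambda>n. ln (real (N n))) \<in> o(\<lambda>n. sqrt (real n))" and e: "0 < e"
  shows "eventually (\<lambda>n. exp (- (e * sqrt (real n))) \<le> level (N n) \<alpha>) sequentially"
proof -
  define L where "L = - ln (1 - \<alpha>)"
  have L: "0 < L" using \<alpha> by (simp add: L_def)
  have e2: "0 < e / 2" using e by simp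
  have "eventually (\<lambda>n. L / 2 < real (N n) * level (N n) \<alpha>) sequentially"
    using level_limits(1)[OF \<alpha> N] L unfolding L_def[symmetric] by (intro order_tendstoD) auto
  moreover have "eventually (\<lambda>n. norm (ln (real (N n))) \<le> e / 2 * norm (sqrt (real n))) sequentially"
    by (rule landau_o.smallD[OF small e2])
  moreover have "eventually (\<lambda>n. exp (- (e / 2 * sqrt (real n))) \<le> L / 2) sequentially"
    using e L by (intro eventually_exp_sqrt_small) simp_all
  moreover have "eventually (\<lambda>n. 1 \<le> N n) sequentially"
    using N by (simp add: filterlim_at_top)
  ultimately show ?thesis
  proof eventually_elim
    case (elim n)
    define E where "E = exp (e / 2 * sqrt n)"
    have NE: "real (N n) \<le> E"
    proof -
      have "ln (real (N n)) \<le> e / 2 * sqrt n" using elim(2) by simp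
      hence "exp (ln (real (N n))) \<le> E" unfolding E_def by (simp only: exp_le_cancel_iff)
      thus ?thesis using elim(4) by simp
    qed
    have E0: "0 < E" by (simp add: E_def)
    have l0: "0 < level (N n) \<alpha>" using elim(4) \<alpha> by (intro level_bounds) auto
    have inv: "exp (- (e / 2 * sqrt n)) = 1 / E" unfolding E_def exp_minus by (simp only: inverse_eq_divide)
    have "1 / E \<le> L / 2" using elim(3) unfolding inv .
    also have "\<dots> \<le> real (N n) * level (N n) \<alpha>" using elim(1) by simp
    also have "\<dots> \<le> E * level (N n) \<alpha>" using NE l0 by (intro mult_right_mono) auto
    finally have "1 / E * (1 / E) \<le> level (N n) \<alpha>" using E0 by (simp add: field_simps)
    also have "1 / E * (1 / E) = exp (- (e * sqrt n))" unfolding inv[symmetric] by (simp flip: exp_add)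
    finally show ?case .
  qed
qed

theorem theorem3p3:
  fixes M :: "'a measure"
    and \<epsilon> :: "nat \<Rightarrow> nat \<Rightarrow> 'a \<Rightarrow> real"
    and \<alpha> C :: real
    and N :: "nat \<Rightarrow> nat"
    and p :: "nat \<Rightarrow> nat \<Rightarrow> real"
  assumes "prob_space M"
    and "0 < \<alpha>" and "\<alpha> < 1"
    and "\<And>i. i \<ge> 1 \<Longrightarrow> prob_space.indep_vars M (\<lambda>_. borel) (\<epsilon> i) {1..}"
    and "\<And>i j. i \<ge> 1 \<Longrightarrow> j \<ge> 1 \<Longrightarrow> distr M borel (\<epsilon> i j) = distr M borel (\<epsilon> i 1)"
    and "\<And>i. i \<ge> 1 \<Longrightarrow> integrable M (\<epsilon> i 1)"
    and "\<And>i. i \<ge> 1 \<Longrightarrow> integral\<^sup>L M (\<epsilon> i 1) = 0"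
    and "\<And>i. i \<ge> 1 \<Longrightarrow> integrable M (\<lambda>\<omega>. (\<epsilon> i 1 \<omega>)\<^sup>2)"
    and "\<And>i. i \<ge> 1 \<Longrightarrow> 0 < integral\<^sup>L M (\<lambda>\<omega>. (\<epsilon> i 1 \<omega>)\<^sup>2)"
    and "C > 0"
    and "\<And>i. i \<ge> 1 \<Longrightarrow>
           measure M {\<omega> \<in> space M. \<bar>\<epsilon> i 1 \<omega> / sqrt (integral\<^sup>L M (\<lambda>\<omega>. (\<epsilon> i 1 \<omega>)\<^sup>2))\<bar> \<le> C} = 1"
    and "filterlim N at_top sequentially"
    and "(\<lambda>n. ln (real (N n))) \<in> o(\<lambda>n. sqrt (real n))"
    and p_def: "\<And>n i. p n i = rejection_prob M n (N n) \<alpha> 0 (\<epsilon> i)"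
  shows "(\<lambda>n. Max (p n ` {1..N n})) \<longlonglongrightarrow> 0
         \<and> (\<lambda>n. \<Sum>i=1..N n. p n i) \<longlonglongrightarrow> - ln (1 - \<alpha>)"
proof -
  interpret prob_space M by (rule assms(1))
  note \<alpha> = \<open>0 < \<alpha>\<close> \<open>\<alpha> < 1\<close>
  have rv: "random_variable borel (\<epsilon> i 1)" if "i \<ge> 1" for i
    using assms(4)[OF that] unfolding indep_vars_def by auto
  define sd where "sd i = sqrt (integral\<^sup>L M (\<lambda>\<omega>. (\<epsilon> i 1 \<omega>)\<^sup>2))" for i
  define \<nu> where "\<nu> i = distr M borel (\<lambda>\<omega>. \<epsilon> i 1 \<omega> / sd i)" for i
  have sd: "0 < sd i" if "i \<ge> 1" for i using assms(9)[OF that] by (simp add: sd_def)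
  have law: "std_law (\<nu> i) C" if "i \<ge> 1" for i
    unfolding \<nu>_def sd_def
    by (rule standardized_law[OF rv[OF that] assms(6)[OF that] assms(7)[OF that] assms(9)[OF that] assms(11)[OF that]])
  have C: "1 \<le> C" using std_law.C_ge_1[OF law[of 1]] by simp
  have p_eq: "p n i = \<P>(y in power_measure n (\<nu> i). boot_crit n (N n) y \<alpha> < \<bar>t_stat n y\<bar>)"
    if "i \<ge> 1" "0 < n" "0 < N n" for n i
    unfolding p_def \<nu>_def
  proof (rule rejection_prob_eq[OF that(2,3) \<alpha> sd[OF that(1)]])
    show "indep_vars (\<lambda>_. borel) (\<epsilon> i) {1..n}"
      using assms(4)[OF that(1)] by (rule indep_vars_subset) auto
    show "distr M borel (\<epsilon> i j) = distr M borel (\<epsilon> i 1)" if "j \<in> {1..n}" for j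
      using assms(5)[OF \<open>i \<ge> 1\<close>, of j] that by simp
  qed
  define l where "l n = level (N n) \<alpha>" for n
  define L where "L = - ln (1 - \<alpha>)"
  have L: "0 < L" using \<alpha> by (simp add: L_def)
  have lim: "(\<lambda>n. real (N n) * l n) \<longlonglongrightarrow> L" "l \<longlonglongrightarrow> 0"
    using level_limits[OF \<alpha> assms(12)] unfolding l_def[abs_def] L_def by auto
  have Npos: "eventually (\<lambda>n. 1 \<le> N n) sequentially"
    using assms(12) by (simp add: filterlim_at_top)
  have close: "eventually (\<lambda>n. 1 \<le> N n \<and> 0 < l n \<and> (\<forall>i\<ge>1. \<bar>p n i - l n\<bar> \<le> 10 * \<eta> * l n)) sequentially"
    if \<eta>: "0 < \<eta>" "\<eta> \<le> 1 / 10" for \<eta>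
  proof -
    obtain e1 l1 n0 where b: "0 < e1" "0 < l1" "0 < n0"
      and br: "\<And>\<nu> n N \<alpha>. std_law \<nu> C \<Longrightarrow> n0 \<le> n \<Longrightarrow> 0 < N \<Longrightarrow> 0 < \<alpha> \<Longrightarrow> \<alpha> < 1 \<Longrightarrow>
      exp (- (e1 * sqrt (real n))) \<le> level N \<alpha> \<Longrightarrow> level N \<alpha> \<le> l1 \<Longrightarrow>
      \<bar>\<P>(y in power_measure n \<nu>. boot_crit n N y \<alpha> < \<bar>t_stat n y\<bar>)
         - level N \<alpha>\<bar> \<le> 10 * \<eta> * level N \<alpha>"
      by (rule bootstrap_rejection[OF \<eta> C]) blast
    have "eventually (\<lambda>n. l n < l1) sequentially" using lim(2) b(2) by (rule order_tendstoD)
    moreover have "eventually (\<lambda>n. exp (- (e1 * sqrt (real n))) \<le> l n) sequentially"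
      unfolding l_def by (rule level_not_too_small[OF \<alpha> assms(12,13) b(1)])
    ultimately show ?thesis using Npos eventually_ge_at_top[of n0]
    proof eventually_elim
      case (elim n)
      have n: "0 < n" "0 < N n" using elim b by auto
      have "\<bar>p n i - l n\<bar> \<le> 10 * \<eta> * l n" if "i \<ge> 1" for i
        unfolding p_eq[OF that n] l_def
        using elim n \<alpha> by (intro br law that) (auto simp: l_def)
      moreover have "0 < l n" unfolding l_def using n \<alpha> by (intro level_bounds) auto
      ultimately show ?case using elim by simp
    qed
  qed
  have "(\<lambda>n. Max (p n ` {1..N n})) \<longlonglongrightarrow> 0"
  proof (rule tendsto_sandwich)
    show "(\<lambda>n. 0) \<longlonglongrightarrow> (0::real)" by simp
    show "(\<lambda>n. 2 * l n) \<longlonglongrightarrow> 0" using tendsto_mult_left[OF lim(2), of 2] by simp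
    have *: "eventually (\<lambda>n. 1 \<le> N n \<and> 0 < l n \<and> (\<forall>i\<ge>1. \<bar>p n i - l n\<bar> \<le> 10 * (1 / 10) * l n)) sequentially"
      by (rule close) simp_all
    thus "eventually (\<lambda>n. 0 \<le> Max (p n ` {1..N n})) sequentially"
    proof eventually_elim
      case (elim n)
      have "p n 1 \<le> Max (p n ` {1..N n})" using elim by (intro Max_ge) auto
      moreover have "0 \<le> p n 1" by (simp add: p_def rejection_prob_def)
      ultimately show ?case by linarith
    qed
    show "eventually (\<lambda>n. Max (p n ` {1..N n}) \<le> 2 * l n) sequentially"
      using *
    proof eventually_elim
      case (elim n)
      have "p n i \<le> 2 * l n" if "i \<ge> 1" for i
      proof -
        have "\<bar>p n i - l n\<bar> \<le> 10 * (1 / 10) * l n" using elim that by blast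
        thus ?thesis by (simp add: abs_le_iff)
      qed
      thus ?case using elim by (subst Max_le_iff) auto
    qed
  qed
  moreover have "(\<lambda>n. \<Sum>i=1..N n. p n i) \<longlonglongrightarrow> L"
  proof (rule tendstoI)
    fix r :: real assume r: "0 < r"
    define \<eta> where "\<eta> = min (1 / 10) (r / (40 * L))"
    have \<eta>: "0 < \<eta>" "\<eta> \<le> 1 / 10" "\<eta> * (20 * L) \<le> r / 2"
    proof -
      show "0 < \<eta>" "\<eta> \<le> 1 / 10" using r L by (auto simp: \<eta>_def)
      have "\<eta> * (20 * L) \<le> r / (40 * L) * (20 * L)" using L by (intro mult_right_mono) (auto simp: \<eta>_def)
      thus "\<eta> * (20 * L) \<le> r / 2" using L by simp
    qed
    have "eventually (\<lambda>n. dist (real (N n) * l n) L < r / 2) sequentially"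
      by (rule tendstoD[OF lim(1)]) (use r in simp)
    moreover have "eventually (\<lambda>n. real (N n) * l n < 2 * L) sequentially"
      using lim(1) L by (intro order_tendstoD) auto
    ultimately show "eventually (\<lambda>n. dist (\<Sum>i=1..N n. p n i) L < r) sequentially"
      using close[OF \<eta>(1,2)]
    proof eventually_elim
      case (elim n)
      have "(\<Sum>i=1..N n. p n i) - real (N n) * l n = (\<Sum>i=1..N n. p n i - l n)"
        by (simp add: sum_subtractf)
      also have "\<bar>\<dots>\<bar> \<le> (\<Sum>i=1..N n. \<bar>p n i - l n\<bar>)" by (rule sum_abs)
      also have "\<dots> \<le> (\<Sum>i=1..N n. 10 * \<eta> * l n)" using elim by (intro sum_mono) auto
      also have "\<dots> = 10 * \<eta> * (real (N n) * l n)" by simp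
      also have "\<dots> \<le> 10 * \<eta> * (2 * L)" using elim \<eta> by (intro mult_left_mono) auto
      also have "\<dots> \<le> r / 2" using \<eta>(3) by simp
      finally show ?case using elim(1) unfolding dist_real_def by linarith
    qed
  qed
  ultimately show ?thesis unfolding L_def ..
qed

end
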